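(* Let $s\in(0,2)$, let $p\in(0,1]$, and suppose that the distribution function $F$ of $v$ satisfies $$\frac{1-F(tx)}{1-F(x)}\to t^{-s}\quad\text{as }x\to\infty,\ \text{for every }t>0.$$ Then $\dfrac{p^{-1/s}\,w_{0,n}}{b_n}\to w$ in distribution as $n\to\infty$.
   Context: Discrete model. Fix $p\in(0,1]$. For integers $i<j$ let $v_{i,j}>0$ be i.i.d. with the law of $v$, with distribution function $F$. Independently of the weights, each directed edge $(i,j)$, $i<j$, is present with probability $p$, independently of the others. $w_{0,n}$ is the maximum, over all sequences $0=i_0<i_1<\dots<i_l=n$ of integers such that every edge $(i_{k-1},i_k)$ is present, of $\sum_{k=1}^l v_{i_{k-1},i_k}$, with $w_{0,n}=-\infty$ if there is no such sequence (so convergence in distribution is for extended-real-valued random variables). Scaling. $b_n=F^{(-1)}\bigl(1-1/\binom{n+1}{2}\bigr)$, where $F^{(-1)}(u)=\inf\{x:F(x)\ge u\}$. Continuous model with index $s$. Let $W_1,W_2,\dots$ be i.i.d. exponential random variables with mean $1$ and $M_k=(W_1+\dots+W_k)^{-1/s}$. Let $U_1,U_2,\dots$ and $V_1,V_2,\dots$ be i.i.d. uniform on $[0,1]$, all independent of each other and of the $W_k$, and let $Y_i=(\min(U_i,V_i),\max(U_i,V_i))$. Two edges $x=(a,b)$, $y=(a',b')$ (with $a<b$, $a'<b'$) are compatible, written $x\sim y$, if $b\le a'$ or $b'\le a$. Let $\mathcal{C}$ be the (random) collection of all $A\subset\{1,2,\dots\}$ such that $Y_i\sim Y_j$ for all distinct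 $i,j\in A$, and $$w=\sup_{A\in\mathcal{C}}\sum_{i\in A}M_i ,$$ which is almost surely finite. *)

theory Defs
  imports "HOL-Probability.Probability"
begin

section \<open>Convergence in distribution\<close>

text \<open>The library's weak convergence (\<^const>\<open>weak_conv_m\<close>) is restricted to measures on the real
  line; the random variables here are extended-real-valued. The limit may live on a different
  probability space.\<close>

definition converges_in_distribution ::
  "'a measure \<Rightarrow> (nat \<Rightarrow> 'a \<Rightarrow> 'c::topological_space) \<Rightarrow> 'b measure \<Rightarrow> ('b \<Rightarrow> 'c) \<Rightarrow> bool" where
  "converges_in_distribution M X N Y \<longleftrightarrow>
     (\<forall>n. X n \<in> borel_measurable M) \<and> Y \<in> borel_measurable N \<and>
     (\<forall>f::'c \<Rightarrow> real. continuous_on UNIV f \<longrightarrow> bounded (range f) \<longrightarrow>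
        (\<lambda>n. \<integral>\<omega>. f (X n \<omega>) \<partial>M) \<longlonglongrightarrow> (\<integral>\<omega>. f (Y \<omega>) \<partial>N))"

section \<open>The discrete model\<close>

definition edges :: "(int \<times> int) set" where
  "edges = {(i, j). i < j}"

text \<open>\<open>e x \<omega>\<close> says that the edge \<open>x\<close> is present. Weights and edge indicators are jointly independent;
  the index set \<open>edges <+> edges\<close> merges them (with the indicators as \<open>0/1\<close>-valued reals) into one
  family. Independence includes measurability.\<close>

locale discrete_model = prob_space M for M :: "'a measure" +
  fixes p :: real and F :: "real \<Rightarrow> real"
    and v :: "int \<times> int \<Rightarrow> 'a \<Rightarrow> real" and e :: "int \<times> int \<Rightarrow> 'a \<Rightarrow> bool"
  assumes v_pos: "\<And>x. x \<in> edges \<Longrightarrow> AE \<omega> in M. 0 < v x \<omega>"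
    and v_cdf: "\<And>x. x \<in> edges \<Longrightarrow> cdf (distr M borel (v x)) = F"
    and e_prob: "\<And>x. x \<in> edges \<Longrightarrow> prob {\<omega> \<in> space M. e x \<omega>} = p"
    and indep: "indep_vars (\<lambda>_. borel)
          (case_sum v (\<lambda>x \<omega>. of_bool (e x \<omega>))) (edges <+> edges)"

text \<open>A path is recorded as the list \<open>[i\<^sub>0, \<dots>, i\<^sub>l]\<close> of its vertices.\<close>

definition paths :: "(int \<times> int \<Rightarrow> bool) \<Rightarrow> int \<Rightarrow> int \<Rightarrow> int list set" where
  "paths E a b = {is. is \<noteq> [] \<and> hd is = a \<and> last is = b \<and> sorted_wrt (<) is \<and>
     (\<forall>k. Suc k < length is \<longrightarrow> E (is ! k, is ! Suc k))}"

definition path_weight :: "(int \<times> int \<Rightarrow> real) \<Rightarrow> int list \<Rightarrow> real" where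
  "path_weight c is = (\<Sum>k<length is - 1. c (is ! k, is ! Suc k))"

text \<open>There are only finitely many paths, so the supremum is a maximum; in the extended reals the
  supremum of the empty set is \<open>-\<infinity>\<close>.\<close>

definition last_passage ::
  "(int \<times> int \<Rightarrow> 'a \<Rightarrow> real) \<Rightarrow> (int \<times> int \<Rightarrow> 'a \<Rightarrow> bool) \<Rightarrow> nat \<Rightarrow> 'a \<Rightarrow> ereal" where
  "last_passage v e n \<omega> =
     (SUP is \<in> paths (\<lambda>x. e x \<omega>) 0 (int n). ereal (path_weight (\<lambda>x. v x \<omega>) is))"

definition quantile :: "(real \<Rightarrow> real) \<Rightarrow> real \<Rightarrow> real" where
  "quantile F u = Inf {x. F x \<ge> u}"

text \<open>The level is in \<open>(0,1)\<close>, and hence the infimum meaningful, once \<open>n \<ge> 2\<close>.\<close>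

definition scaling :: "(real \<Rightarrow> real) \<Rightarrow> nat \<Rightarrow> real" where
  "scaling F n = quantile F (1 - 1 / real ((n + 1) choose 2))"

section \<open>The continuous model\<close>

text \<open>All sequences are indexed from \<open>0\<close> instead of \<open>1\<close>.\<close>

locale continuous_model = prob_space N for N :: "'b measure" +
  fixes W U V :: "nat \<Rightarrow> 'b \<Rightarrow> real"
  assumes W_distr: "\<And>k. distributed N lborel (W k) (exponential_density 1)"
    and U_distr: "\<And>i. distr N borel (U i) = uniform_measure lborel {0..1}"
    and V_distr: "\<And>i. distr N borel (V i) = uniform_measure lborel {0..1}"
    and indep: "indep_vars (\<lambda>_. borel) (case_sum W (case_sum U V)) UNIV"

definition weight :: "real \<Rightarrow> (nat \<Rightarrow> 'b \<Rightarrow> real) \<Rightarrow> nat \<Rightarrow> 'b \<Rightarrow> real" where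
  "weight s W k \<omega> = (\<Sum>i\<le>k. W i \<omega>) powr (- 1 / s)"

definition position ::
  "(nat \<Rightarrow> 'b \<Rightarrow> real) \<Rightarrow> (nat \<Rightarrow> 'b \<Rightarrow> real) \<Rightarrow> nat \<Rightarrow> 'b \<Rightarrow> real \<times> real" where
  "position U V i \<omega> = (min (U i \<omega>) (V i \<omega>), max (U i \<omega>) (V i \<omega>))"

definition compatible :: "real \<times> real \<Rightarrow> real \<times> real \<Rightarrow> bool" where
  "compatible x y \<longleftrightarrow> snd x \<le> fst y \<or> snd y \<le> fst x"

definition compatible_sets ::
  "(nat \<Rightarrow> 'b \<Rightarrow> real) \<Rightarrow> (nat \<Rightarrow> 'b \<Rightarrow> real) \<Rightarrow> 'b \<Rightarrow> nat set set" where
  "compatible_sets U V \<omega> =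
     {A. \<forall>i\<in>A. \<forall>j\<in>A. i \<noteq> j \<longrightarrow> compatible (position U V i \<omega>) (position U V j \<omega>)}"

definition continuous_last_passage ::
  "real \<Rightarrow> (nat \<Rightarrow> 'b \<Rightarrow> real) \<Rightarrow> (nat \<Rightarrow> 'b \<Rightarrow> real) \<Rightarrow> (nat \<Rightarrow> 'b \<Rightarrow> real) \<Rightarrow> 'b \<Rightarrow> ereal" where
  "continuous_last_passage s W U V \<omega> =
     (SUP A \<in> compatible_sets U V \<omega>. \<Sum>\<^sub>\<infinity>i\<in>A. ereal (weight s W i \<omega>))"

end

theory Submission
  imports Defs "HOL-Real_Asymp.Real_Asymp"
begin

text \<open>
  Let \<open>K\<close> be the number of edges inside \<open>{0..n}\<close>, set the weight of an absent edge to \<open>0\<close>, and write the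
  resulting i.i.d. weights as \<open>h (\<tau> x)\<close> with independent uniform labels \<open>\<tau> x\<close> and the non-increasing inverse
  \<open>h\<close> of the upper tail, so that \<open>x\<close> is present iff \<open>\<tau> x < p\<close>.

  The \<open>k\<close> heaviest edges have the \<open>k\<close> smallest labels. Their law has an explicit density with respect to
  the law of \<open>k\<close> uniform edges with the labels \<open>(W\<^sub>1 + \<dots> + W\<^sub>i) / K\<close>, and this density tends to \<open>1\<close>; by regular
  variation the rescaled weight \<open>h (t / K)\<close> tends to \<open>t powr (- 1 / s)\<close>. So the best chain among the \<open>k\<close> heaviest
  edges converges to the one of the continuous model.

  Such a chain extends to a path with high probability: its end points are far apart, and any two
  vertices at distance at least \<open>sqrt n\<close> are joined by a present path of two edges.

  The other edges contribute little. A chain of \<open>l\<close> edges has \<open>2 ^ l\<close> subchains, and the expected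
  number of chains among the edges of label at most \<open>q\<close> is at most \<open>(1 + 2 * sqrt q) ^ n\<close>; so the longest chain
  among the edges of label at most \<open>u / K\<close> has expected length of order \<open>sqrt u\<close>. Summing over dyadic scales,
  the terms \<open>u powr (- 1 / s) * sqrt u\<close> are summable since \<open>s < 2\<close>.
\<close>

section \<open>Regular variation of the weights\<close>

text \<open>The inverse of the upper tail of the weight of an edge, where absent edges have weight \<open>0\<close>. For
  \<open>u \<le> 0\<close> the infimum is over the empty set.\<close>

definition tail_inverse :: "(real \<Rightarrow> real) \<Rightarrow> real \<Rightarrow> real \<Rightarrow> real" where
  "tail_inverse F p u = Inf {x. 0 \<le> x \<and> p * (1 - F x) \<le> u}"

locale heavy_tail =
  fixes F :: "real \<Rightarrow> real" and s p :: real
  assumes F_mono: "mono F" and F_right_cont: "\<And>x. continuous (at_right x) F"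
    and F_at_top: "(F \<longlongrightarrow> 1) at_top" and F_zero: "F 0 = 0"
    and s_pos: "0 < s" and p_pos: "0 < p" and p_le: "p \<le> 1"
    and regularly_varying:
      "\<And>t. 0 < t \<Longrightarrow> ((\<lambda>x. (1 - F (t * x)) / (1 - F x)) \<longlongrightarrow> t powr (- s)) at_top"
begin

abbreviation "T x \<equiv> p * (1 - F x)"
abbreviation "h \<equiv> tail_inverse F p"

lemma F_le_1: "F x \<le> 1"
  using F_mono F_at_top by (intro tendsto_lowerbound[OF F_at_top])
    (auto simp: eventually_at_top_linorder mono_def)

lemma T_antimono: "x \<le> y \<Longrightarrow> T y \<le> T x"
  using F_mono p_pos by (auto simp: mono_def)

lemma F_less_1: "F x < 1"
proof (rule ccontr)
  assume "\<not> F x < 1"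
  then have "F y = 1" if "x \<le> y" for y
    using F_le_1[of y] F_mono that by (metis antisym linorder_not_less monoD order_trans)
  then have "eventually (\<lambda>y. (1 - F (1 * y)) / (1 - F y) = 0) at_top"
    by (auto simp: eventually_at_top_linorder)
  then have "((\<lambda>y. (1 - F (1 * y)) / (1 - F y)) \<longlongrightarrow> 0) at_top"
    by (rule tendsto_eventually)
  then have "(1::real) powr (- s) = 0"
    using regularly_varying[of 1] tendsto_unique[OF trivial_limit_at_top_linorder] by fastforce
  then show False by simp
qed

lemma T_pos: "0 < T x"
  using F_less_1 p_pos by simp

lemma T_at_top: "(T \<longlongrightarrow> 0) at_top"
  using F_at_top by (auto intro!: tendsto_eq_intros)

lemma
  assumes "0 < u"
  shows tail_inverse_in: "0 \<le> h u" "T (h u) \<le> u"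
    and tail_inverse_le: "0 \<le> x \<Longrightarrow> T x \<le> u \<Longrightarrow> h u \<le> x"
proof -
  let ?A = "{x. 0 \<le> x \<and> T x \<le> u}"
  have "eventually (\<lambda>x. T x < u \<and> 0 \<le> x) at_top"
    using order_tendstoD(2)[OF T_at_top assms] eventually_ge_at_top[of 0] by (rule eventually_conj)
  then obtain x0 where "T x0 < u" "0 \<le> x0"
    using eventually_happens'[OF trivial_limit_at_top_linorder] by blast
  then have ne: "?A \<noteq> {}" by (auto intro!: exI[of _ x0])
  have bdd: "bdd_below ?A" by (auto intro: bdd_belowI[of _ 0])
  show nn: "0 \<le> h u"
    unfolding tail_inverse_def by (rule cInf_greatest[OF ne]) auto
  show le: "h u \<le> x" if "0 \<le> x" "T x \<le> u" for x
    unfolding tail_inverse_def by (rule cInf_lower[OF _ bdd]) (use that in auto)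
  have gt: "T x \<le> u" if x: "h u < x" for x
  proof -
    obtain y where "y \<in> ?A" "y < x"
      using x ne unfolding tail_inverse_def by (meson cInf_lessD)
    then show ?thesis using T_antimono[of y x] by simp
  qed
  have "(T \<longlongrightarrow> T (h u)) (at_right (h u))"
    using F_right_cont[of "h u"] by (auto simp: continuous_within intro!: tendsto_intros)
  moreover have "eventually (\<lambda>x. T x \<le> u) (at_right (h u))"
    using gt by (auto simp: eventually_at_right_field intro!: exI[of _ "h u + 1"])
  ultimately show "T (h u) \<le> u"
    by (rule tendsto_upperbound) simp
qed

lemma tail_inverse_le_iff: "0 < u \<Longrightarrow> 0 \<le> x \<Longrightarrow> h u \<le> x \<longleftrightarrow> T x \<le> u"
  using tail_inverse_in(2)[of u] tail_inverse_le[of u x] T_antimono[of "h u" x] by fastforce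

lemma tail_inverse_antimono: "0 < u \<Longrightarrow> u \<le> u' \<Longrightarrow> h u' \<le> h u"
  using tail_inverse_in[of u] by (intro tail_inverse_le) auto

lemma tail_inverse_pos_iff: "0 < u \<Longrightarrow> 0 < h u \<longleftrightarrow> u < p"
  using tail_inverse_le_iff[of u 0] F_zero by (simp add: not_le[symmetric])

lemma tail_inverse_at_0: "filterlim h at_top (at_right 0)"
  unfolding filterlim_at_top_dense
proof
  fix Z :: real
  have "eventually (\<lambda>u. u \<in> {0<..<T (max Z 0)}) (at_right 0)"
    by (rule eventually_at_rightI) (use T_pos in auto)
  then show "eventually (\<lambda>u. Z < h u) (at_right 0)"
  proof eventually_elim
    case (elim u)
    then have "\<not> h u \<le> max Z 0"
      using tail_inverse_le_iff[of u "max Z 0"] by auto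
    then show ?case by simp
  qed
qed

lemma tail_ratio: "0 < t \<Longrightarrow> ((\<lambda>x. T (t * x) / T x) \<longlongrightarrow> t powr (- s)) at_top"
  using regularly_varying[of t] p_pos by simp

lemma tail_inverse_ratio:
  assumes "0 < l"
  shows "((\<lambda>u. h (l * u) / h u) \<longlongrightarrow> l powr (- 1 / s)) (at_right 0)"
proof (rule order_tendstoI)
  have u_pos: "eventually (\<lambda>u::real. 0 < u) (at_right 0)"
    by (simp add: eventually_at_right_less)
  have h_pos: "eventually (\<lambda>u. 0 < h u) (at_right 0)"
    using tail_inverse_at_0 by (simp add: filterlim_at_top_dense)
  have key: "(l powr (- 1 / s)) powr (- s) = l"
    using assms s_pos by (simp add: powr_powr)
  {
    fix a assume a: "l powr (- 1 / s) < a"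
    then obtain b where b: "l powr (- 1 / s) < b" "b < a" using dense by blast
    have b0: "0 < b" using b(1) powr_ge_zero by (meson le_less_trans)
    have "b powr (- s) < (l powr (- 1 / s)) powr (- s)"
      using b assms s_pos by (intro powr_less_mono2_neg) auto
    then have "b powr (- s) < l" using key by simp
    from order_tendstoD(2)[OF tail_ratio[OF b0] this]
    have "eventually (\<lambda>u. T (b * h u) / T (h u) < l) (at_right 0)"
      using tail_inverse_at_0 by (rule eventually_compose_filterlim)
    with u_pos h_pos show "eventually (\<lambda>u. h (l * u) / h u < a) (at_right 0)"
    proof eventually_elim
      case (elim u)
      have "T (b * h u) \<le> l * T (h u)"
        using elim(3) T_pos[of "h u"] by (simp only: pos_divide_less_eq less_imp_le)
      also have "\<dots> \<le> l * u"
        using tail_inverse_in(2)[OF elim(1)] assms by simp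
      finally have "h (l * u) \<le> b * h u"
        using elim assms b0 by (intro tail_inverse_le) auto
      then have "h (l * u) / h u \<le> b" using elim by (simp add: pos_divide_le_eq)
      then show ?case using b by simp
    qed
  }
  {
    fix a assume a: "a < l powr (- 1 / s)"
    show "eventually (\<lambda>u. a < h (l * u) / h u) (at_right 0)"
    proof (cases "a < 0")
      case True
      from u_pos h_pos show ?thesis
      proof eventually_elim
        case (elim u)
        have "0 \<le> h (l * u)" using tail_inverse_in(1)[of "l * u"] elim assms by simp
        then show ?case using True elim by (smt (verit) divide_nonneg_pos)
      qed
    next
      case False
      obtain b where b: "a < b" "b < l powr (- 1 / s)" using a dense by blast
      obtain c where c: "b < c" "c < l powr (- 1 / s)" using b dense by blast
      have pos: "0 < b" "0 < c" using b c False by auto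
      define z where "z = b / c"
      have z: "0 < z" "z < 1" using pos c by (auto simp: z_def)
      have "(l powr (- 1 / s)) powr (- s) < c powr (- s)"
        using c pos s_pos by (intro powr_less_mono2_neg) auto
      then have "l < c powr (- s)" using key by simp
      from order_tendstoD(1)[OF tail_ratio[OF pos(2)] this]
      have "eventually (\<lambda>u. l < T (c * (z * h u)) / T (z * h u)) (at_right 0)"
        by (rule eventually_compose_filterlim)
          (rule filterlim_tendsto_pos_mult_at_top[OF tendsto_const z(1) tail_inverse_at_0])
      with u_pos h_pos show ?thesis
      proof eventually_elim
        case (elim u)
        have "z * h u < h u" using z elim by simp
        then have "u < T (z * h u)"
          using tail_inverse_le_iff[OF elim(1), of "z * h u"] z elim by simp
        then have "l * u < l * T (z * h u)" using assms by simp
        also have "\<dots> < T (c * (z * h u))"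
          using elim(3) T_pos[of "z * h u"] by (simp only: pos_less_divide_eq)
        also have "c * (z * h u) = b * h u" using pos by (simp add: z_def)
        finally have "b * h u < h (l * u)"
          using tail_inverse_le_iff[of "l * u" "b * h u"] elim assms pos by simp
        then have "b < h (l * u) / h u" using elim by (simp add: pos_less_divide_eq)
        then show ?case using b by simp
      qed
    qed
  }
qed

lemma tail_inverse_doubling:
  assumes "s < 2"
  obtains \<rho> u0 where "0 < \<rho>" "\<rho> * sqrt 2 < 1" "0 < u0" "\<And>u. 0 < u \<Longrightarrow> u \<le> u0 \<Longrightarrow> h (2 * u) \<le> \<rho> * h u"
proof -
  have "(2::real) powr (- 1 / s) < 2 powr (- 1 / 2)"
    using assms s_pos by (intro powr_less_mono) (auto simp: field_simps)
  then obtain \<rho> where \<rho>: "(2::real) powr (- 1 / s) < \<rho>" "\<rho> < 2 powr (- 1 / 2)"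
    using dense by blast
  have pos: "0 < \<rho>" using \<rho>(1) by (meson le_less_trans powr_ge_zero)
  have "(2::real) powr (- 1 / 2) * sqrt 2 = 1"
    by (simp add: powr_half_sqrt[symmetric] powr_add[symmetric] flip: powr_minus)
  then have lt: "\<rho> * sqrt 2 < 1"
    using \<rho>(2) by (smt (verit) mult_strict_right_mono real_sqrt_gt_zero)
  have h_pos: "eventually (\<lambda>u. 0 < h u) (at_right 0)"
    using tail_inverse_at_0 by (simp add: filterlim_at_top_dense)
  have "eventually (\<lambda>u. h (2 * u) / h u < \<rho>) (at_right 0)"
    using tail_inverse_ratio[of 2] \<rho>(1) by (intro order_tendstoD) auto
  with h_pos have "eventually (\<lambda>u. h (2 * u) \<le> \<rho> * h u) (at_right 0)"
    by eventually_elim (simp add: pos_divide_less_eq)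
  then obtain b where "b > 0" "\<And>u. 0 < u \<Longrightarrow> u < b \<Longrightarrow> h (2 * u) \<le> \<rho> * h u"
    by (auto simp: eventually_at_right_field)
  then show ?thesis using pos lt by (intro that[of \<rho> "b / 2"]) auto
qed

lemma scaling_eq: "2 \<le> n \<Longrightarrow> scaling F n = h (p / real ((n + 1) choose 2))"
proof -
  assume n: "2 \<le> n"
  define K where "K = real ((n + 1) choose 2)"
  have "2 * 1 \<le> n * (n + 1) div 2" using n mult_le_mono[of 2 n 2 "n + 1"] by simp
  then have K: "1 < K" unfolding K_def by (simp add: choose_two mult.commute)
  have "1 - 1 / K \<le> F x \<longleftrightarrow> 0 \<le> x \<and> T x \<le> p / K" for x
  proof -
    have "0 \<le> x" if "1 - 1 / K \<le> F x"
    proof (rule ccontr)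
      assume "\<not> 0 \<le> x"
      then have "F x \<le> 0" using F_mono F_zero by (metis linorder_not_less monoD order_less_imp_le)
      then show False using that K mult_nonneg_nonpos[of K "F x"] by (simp add: field_simps)
    qed
    moreover have "1 - 1 / K \<le> F x \<longleftrightarrow> T x \<le> p / K"
      using mult_le_cancel_left_pos[OF p_pos, of "1 - F x" "1 / K"] by (simp add: algebra_simps)
    ultimately show ?thesis by blast
  qed
  then show ?thesis
    unfolding scaling_def quantile_def tail_inverse_def K_def[symmetric] by simp
qed

end

section \<open>Chains of edges and paths\<close>

definition nonoverlapping :: "'l::linorder \<times> 'l \<Rightarrow> 'l \<times> 'l \<Rightarrow> bool" where
  "nonoverlapping x y \<longleftrightarrow> snd x \<le> fst y \<or> snd y \<le> fst x"

definition edge_chains :: "('i \<Rightarrow> 'l::linorder \<times> 'l) \<Rightarrow> 'i set \<Rightarrow> 'i set set" where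
  "edge_chains pos I = {A. A \<subseteq> I \<and> pairwise (\<lambda>i j. nonoverlapping (pos i) (pos j)) A}"

definition max_weight :: "('i \<Rightarrow> 'l::linorder \<times> 'l) \<Rightarrow> ('i \<Rightarrow> real) \<Rightarrow> 'i set \<Rightarrow> real" where
  "max_weight pos c I = Max (sum c ` edge_chains pos I)"

definition edge_set :: "nat \<Rightarrow> (int \<times> int) set" where
  "edge_set n = {(i, j). 0 \<le> i \<and> i < j \<and> j \<le> int n}"

definition lpp :: "nat \<Rightarrow> (int \<times> int \<Rightarrow> real) \<Rightarrow> ereal" where
  "lpp n c = (SUP is \<in> paths (\<lambda>x. 0 < c x) 0 (int n). ereal (path_weight c is))"

lemma finite_edge_chains: "finite I \<Longrightarrow> finite (edge_chains pos I)"
  by (rule finite_subset[of _ "Pow I"]) (auto simp: edge_chains_def)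

lemma empty_in_edge_chains [simp]: "{} \<in> edge_chains pos I"
  by (simp add: edge_chains_def)

lemma edge_chains_subset: "A \<in> edge_chains pos I \<Longrightarrow> B \<subseteq> A \<Longrightarrow> B \<in> edge_chains pos I"
  by (auto simp: edge_chains_def intro: pairwise_subset)

lemma max_weight_ge: "finite I \<Longrightarrow> A \<in> edge_chains pos I \<Longrightarrow> sum c A \<le> max_weight pos c I"
  unfolding max_weight_def by (intro Max_ge) (auto simp: finite_edge_chains)

lemma max_weight_le:
  "finite I \<Longrightarrow> (\<And>A. A \<in> edge_chains pos I \<Longrightarrow> sum c A \<le> r) \<Longrightarrow> max_weight pos c I \<le> r"
  unfolding max_weight_def by (subst Max_le_iff) (auto simp: finite_edge_chains intro: empty_in_edge_chains)

lemma max_weight_nonneg: "finite I \<Longrightarrow> 0 \<le> max_weight pos c I"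
  using max_weight_ge[OF _ empty_in_edge_chains, of I c pos] by simp

lemma max_weight_attained:
  assumes "finite I"
  obtains A where "A \<in> edge_chains pos I" "max_weight pos c I = sum c A"
proof -
  have "max_weight pos c I \<in> sum c ` edge_chains pos I"
    unfolding max_weight_def using assms
    by (intro Max_in) (auto simp: finite_edge_chains intro: empty_in_edge_chains)
  then show ?thesis using that by auto
qed

lemma finite_edge_set: "finite (edge_set n)"
  by (rule finite_subset[of _ "{0..int n} \<times> {0..int n}"]) (auto simp: edge_set_def)

lemma edge_set_Suc: "edge_set (Suc n) = edge_set n \<union> (\<lambda>i. (int i, int (Suc n))) ` {..n}"
proof (rule set_eqI)
  fix x :: "int \<times> int"
  have "(0 \<le> fst x \<and> fst x < int (Suc n)) \<longleftrightarrow> (\<exists>i\<le>n. fst x = int i)"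
    by (auto intro!: exI[of _ "nat (fst x)"])
  then show "x \<in> edge_set (Suc n) \<longleftrightarrow> x \<in> edge_set n \<union> (\<lambda>i. (int i, int (Suc n))) ` {..n}"
    by (cases x) (auto simp: edge_set_def)
qed

lemma card_edge_set: "card (edge_set n) = (n + 1) choose 2"
proof (induction n)
  case 0
  have "edge_set 0 = {}" by (auto simp: edge_set_def)
  then show ?case by simp
next
  case (Suc n)
  have "card (edge_set (Suc n)) = card (edge_set n) + card ((\<lambda>i. (int i, int (Suc n))) ` {..n})"
    unfolding edge_set_Suc
    by (intro card_Un_disjoint finite_edge_set finite_imageI) (auto simp: edge_set_def)
  also have "card ((\<lambda>i. (int i, int (Suc n))) ` {..n}) = Suc n"
    by (subst card_image) (auto simp: inj_on_def)
  finally show ?case using Suc by (simp add: numeral_2_eq_2)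
qed

lemma real_card_edge_set: "real (card (edge_set n)) = real n * (real n + 1) / 2"
proof -
  have "even (n * (n + 1))" by simp
  then have "real (n * (n + 1) div 2) = real (n * (n + 1)) / 2" by (simp add: real_of_nat_div)
  then show ?thesis by (simp add: card_edge_set choose_two mult.commute ring_distribs)
qed

lemma path_edges:
  assumes "is \<in> paths E 0 (int n)"
  obtains A where "A \<in> edge_chains id (edge_set n)" "\<And>x. x \<in> A \<Longrightarrow> E x" "\<And>c. path_weight c is = sum c A"
    "\<And>k. Suc k < length is \<Longrightarrow> (is ! k, is ! Suc k) \<in> A"
proof -
  let ?e = "\<lambda>k. (is ! k, is ! Suc k)"
  have ne: "is \<noteq> []" and hd: "hd is = 0" and last: "last is = int n" and srt: "sorted_wrt (<) is"
    and E: "\<And>k. Suc k < length is \<Longrightarrow> E (?e k)"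
    using assms by (auto simp: paths_def)
  define m where "m = length is - 1"
  have len: "length is = Suc m" using ne by (simp add: m_def)
  have lt: "is ! i < is ! j" if "i < j" "j \<le> m" for i j
    using srt that len by (simp add: sorted_wrt_iff_nth_less)
  have le: "is ! i \<le> is ! j" if "i \<le> j" "j \<le> m" for i j
    using lt[of i j] that by (cases "i = j") auto
  have ends: "is ! 0 = 0" "is ! m = int n"
    using hd last ne len by (auto simp: hd_conv_nth last_conv_nth)
  have inj: "inj_on ?e {..<m}"
    by (rule inj_onI) (metis lt Pair_inject lessThan_iff less_imp_le_nat nat_neq_iff order_less_irrefl)
  show ?thesis
  proof (rule that[of "?e ` {..<m}"])
    have "?e k \<in> edge_set n" if "k < m" for k
      using le[of 0 k] lt[of k "Suc k"] le[of "Suc k" m] that ends by (auto simp: edge_set_def)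
    moreover have "nonoverlapping (?e i) (?e j)" if "i < m" "j < m" "?e i \<noteq> ?e j" for i j
      using le[of "Suc i" j] le[of "Suc j" i] that unfolding nonoverlapping_def
      by (cases i j rule: linorder_cases) auto
    ultimately show "?e ` {..<m} \<in> edge_chains id (edge_set n)"
      by (auto simp: edge_chains_def pairwise_def)
    show "E x" if "x \<in> ?e ` {..<m}" for x using that E len by auto
    show "path_weight c is = sum c (?e ` {..<m})" for c
      by (simp add: path_weight_def len sum.reindex[OF inj])
    show "?e k \<in> ?e ` {..<m}" if "Suc k < length is" for k using that len by auto
  qed
qed

lemma lpp_le:
  fixes x :: "nat \<Rightarrow> int \<times> int"
  assumes x: "x \<in> {..<k} \<rightarrow> edge_set n" "inj_on x {..<k}"
    and r: "\<And>A. A \<in> edge_chains id (edge_set n - x ` {..<k}) \<Longrightarrow> sum c A \<le> r"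
  shows "lpp n c \<le> ereal (max_weight x (\<lambda>i. c (x i)) {..<k} + r)"
  unfolding lpp_def
proof (rule SUP_least)
  fix "is" assume "is \<in> paths (\<lambda>x. 0 < c x) 0 (int n)"
  then obtain A where A: "A \<in> edge_chains id (edge_set n)" "path_weight c is = sum c A"
    by (rule path_edges) blast
  define B where "B = {i \<in> {..<k}. x i \<in> A}"
  have fin: "finite A" using A finite_subset[OF _ finite_edge_set] by (auto simp: edge_chains_def)
  have xB: "x ` B = A \<inter> x ` {..<k}" by (auto simp: B_def)
  have injB: "inj_on x B" using x(2) by (rule inj_on_subset) (auto simp: B_def)
  have "sum c A = sum c (A \<inter> x ` {..<k}) + sum c (A - x ` {..<k})"
    using fin by (metis sum.Int_Diff)
  also have "sum c (A \<inter> x ` {..<k}) = sum (\<lambda>i. c (x i)) B"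
    using sum.reindex[OF injB, of c] by (simp add: xB)
  also have "\<dots> \<le> max_weight x (\<lambda>i. c (x i)) {..<k}"
  proof (rule max_weight_ge)
    have "nonoverlapping (x i) (x j)" if "i \<in> B" "j \<in> B" "i \<noteq> j" for i j
      using A(1) that inj_onD[OF injB, of i j] by (auto simp: edge_chains_def pairwise_def B_def)
    then show "B \<in> edge_chains x {..<k}" by (auto simp: edge_chains_def pairwise_def B_def)
  qed simp
  also have "sum c (A - x ` {..<k}) \<le> r"
    using A(1) by (intro r) (auto simp: edge_chains_def intro: pairwise_subset)
  finally show "ereal (path_weight c is) \<le> ereal (max_weight x (\<lambda>i. c (x i)) {..<k} + r)"
    using A(2) by simp
qed

definition reach :: "(int \<times> int \<Rightarrow> bool) \<Rightarrow> (int \<times> int \<Rightarrow> real) \<Rightarrow> int \<Rightarrow> int \<Rightarrow> real \<Rightarrow> bool" where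
  "reach E c a b S \<longleftrightarrow> (\<exists>is \<in> paths E a b. S \<le> path_weight c is)"

lemma reach_refl: "reach E c a a 0"
  by (auto simp: reach_def paths_def path_weight_def intro!: bexI[of _ "[a]"])

lemma reach_step:
  assumes "reach E c a b S" "b < d" "E (b, d)"
  shows "reach E c a d (S + c (b, d))"
proof -
  obtain "is" where is_path: "is \<in> paths E a b" and S: "S \<le> path_weight c is"
    using assms(1) by (auto simp: reach_def)
  have ne: "is \<noteq> []" and last: "last is = b" and srt: "sorted_wrt (<) is"
    using is_path by (auto simp: paths_def)
  define m where "m = length is - 1"
  have len: "length is = Suc m" using ne by (simp add: m_def)
  have ism: "is ! m = b" using last ne len by (simp add: last_conv_nth)
  have "x \<le> b" if xin: "x \<in> set is" for x
  proof -
    obtain i where i: "i < length is" "x = is ! i" using xin by (auto simp: in_set_conv_nth)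
    show ?thesis
    proof (cases "i = m")
      case False
      then have "is ! i < is ! m" using srt len i(1) by (simp add: sorted_wrt_iff_nth_less)
      then show ?thesis using i ism by simp
    qed (use i ism in simp)
  qed
  then have "\<forall>x\<in>set is. x < d" using assms(2) by fastforce
  then have "is @ [d] \<in> paths E a d"
    using is_path assms(3) ism len
    by (auto simp: paths_def sorted_wrt_append nth_append less_Suc_eq)
  moreover have "path_weight c (is @ [d]) = path_weight c is + c (b, d)"
    by (simp add: path_weight_def len nth_append ism)
  ultimately show ?thesis using S by (auto simp: reach_def intro!: bexI[of _ "is @ [d]"])
qed

definition connected_gaps :: "(int \<times> int \<Rightarrow> bool) \<Rightarrow> nat \<Rightarrow> real \<Rightarrow> bool" where
  "connected_gaps E n d \<longleftrightarrow> (\<forall>i j. 0 \<le> i \<longrightarrow> j \<le> int n \<longrightarrow> of_int i + d \<le> of_int j \<longrightarrow>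
     (\<exists>l. i < l \<and> l < j \<and> E (i, l) \<and> E (l, j)))"

lemma reach_gap:
  assumes "connected_gaps E n d" and c: "\<And>x. E x \<Longrightarrow> 0 \<le> c x"
    and "reach E c a b S" "0 \<le> b" "j \<le> int n" "of_int b + d \<le> of_int j"
  shows "reach E c a j S"
proof -
  obtain l where l: "b < l" "l < j" "E (b, l)" "E (l, j)"
    using assms(1,4-6) unfolding connected_gaps_def by blast
  then have "reach E c a j (S + c (b, l) + c (l, j))"
    using assms(3) by (intro reach_step) auto
  then show ?thesis using c[OF l(3)] c[OF l(4)] by (force simp: reach_def)
qed

lemma reach_chain:
  assumes gaps: "connected_gaps E n d" and c: "\<And>x. E x \<Longrightarrow> 0 \<le> c x" and "finite A"
    and A: "\<And>x. x \<in> A \<Longrightarrow> E x \<and> fst x < snd x \<and> d \<le> of_int (fst x)"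
    and chain: "pairwise nonoverlapping A"
    and sep: "\<And>x y. x \<in> A \<Longrightarrow> y \<in> A \<Longrightarrow> x \<noteq> y \<Longrightarrow> snd x \<le> fst y \<Longrightarrow> of_int (snd x) + d \<le> of_int (fst y)"
    and b: "0 < d" "d \<le> of_int b" "b \<le> int n" "\<And>x. x \<in> A \<Longrightarrow> of_int (snd x) + d \<le> of_int b"
  shows "reach E c 0 b (sum c A)"
  using \<open>finite A\<close> A chain sep b
proof (induction A arbitrary: b rule: finite_ranking_induct[where f = snd])
  case empty
  then show ?case using reach_gap[OF gaps c reach_refl, where j = b] by simp
next
  case (insert x A)
  show ?case
  proof (cases "x \<in> A")
    case True
    then show ?thesis using insert by (simp add: insert_absorb)
  next
    case False
    have x: "E x" "fst x < snd x" "d \<le> of_int (fst x)" "of_int (snd x) + d \<le> of_int b"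
      using insert.prems by auto
    have y: "of_int (snd y) + d \<le> of_int (fst x)" if "y \<in> A" for y
    proof -
      have "y \<noteq> x" using that False by blast
      then have "nonoverlapping x y"
        using pairwiseD[OF insert.prems(2), of x y] that by simp
      moreover have "snd y \<le> snd x" "fst y < snd y" using insert that by auto
      ultimately have "snd y \<le> fst x" by (auto simp: nonoverlapping_def)
      then show ?thesis using insert.prems(3)[of y x] that False by auto
    qed
    have "(0::real) < of_int (fst x)" using x(3) insert.prems(4) by linarith
    then have fst_pos: "0 < fst x" and snd_pos: "0 < snd x" using x(2) by simp_all
    have le: "snd x \<le> b" using x(4) insert.prems(4) by linarith
    have "reach E c 0 (fst x) (sum c A)"
    proof (rule insert.IH)
      show "pairwise nonoverlapping A" using insert.prems(2) by (simp add: pairwise_insert)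
      show "fst x \<le> int n" using le x insert.prems(6) by linarith
      show "d \<le> of_int (fst x)" by fact
      show "0 < d" by fact
    qed (use insert.prems x y in auto)
    then have reach_x: "reach E c 0 (snd x) (sum c A + c (fst x, snd x))"
      using x by (intro reach_step) auto
    have "reach E c 0 b (sum c A + c (fst x, snd x))"
      by (rule reach_gap[OF gaps _ reach_x]) (use c x snd_pos insert.prems in simp_all)
    then show ?thesis using False insert.hyps by (simp add: add.commute)
  qed
qed

definition separated :: "nat \<Rightarrow> real \<Rightarrow> nat \<Rightarrow> (nat \<Rightarrow> int \<times> int) \<Rightarrow> bool" where
  "separated n d k x \<longleftrightarrow> (\<forall>i<k. d \<le> of_int (fst (x i)) \<and> of_int (snd (x i)) + d \<le> real n \<and>
     (\<forall>j<k. i \<noteq> j \<longrightarrow> d \<le> \<bar>of_int (snd (x i)) - of_int (fst (x j))\<bar>))"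

lemma lpp_ge:
  fixes x :: "nat \<Rightarrow> int \<times> int"
  assumes x: "x \<in> {..<k} \<rightarrow> edge_set n" "inj_on x {..<k}" and pos: "\<And>i. i < k \<Longrightarrow> 0 < c (x i)"
    and gaps: "connected_gaps (\<lambda>x. 0 < c x) n d" and sep: "separated n d k x"
    and d: "0 < d" "d \<le> real n"
  shows "ereal (max_weight x (\<lambda>i. c (x i)) {..<k}) \<le> lpp n c"
proof -
  obtain B where B: "B \<in> edge_chains x {..<k}" "max_weight x (\<lambda>i. c (x i)) {..<k} = sum (\<lambda>i. c (x i)) B"
    using max_weight_attained[of "{..<k}"] by blast
  have Bk: "B \<subseteq> {..<k}" using B(1) by (auto simp: edge_chains_def)
  have inj: "inj_on x B" using x(2) Bk by (rule inj_on_subset)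
  have "reach (\<lambda>x. 0 < c x) c 0 (int n) (sum c (x ` B))"
  proof (rule reach_chain[OF gaps])
    show "finite (x ` B)" using Bk finite_subset by blast
    show "0 < c y \<and> fst y < snd y \<and> d \<le> of_int (fst y)" if y: "y \<in> x ` B" for y
    proof -
      obtain i where i: "y = x i" "i < k" using y Bk by auto
      then have "x i \<in> edge_set n" "0 < c (x i)" "d \<le> of_int (fst (x i))"
        using x(1) pos sep by (auto simp: separated_def)
      then show ?thesis using i by (auto simp: edge_set_def)
    qed
    show "pairwise nonoverlapping (x ` B)"
      using B(1) by (auto simp: edge_chains_def pairwise_def)
    show "of_int (snd y) + d \<le> of_int (fst z)"
      if yz: "y \<in> x ` B" "z \<in> x ` B" "y \<noteq> z" "snd y \<le> fst z" for y z
    proof -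
      obtain i j where ij: "y = x i" "z = x j" "i < k" "j < k" "i \<noteq> j" using yz Bk by auto
      then have "d \<le> \<bar>of_int (snd y) - of_int (fst z)\<bar>" using sep by (auto simp: separated_def)
      then show ?thesis using yz(4) by (simp add: abs_if split: if_splits)
    qed
    show "of_int (snd y) + d \<le> of_int (int n)" if y: "y \<in> x ` B" for y
    proof -
      obtain i where "y = x i" "i < k" using y Bk by auto
      then show ?thesis using sep by (simp add: separated_def)
    qed
  qed (use d in auto)
  then obtain "is" where "is \<in> paths (\<lambda>x. 0 < c x) 0 (int n)" "sum c (x ` B) \<le> path_weight c is"
    by (auto simp: reach_def)
  moreover have "sum c (x ` B) = sum (\<lambda>i. c (x i)) B" by (simp add: sum.reindex[OF inj])
  ultimately show ?thesis unfolding lpp_def using B(2) by (intro SUP_upper2) auto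
qed

lemma edge_chains_Suc:
  "edge_chains id (edge_set (Suc m)) \<subseteq> edge_chains id (edge_set m) \<union>
     (\<Union>i\<le>m. insert (int i, int (Suc m)) ` edge_chains id (edge_set i))"
proof
  fix B assume B: "B \<in> edge_chains id (edge_set (Suc m))"
  show "B \<in> edge_chains id (edge_set m) \<union>
     (\<Union>i\<le>m. insert (int i, int (Suc m)) ` edge_chains id (edge_set i))"
  proof (cases "B \<subseteq> edge_set m")
    case True
    then show ?thesis using B by (auto simp: edge_chains_def)
  next
    case False
    then obtain i where i: "i \<le> m" "(int i, int (Suc m)) \<in> B"
      using B by (auto simp: edge_chains_def edge_set_Suc)
    let ?x = "(int i, int (Suc m))"
    have "y \<in> edge_set i" if "y \<in> B - {?x}" for y
    proof -
      have "nonoverlapping ?x y" "y \<in> edge_set (Suc m)"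
        using B i that by (auto simp: edge_chains_def pairwise_def)
      then show ?thesis by (cases y) (auto simp: nonoverlapping_def edge_set_def)
    qed
    then have "B - {?x} \<in> edge_chains id (edge_set i)"
      using B by (auto simp: edge_chains_def intro: pairwise_subset)
    moreover have "B = insert ?x (B - {?x})" using i by auto
    ultimately show ?thesis using i(1) by blast
  qed
qed

lemma sum_UN_le:
  fixes f :: "'b \<Rightarrow> real"
  assumes "finite I" "\<And>i. i \<in> I \<Longrightarrow> finite (A i)" "\<And>x. 0 \<le> f x"
  shows "sum f (\<Union>i\<in>I. A i) \<le> (\<Sum>i\<in>I. sum f (A i))"
proof -
  have "(\<Union>i\<in>I. A i) = snd ` Sigma I A" by force
  then have "sum f (\<Union>i\<in>I. A i) \<le> sum (f \<circ> snd) (Sigma I A)"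
    using assms by (simp only:) (intro sum_image_le, auto)
  also have "\<dots> = (\<Sum>i\<in>I. sum f (A i))"
    using assms by (simp add: sum.Sigma split_def)
  finally show ?thesis .
qed

lemma chain_generating_function_le:
  fixes q :: real
  assumes "0 \<le> q" "q \<le> 9 / 4"
  shows "(\<Sum>B\<in>edge_chains id (edge_set m). q ^ card B) \<le> (1 + 2 * sqrt q) ^ m"
proof -
  define G where "G = (\<lambda>m. \<Sum>B\<in>edge_chains id (edge_set m). q ^ card B)"
  define a where "a = 2 * sqrt q"
  have "sqrt q \<le> sqrt ((3 / 2)\<^sup>2)"
    using assms by (intro real_sqrt_le_mono) (simp add: power2_eq_square)
  then have a: "0 \<le> a" "a \<le> 3" "q = a * a / 4" using assms by (auto simp: a_def)
  have "G m \<le> (1 + a) ^ m"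
  proof (induction m rule: less_induct)
    case (less m)
    show ?case
    proof (cases m)
      case 0
      have "edge_chains id (edge_set 0) = {{}}"
        by (auto simp: edge_chains_def edge_set_def)
      then show ?thesis by (simp add: G_def 0)
    next
      case (Suc l)
      have fin: "finite (edge_chains id (edge_set i))" for i
        by (intro finite_edge_chains finite_edge_set)
      have step: "(\<Sum>B\<in>insert (int i, int (Suc l)) ` edge_chains id (edge_set i). q ^ card B) \<le> q * G i"
        if "i \<le> l" for i
      proof -
        let ?x = "(int i, int (Suc l))"
        have "(\<Sum>B\<in>insert ?x ` edge_chains id (edge_set i). q ^ card B)
            \<le> (\<Sum>B\<in>edge_chains id (edge_set i). q ^ card (insert ?x B))"
          using sum_image_le[OF fin[of i], where g = "\<lambda>B. q ^ card B" and f = "insert ?x"] assms(1) by (simp add: o_def)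
        also have "\<dots> = (\<Sum>B\<in>edge_chains id (edge_set i). q * q ^ card B)"
        proof (rule sum.cong[OF refl])
          fix B assume "B \<in> edge_chains id (edge_set i)"
          then have B: "B \<subseteq> edge_set i" by (auto simp: edge_chains_def)
          then have "finite B" using finite_edge_set finite_subset by blast
          moreover have "?x \<notin> B" using B that by (auto simp: edge_set_def)
          ultimately show "q ^ card (insert ?x B) = q * q ^ card B" by simp
        qed
        finally show ?thesis by (simp add: G_def sum_distrib_left)
      qed
      have "G (Suc l) \<le> (\<Sum>B\<in>edge_chains id (edge_set l) \<union>
          (\<Union>i\<le>l. insert (int i, int (Suc l)) ` edge_chains id (edge_set i)). q ^ card B)"
        unfolding G_def using assms(1)
        by (intro sum_mono2 edge_chains_Suc) (auto simp: fin)
      also have "\<dots> \<le> G l + (\<Sum>B\<in>(\<Union>i\<le>l. insert (int i, int (Suc l)) ` edge_chains id (edge_set i)). q ^ card B)"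
        unfolding G_def using assms(1) by (subst sum_Un) (auto simp: fin intro!: sum_nonneg)
      also have "(\<Sum>B\<in>(\<Union>i\<le>l. insert (int i, int (Suc l)) ` edge_chains id (edge_set i)). q ^ card B)
          \<le> (\<Sum>i\<le>l. \<Sum>B\<in>insert (int i, int (Suc l)) ` edge_chains id (edge_set i). q ^ card B)"
        using assms(1) by (intro sum_UN_le) (auto simp: fin)
      also have "\<dots> \<le> (\<Sum>i\<le>l. q * G i)"
        using step by (intro sum_mono) auto
      also have "\<dots> \<le> (\<Sum>i\<le>l. q * (1 + a) ^ i)"
        using less.IH Suc assms(1) by (intro sum_mono mult_left_mono) auto
      also have "\<dots> = a / 4 * ((1 + a) ^ Suc l - 1)"
      proof -
        have "a * (\<Sum>i\<le>l. (1 + a) ^ i) = (1 + a) ^ Suc l - 1"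
          using power_diff_1_eq[of "1 + a" "Suc l"] by (simp add: lessThan_Suc_atMost)
        moreover have "(\<Sum>i\<le>l. q * (1 + a) ^ i) = a / 4 * (a * (\<Sum>i\<le>l. (1 + a) ^ i))"
          by (simp only: sum_distrib_left[symmetric] a(3)) simp
        ultimately show ?thesis by simp
      qed
      also have "G l \<le> (1 + a) ^ l" using less.IH Suc by simp
      finally have "G m \<le> (1 + a) ^ l * (1 + a / 4 * (1 + a)) - a / 4"
        using Suc by (simp add: algebra_simps add_divide_distrib)
      also have "\<dots> \<le> (1 + a) ^ l * (1 + a / 4 * (1 + a))" using a by simp
      also have "\<dots> \<le> (1 + a) ^ l * (1 + a)"
      proof (rule mult_left_mono)
        have "a / 4 * (1 + a) \<le> a / 4 * 4" using a by (intro mult_left_mono) auto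
        then show "1 + a / 4 * (1 + a) \<le> 1 + a" by simp
      qed (use a in auto)
      finally show ?thesis using Suc by (simp add: mult.commute)
    qed
  qed
  then show ?thesis by (simp add: G_def a_def)
qed

lemma chain_dyadic_bound:
  fixes g \<tau> :: "_ \<Rightarrow> real"
  assumes A: "finite A" and g: "\<And>t t'. 0 < t \<Longrightarrow> t \<le> t' \<Longrightarrow> g t' \<le> g t" "\<And>t. 0 < t \<Longrightarrow> 0 \<le> g t"
    and \<theta>: "0 < \<theta>" and \<tau>: "\<And>x. x \<in> A \<Longrightarrow> \<theta> \<le> \<tau> x \<and> \<tau> x \<le> \<theta> * 2 ^ J"
    and J: "0 < J"
  shows "(\<Sum>x\<in>A. g (\<tau> x)) \<le> (\<Sum>j<J. g (\<theta> * 2 ^ j) * card {x \<in> A. \<tau> x \<le> \<theta> * 2 ^ Suc j})"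
proof -
  have "g (\<tau> x) \<le> (\<Sum>j<J. g (\<theta> * 2 ^ j) * of_bool (\<tau> x \<le> \<theta> * 2 ^ Suc j))" if x: "x \<in> A" for x
  proof -
    define j where "j = (LEAST j. \<tau> x \<le> \<theta> * 2 ^ Suc j)"
    have ex: "\<tau> x \<le> \<theta> * 2 ^ Suc (J - 1)" using \<tau>[OF x] J by simp
    have j: "\<tau> x \<le> \<theta> * 2 ^ Suc j" unfolding j_def using ex by (rule LeastI)
    have jJ: "j < J" unfolding j_def using Least_le[of "\<lambda>j. \<tau> x \<le> \<theta> * 2 ^ Suc j", OF ex] J by linarith
    have "\<theta> * 2 ^ j \<le> \<tau> x"
    proof (cases j)
      case 0
      then show ?thesis using \<tau>[OF x] by simp
    next
      case (Suc i)
      then have "\<not> \<tau> x \<le> \<theta> * 2 ^ Suc i" unfolding j_def using not_less_Least[of i "\<lambda>j. \<tau> x \<le> \<theta> * 2 ^ Suc j"] by auto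
      then show ?thesis using Suc by simp
    qed
    then have "g (\<tau> x) \<le> g (\<theta> * 2 ^ j)" using \<theta> by (intro g) auto
    also have "\<dots> = g (\<theta> * 2 ^ j) * of_bool (\<tau> x \<le> \<theta> * 2 ^ Suc j)" using j by simp
    also have "\<dots> \<le> (\<Sum>j<J. g (\<theta> * 2 ^ j) * of_bool (\<tau> x \<le> \<theta> * 2 ^ Suc j))"
      using jJ g(2) \<theta> by (intro member_le_sum) auto
    finally show ?thesis .
  qed
  then have "(\<Sum>x\<in>A. g (\<tau> x)) \<le> (\<Sum>x\<in>A. \<Sum>j<J. g (\<theta> * 2 ^ j) * of_bool (\<tau> x \<le> \<theta> * 2 ^ Suc j))"
    by (rule sum_mono)
  also have "\<dots> = (\<Sum>j<J. \<Sum>x\<in>A. g (\<theta> * 2 ^ j) * of_bool (\<tau> x \<le> \<theta> * 2 ^ Suc j))"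
    by (rule sum.swap)
  also have "\<dots> = (\<Sum>j<J. g (\<theta> * 2 ^ j) * card {x \<in> A. \<tau> x \<le> \<theta> * 2 ^ Suc j})"
  proof (rule sum.cong[OF refl])
    fix j
    have "{x \<in> A. \<tau> x \<le> \<theta> * 2 ^ Suc j} = A \<inter> {x. \<tau> x \<le> \<theta> * 2 ^ Suc j}" by auto
    then show "(\<Sum>x\<in>A. g (\<theta> * 2 ^ j) * of_bool (\<tau> x \<le> \<theta> * 2 ^ Suc j))
        = g (\<theta> * 2 ^ j) * card {x \<in> A. \<tau> x \<le> \<theta> * 2 ^ Suc j}"
      using A by (simp add: sum_distrib_left[symmetric] of_bool_def sum.If_cases)
  qed
  finally show ?thesis .
qed

text \<open>A chain of size \<open>l\<close> has \<open>2 ^ l\<close> subchains; the logarithm is then replaced by a tangent.\<close>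

lemma card_chain_le:
  fixes y :: real
  assumes "finite I" "A \<in> edge_chains pos I" "\<And>x. x \<in> A \<Longrightarrow> P x"
  shows "card A * ln 2 \<le> exp (- y) * (\<Sum>B\<in>edge_chains pos I. \<Prod>x\<in>B. of_bool (P x)) - 1 + y"
proof -
  have fin: "finite A" using assms finite_subset by (auto simp: edge_chains_def)
  have "2 ^ card A = (\<Sum>B\<in>Pow A. \<Prod>x\<in>B. of_bool (P x) :: real)"
  proof -
    have "(\<Prod>x\<in>B. of_bool (P x) :: real) = 1" if "B \<in> Pow A" for B
      using that assms(3) by (intro prod.neutral) auto
    then show ?thesis using fin by (simp add: card_Pow)
  qed
  also have "\<dots> \<le> (\<Sum>B\<in>edge_chains pos I. \<Prod>x\<in>B. of_bool (P x))"
    using assms edge_chains_subset[OF assms(2)] by (intro sum_mono2 finite_edge_chains) (auto intro: prod_nonneg)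
  finally have le: "2 ^ card A \<le> (\<Sum>B\<in>edge_chains pos I. \<Prod>x\<in>B. of_bool (P x) :: real)" .
  have "1 + (card A * ln 2 - y) \<le> exp (card A * ln 2 - y)" by (rule exp_ge_add_one_self)
  also have "\<dots> = exp (- y) * 2 ^ card A"
    by (simp add: exp_diff exp_minus exp_of_nat_mult field_simps)
  also have "\<dots> \<le> exp (- y) * (\<Sum>B\<in>edge_chains pos I. \<Prod>x\<in>B. of_bool (P x))"
    using le by (intro mult_left_mono) auto
  finally show ?thesis by simp
qed

section \<open>Independent uniform labels\<close>

definition unif :: "real measure" where
  "unif = uniform_measure lborel {0..1}"

definition canon :: "nat \<Rightarrow> (int \<times> int \<Rightarrow> real) measure" where
  "canon n = PiM (edge_set n) (\<lambda>_. unif)"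

lemma sets_unif [simp, measurable_cong]: "sets unif = sets borel"
  by (simp add: unif_def)

lemma space_unif [simp]: "space unif = UNIV"
  by (simp add: unif_def)

lemma measurable_PiM_unif_component:
  "i \<in> I \<Longrightarrow> (\<lambda>u. u i) \<in> borel_measurable (PiM I (\<lambda>_. unif))"
  by (rule measurable_compose[where N = unif and f = "\<lambda>u. u i",
        OF measurable_component_singleton measurable_ident_sets[OF sets_unif]])

interpretation unif: prob_space unif
  unfolding unif_def by (rule prob_space_uniform_measure) auto

interpretation unif_prod: product_prob_space "\<lambda>_. unif" I for I
  by standard

interpretation canon: prob_space "canon n" for n
  unfolding canon_def by (rule prob_space_PiM) (rule unif.prob_space_axioms)

lemma measure_unif_atMost: "0 \<le> q \<Longrightarrow> q \<le> 1 \<Longrightarrow> measure unif {..q} = q"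
proof -
  assume q: "0 \<le> q" "q \<le> 1"
  have "{0..1} \<inter> {..q} = {0..q}" using q by auto
  then show ?thesis using q by (simp add: unif_def measure_uniform_measure)
qed

lemma measure_unif_lessThan: "0 \<le> q \<Longrightarrow> q \<le> 1 \<Longrightarrow> measure unif {..<q} = q"
proof -
  assume q: "0 \<le> q" "q \<le> 1"
  have "{0..1} \<inter> {..<q} = {0..<q}" using q by auto
  then show ?thesis using q by (simp add: unif_def measure_uniform_measure)
qed

lemma measure_unif_atMost_le: "0 \<le> q \<Longrightarrow> measure unif {..q} \<le> q"
  using measure_unif_atMost[of q] order_trans[OF unif.prob_le_1[of "{..q}"], of q] by fastforce

lemma AE_unif: "AE x in unif. 0 < x \<and> x < 1"
proof -
  have "AE x::real in lborel. x \<in> {0..1} \<longrightarrow> 0 < x \<and> x < 1"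
    using AE_lborel_singleton[of 0] AE_lborel_singleton[of 1] by eventually_elim auto
  then show ?thesis
    unfolding unif_def by (rule AE_uniform_measureI[rotated]) simp
qed

lemma measurable_canon_component [measurable (raw)]:
  "x \<in> edge_set n \<Longrightarrow> (\<lambda>\<tau>. \<tau> x) \<in> borel_measurable (canon n)"
  unfolding canon_def by measurable

lemma AE_canon: "AE \<tau> in canon n. \<forall>x\<in>edge_set n. 0 < \<tau> x \<and> \<tau> x < 1"
  unfolding canon_def
  by (intro AE_finite_allI finite_edge_set AE_PiM_component unif.prob_space_axioms AE_unif)

lemma measure_canon_Collect:
  assumes "J \<subseteq> edge_set n" "\<And>x. x \<in> J \<Longrightarrow> X x \<in> sets borel"
  shows "measure (canon n) {\<tau> \<in> space (canon n). \<forall>x\<in>J. \<tau> x \<in> X x} = (\<Prod>x\<in>J. measure unif (X x))"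
proof -
  have fin: "finite J" using assms(1) finite_edge_set finite_subset by blast
  have "emeasure (canon n) {\<tau> \<in> space (canon n). \<forall>x\<in>J. \<tau> x \<in> X x} = (\<Prod>x\<in>J. emeasure unif (X x))"
    unfolding canon_def using assms fin by (intro unif_prod.emeasure_PiM_Collect) auto
  also have "\<dots> = ennreal (\<Prod>x\<in>J. measure unif (X x))"
    by (simp add: unif.emeasure_eq_measure prod_ennreal)
  finally show ?thesis by (simp add: measure_def prod_nonneg)
qed

lemma expectation_prod_of_bool:
  assumes "B \<subseteq> edge_set n" "0 \<le> q"
  shows "(\<integral>\<tau>. (\<Prod>x\<in>B. of_bool (\<tau> x \<le> q)) \<partial>canon n) \<le> q ^ card B"
    and "integrable (canon n) (\<lambda>\<tau>. \<Prod>x\<in>B. of_bool (\<tau> x \<le> q) :: real)"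
proof -
  have fin: "finite B" using assms(1) finite_edge_set finite_subset by blast
  have eq: "(\<Prod>x\<in>B. of_bool (\<tau> x \<le> q) :: real)
      = indicator {\<tau> \<in> space (canon n). \<forall>x\<in>B. \<tau> x \<in> {..q}} \<tau>" if "\<tau> \<in> space (canon n)" for \<tau>
    using that fin by (auto simp: indicator_def intro!: prod.neutral)
  have [measurable]: "(\<lambda>\<tau>. \<tau> x) \<in> borel_measurable (canon n)" if "x \<in> B" for x
    using that assms(1) by (intro measurable_canon_component) auto
  have meas: "{\<tau> \<in> space (canon n). \<forall>x\<in>B. \<tau> x \<in> {..q}} \<in> sets (canon n)"
    using fin by measurable
  have "(\<integral>\<tau>. (\<Prod>x\<in>B. of_bool (\<tau> x \<le> q) :: real) \<partial>canon n)
      = (\<integral>\<tau>. indicator {\<tau> \<in> space (canon n). \<forall>x\<in>B. \<tau> x \<in> {..q}} \<tau> \<partial>canon n)"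
    by (rule Bochner_Integration.integral_cong[OF refl eq])
  also have "\<dots> = (\<Prod>x\<in>B. measure unif {..q})"
    using measure_canon_Collect[OF assms(1), of "\<lambda>_. {..q}"] meas by simp
  also have "\<dots> \<le> q ^ card B"
    using measure_unif_atMost_le[OF assms(2)] by (simp add: power_mono)
  finally show "(\<integral>\<tau>. (\<Prod>x\<in>B. of_bool (\<tau> x \<le> q)) \<partial>canon n) \<le> q ^ card B" .
  show "integrable (canon n) (\<lambda>\<tau>. \<Prod>x\<in>B. of_bool (\<tau> x \<le> q) :: real)"
    using meas by (subst Bochner_Integration.integrable_cong[OF refl eq]) (auto simp: canon.emeasure_eq_measure)
qed

lemma expected_chain_weight:
  fixes g :: "real \<Rightarrow> real"
  assumes n: "0 < n" and g: "\<And>t t'. 0 < t \<Longrightarrow> t \<le> t' \<Longrightarrow> g t' \<le> g t" "\<And>t. 0 < t \<Longrightarrow> 0 \<le> g t"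
    and K: "K = real (card (edge_set n))" and \<theta>: "0 < \<theta>" "\<theta> < K"
  obtains R :: "(int \<times> int \<Rightarrow> real) \<Rightarrow> real"
  where "integrable (canon n) R" "\<And>\<tau>. 0 \<le> R \<tau>"
    and "(\<integral>\<tau>. R \<tau> \<partial>canon n) \<le> (\<Sum>j | \<theta> * 2 ^ j < K. g (\<theta> * 2 ^ j) * (4 * sqrt (\<theta> * 2 ^ j) / ln 2))"
    and "\<And>\<tau> A. A \<in> edge_chains id (edge_set n) \<Longrightarrow> (\<And>x. x \<in> A \<Longrightarrow> \<tau> x \<le> 1 \<and> \<theta> \<le> K * \<tau> x) \<Longrightarrow>
      (\<Sum>x\<in>A. g (K * \<tau> x)) \<le> R \<tau>"
proof -
  have Kn: "K = real n * (real n + 1) / 2" by (simp add: K real_card_edge_set)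
  have K0: "0 < K" using \<theta> by simp
  obtain J0 where "K / \<theta> < 2 ^ J0"
    using real_arch_pow[of 2 "K / \<theta>"] by auto
  then have J0: "K \<le> \<theta> * 2 ^ J0" using \<theta> by (simp add: field_simps)
  define J where "J = (LEAST j. K \<le> \<theta> * 2 ^ j)"
  have J: "K \<le> \<theta> * 2 ^ J" unfolding J_def using J0 by (rule LeastI)
  have J_pos: "0 < J" using J \<theta> by (cases J) auto
  have set_eq: "{j. \<theta> * 2 ^ j < K} = {..<J}"
  proof (intro equalityI subsetI)
    fix j assume "j \<in> {..<J}"
    then show "j \<in> {j. \<theta> * 2 ^ j < K}"
      unfolding J_def using not_less_Least[of j "\<lambda>j. K \<le> \<theta> * 2 ^ j"] by auto
  next
    fix j assume j: "j \<in> {j. \<theta> * 2 ^ j < K}"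
    show "j \<in> {..<J}"
    proof (rule ccontr)
      assume "j \<notin> {..<J}"
      then have "\<theta> * 2 ^ J \<le> \<theta> * 2 ^ j" using \<theta> by (intro mult_left_mono power_increasing) auto
      then show False using J j by simp
    qed
  qed
  define q where "q = (\<lambda>j. \<theta> * 2 ^ Suc j / K)"
  define y where "y = (\<lambda>j. 4 * sqrt (\<theta> * 2 ^ j))"
  define Z where "Z = (\<lambda>j (\<tau> :: int \<times> int \<Rightarrow> real).
    \<Sum>B\<in>edge_chains id (edge_set n). \<Prod>x\<in>B. of_bool (\<tau> x \<le> q j) :: real)"
  define L where "L = (\<lambda>j \<tau>. (exp (- y j) * Z j \<tau> - 1 + y j) / ln 2)"
  define R where "R = (\<lambda>\<tau>. \<Sum>j<J. g (\<theta> * 2 ^ j) * L j \<tau>)"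
  have q0: "0 \<le> q j" for j using \<theta> K0 by (simp add: q_def)
  have Z_int: "integrable (canon n) (Z j)" for j
    unfolding Z_def using q0
    by (intro Bochner_Integration.integrable_sum expectation_prod_of_bool) (auto simp: edge_chains_def)
  have Z_exp: "(\<integral>\<tau>. Z j \<tau> \<partial>canon n) \<le> exp (y j)" if "j < J" for j
  proof -
    have "j \<in> {j. \<theta> * 2 ^ j < K}" using that set_eq by simp
    then have "q j \<le> 2" using K0 by (simp add: q_def field_simps)
    have "(\<integral>\<tau>. Z j \<tau> \<partial>canon n)
        = (\<Sum>B\<in>edge_chains id (edge_set n). \<integral>\<tau>. (\<Prod>x\<in>B. of_bool (\<tau> x \<le> q j)) \<partial>canon n)"
      unfolding Z_def using q0
      by (intro Bochner_Integration.integral_sum expectation_prod_of_bool) (auto simp: edge_chains_def)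
    also have "\<dots> \<le> (\<Sum>B\<in>edge_chains id (edge_set n). q j ^ card B)"
      using q0 by (intro sum_mono expectation_prod_of_bool) (auto simp: edge_chains_def)
    also have "\<dots> \<le> (1 + 2 * sqrt (q j)) ^ n"
      using q0 \<open>q j \<le> 2\<close> by (intro chain_generating_function_le) auto
    also have "\<dots> \<le> exp (2 * sqrt (q j)) ^ n"
      using q0 by (intro power_mono exp_ge_add_one_self) auto
    also have "\<dots> = exp (real n * (2 * sqrt (q j)))" by (simp add: exp_of_nat_mult)
    also have "real n * (2 * sqrt (q j)) = sqrt ((real n)\<^sup>2 * 4 * q j)"
      by (simp add: real_sqrt_mult)
    also have "\<dots> \<le> sqrt (16 * (\<theta> * 2 ^ j))"
    proof (rule real_sqrt_le_mono)
      have "(real n)\<^sup>2 * 4 * q j = 16 * (\<theta> * 2 ^ j) * (real n / (real n + 1))"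
        using n by (simp add: q_def Kn power2_eq_square divide_simps add_eq_0_iff)
      also have "\<dots> \<le> 16 * (\<theta> * 2 ^ j) * 1"
        using \<theta> by (intro mult_left_mono) auto
      finally show "(real n)\<^sup>2 * 4 * q j \<le> 16 * (\<theta> * 2 ^ j)" by simp
    qed
    also have "\<dots> = y j" by (simp add: y_def real_sqrt_mult)
    finally show ?thesis by simp
  qed
  have L_int: "integrable (canon n) (L j)" for j
    unfolding L_def using Z_int by (intro integrable_divide Bochner_Integration.integrable_add
        Bochner_Integration.integrable_diff integrable_mult_right) auto
  have L_exp: "(\<integral>\<tau>. L j \<tau> \<partial>canon n) \<le> y j / ln 2" if "j < J" for j
  proof -
    have "(\<integral>\<tau>. L j \<tau> \<partial>canon n) = (exp (- y j) * (\<integral>\<tau>. Z j \<tau> \<partial>canon n) - 1 + y j) / ln 2"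
      unfolding L_def using Z_int[of j] by (simp add: canon.prob_space)
    also have "\<dots> \<le> (exp (- y j) * exp (y j) - 1 + y j) / ln 2"
      using Z_exp[OF that] by (intro divide_right_mono add_right_mono diff_right_mono mult_left_mono) auto
    finally show ?thesis by (simp add: exp_minus field_simps)
  qed
  have L_ge: "real (card A) \<le> L j \<tau>"
    if "A \<in> edge_chains id (edge_set n)" "\<And>x. x \<in> A \<Longrightarrow> \<tau> x \<le> q j" for j A \<tau>
    using card_chain_le[OF finite_edge_set that(1), of "\<lambda>x. \<tau> x \<le> q j" "y j"] that(2)
    by (simp add: L_def Z_def pos_le_divide_eq)
  have L_nonneg: "0 \<le> L j \<tau>" for j \<tau>
    using L_ge[of "{}" \<tau> j] by simp
  show ?thesis
  proof (rule that[of R])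
    show "integrable (canon n) R"
      unfolding R_def using L_int by (intro Bochner_Integration.integrable_sum integrable_mult_right)
    show "0 \<le> R \<tau>" for \<tau>
      unfolding R_def using g(2) L_nonneg \<theta> by (intro sum_nonneg mult_nonneg_nonneg) auto
    have "(\<integral>\<tau>. R \<tau> \<partial>canon n) = (\<Sum>j<J. g (\<theta> * 2 ^ j) * (\<integral>\<tau>. L j \<tau> \<partial>canon n))"
      unfolding R_def using L_int by simp
    also have "\<dots> \<le> (\<Sum>j<J. g (\<theta> * 2 ^ j) * (y j / ln 2))"
      using L_exp g(2) \<theta> by (intro sum_mono mult_left_mono) auto
    finally show "(\<integral>\<tau>. R \<tau> \<partial>canon n)
        \<le> (\<Sum>j | \<theta> * 2 ^ j < K. g (\<theta> * 2 ^ j) * (4 * sqrt (\<theta> * 2 ^ j) / ln 2))"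
      by (simp add: set_eq y_def)
    fix \<tau> :: "int \<times> int \<Rightarrow> real" and A
    assume A: "A \<in> edge_chains id (edge_set n)" and \<tau>: "\<And>x. x \<in> A \<Longrightarrow> \<tau> x \<le> 1 \<and> \<theta> \<le> K * \<tau> x"
    have fin: "finite A" using A finite_subset[OF _ finite_edge_set] by (auto simp: edge_chains_def)
    have "\<theta> \<le> K * \<tau> x \<and> K * \<tau> x \<le> \<theta> * 2 ^ J" if "x \<in> A" for x
      using \<tau>[OF that] J mult_left_mono[of "\<tau> x" 1 K, OF _ less_imp_le[OF K0]] by auto
    then have "(\<Sum>x\<in>A. g (K * \<tau> x))
        \<le> (\<Sum>j<J. g (\<theta> * 2 ^ j) * card {x \<in> A. K * \<tau> x \<le> \<theta> * 2 ^ Suc j})"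
      by (intro chain_dyadic_bound fin g \<theta>(1) J_pos) auto
    also have "\<dots> \<le> R \<tau>"
      unfolding R_def
    proof (intro sum_mono mult_left_mono L_ge)
      fix j
      show "{x \<in> A. K * \<tau> x \<le> \<theta> * 2 ^ Suc j} \<in> edge_chains id (edge_set n)"
        using A by (rule edge_chains_subset) auto
      show "\<tau> x \<le> q j" if "x \<in> {x \<in> A. K * \<tau> x \<le> \<theta> * 2 ^ Suc j}" for x
        using that K0 by (simp add: q_def field_simps)
    qed (use g(2) \<theta> in auto)
    finally show "(\<Sum>x\<in>A. g (K * \<tau> x)) \<le> R \<tau>" .
  qed
qed

lemma prob_many_small:
  assumes "0 < k" "0 \<le> q"
  shows "measure (canon n) {\<tau> \<in> space (canon n). k \<le> card {x \<in> edge_set n. \<tau> x \<le> q}}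
    \<le> real (card (edge_set n)) * q / real k"
proof -
  define X where "X = (\<lambda>\<tau> :: int \<times> int \<Rightarrow> real. \<Sum>x\<in>edge_set n. of_bool (\<tau> x \<le> q) :: real)"
  have X_eq: "X \<tau> = real (card {x \<in> edge_set n. \<tau> x \<le> q})" for \<tau>
  proof -
    have "{x \<in> edge_set n. \<tau> x \<le> q} = edge_set n \<inter> {x. \<tau> x \<le> q}" by auto
    then show ?thesis by (simp add: X_def of_bool_def sum.If_cases finite_edge_set)
  qed
  have int: "integrable (canon n) (\<lambda>\<tau>. of_bool (\<tau> x \<le> q) :: real)"
    and le: "(\<integral>\<tau>. of_bool (\<tau> x \<le> q) \<partial>canon n) \<le> q" if "x \<in> edge_set n" for x
    using expectation_prod_of_bool[of "{x}" n q] that assms by simp_all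
  have "measure (canon n) {\<tau> \<in> space (canon n). real k \<le> X \<tau>} \<le> (\<integral>\<tau>. X \<tau> \<partial>canon n) / real k"
    using assms int by (intro integral_Markov_inequality_measure[where A = "{}"])
      (auto simp: X_def intro!: AE_I2 sum_nonneg)
  also have "(\<integral>\<tau>. X \<tau> \<partial>canon n) = (\<Sum>x\<in>edge_set n. \<integral>\<tau>. of_bool (\<tau> x \<le> q) \<partial>canon n)"
    unfolding X_def using int by (intro Bochner_Integration.integral_sum) auto
  also have "\<dots> \<le> real (card (edge_set n)) * q"
    using sum_mono[OF le] by simp
  finally show ?thesis by (simp add: X_eq divide_right_mono)
qed

section \<open>Connectivity and the scale of the weights\<close>

lemma indep_vars_canon:
  assumes "0 < n"
  shows "canon.indep_vars n (\<lambda>_. unif) (\<lambda>x \<tau>. \<tau> x) (edge_set n)"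
proof -
  have "(0, 1) \<in> edge_set n" using assms by (auto simp: edge_set_def)
  then have ne: "edge_set n \<noteq> {}" by blast
  have rv: "(\<lambda>\<tau>. \<tau> x) \<in> measurable (canon n) unif" if "x \<in> edge_set n" for x
    using that unfolding canon_def by (rule measurable_component_singleton)
  have "distr (canon n) (\<Pi>\<^sub>M x\<in>edge_set n. unif) (\<lambda>\<tau>. \<lambda>x\<in>edge_set n. \<tau> x)
      = distr (canon n) (canon n) (\<lambda>\<tau>. \<tau>)"
    by (intro distr_cong) (auto simp: canon_def space_PiM)
  also have "\<dots> = canon n" by (rule distr_id2) simp
  also have "canon n = (\<Pi>\<^sub>M x\<in>edge_set n. distr (canon n) unif (\<lambda>\<tau>. \<tau> x))"
    unfolding canon_def by (intro PiM_cong refl unif_prod.PiM_component[symmetric])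
  finally show ?thesis
    using canon.indep_vars_iff_distr_eq_PiM'[OF ne rv] by simp
qed

lemma prob_no_connection:
  assumes n: "0 < n" and p: "0 \<le> p" "p \<le> 1" and ij: "0 \<le> i" "j \<le> int n"
  shows "measure (canon n) {\<tau> \<in> space (canon n). \<forall>l\<in>{i<..<j}. \<not> (\<tau> (i, l) < p \<and> \<tau> (l, j) < p)}
      = (1 - p\<^sup>2) ^ nat (j - i - 1)"
    and "{\<tau> \<in> space (canon n). \<forall>l\<in>{i<..<j}. \<not> (\<tau> (i, l) < p \<and> \<tau> (l, j) < p)} \<in> sets (canon n)"
proof -
  define K where "K = (\<lambda>l. {(i, l), (l, j)})"
  define Y where "Y = (\<lambda>l (r :: int \<times> int \<Rightarrow> real). r (i, l) < p \<and> r (l, j) < p)"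
  have K_sub: "K l \<subseteq> edge_set n" if "l \<in> {i<..<j}" for l
    using that ij by (auto simp: K_def edge_set_def)
  then have edge: "(i, l) \<in> edge_set n" "(l, j) \<in> edge_set n" if "l \<in> {i<..<j}" for l
    using that by (auto simp: K_def)
  have meas: "{\<tau> \<in> space (canon n). \<not> Y l \<tau>} \<in> sets (canon n)" if "l \<in> {i<..<j}" for l
  proof -
    note [measurable] = edge[OF that, THEN measurable_canon_component]
    show ?thesis unfolding Y_def by measurable
  qed
  have eq: "{\<tau> \<in> space (canon n). \<forall>l\<in>{i<..<j}. \<not> (\<tau> (i, l) < p \<and> \<tau> (l, j) < p)}
      = {\<tau> \<in> space (canon n). \<forall>l\<in>{i<..<j}. \<tau> \<in> {\<tau> \<in> space (canon n). \<not> Y l \<tau>}}"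
    by (auto simp: Y_def)
  show "{\<tau> \<in> space (canon n). \<forall>l\<in>{i<..<j}. \<not> (\<tau> (i, l) < p \<and> \<tau> (l, j) < p)} \<in> sets (canon n)"
    unfolding eq using meas by (intro sets.sets_Collect_finite_All) (auto simp: Int_def)
  show "measure (canon n) {\<tau> \<in> space (canon n). \<forall>l\<in>{i<..<j}. \<not> (\<tau> (i, l) < p \<and> \<tau> (l, j) < p)}
      = (1 - p\<^sup>2) ^ nat (j - i - 1)"
  proof (cases "{i<..<j} = {}")
    case True
    then have "i + 1 \<notin> {i<..<j}" by blast
    then have "nat (j - i - 1) = 0" by simp
    then show ?thesis by (simp add: True canon.prob_space)
  next
    case False
    have "disjoint_family_on K {i<..<j}"
      by (auto simp: disjoint_family_on_def K_def)
    then have ind: "canon.indep_vars n (\<lambda>l. PiM (K l) (\<lambda>_. unif)) (\<lambda>l \<tau>. restrict \<tau> (K l)) {i<..<j}"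
      using canon.indep_vars_restrict[where K = K and L = "{i<..<j}", OF indep_vars_canon[OF n] K_sub]
      by simp
    have Ym: "Y l \<in> measurable (PiM (K l) (\<lambda>_. unif)) (count_space UNIV)" if "l \<in> {i<..<j}" for l
    proof -
      have comp: "(\<lambda>r. r x) \<in> borel_measurable (PiM (K l) (\<lambda>_. unif))" if "x \<in> K l" for x
        using that by (rule measurable_PiM_unif_component)
      have [measurable]: "(\<lambda>r. r (i, l)) \<in> borel_measurable (PiM (K l) (\<lambda>_. unif))"
        "(\<lambda>r. r (l, j)) \<in> borel_measurable (PiM (K l) (\<lambda>_. unif))"
        by (rule comp, simp add: K_def)+
      show ?thesis unfolding Y_def by measurable
    qed
    have ind2: "canon.indep_vars n (\<lambda>_. count_space UNIV) (\<lambda>l \<tau>. Y l (restrict \<tau> (K l))) {i<..<j}"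
      using canon.indep_vars_compose2[OF ind Ym] .
    have Y_restrict: "Y l (restrict \<tau> (K l)) = Y l \<tau>" for l \<tau>
      by (simp add: Y_def K_def)
    have single: "measure (canon n) {\<tau> \<in> space (canon n). \<not> Y l \<tau>} = 1 - p\<^sup>2" if l: "l \<in> {i<..<j}" for l
    proof -
      have "{\<tau> \<in> space (canon n). Y l \<tau>} = {\<tau> \<in> space (canon n). \<forall>x\<in>K l. \<tau> x \<in> {..<p}}"
        by (simp add: Y_def K_def)
      then have "measure (canon n) {\<tau> \<in> space (canon n). Y l \<tau>} = (\<Prod>x\<in>K l. measure unif {..<p})"
        using measure_canon_Collect[OF K_sub[OF l], of "\<lambda>_. {..<p}"] by simp
      also have "\<dots> = p\<^sup>2"
        using l p by (simp add: K_def measure_unif_lessThan power2_eq_square)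
      finally have "measure (canon n) {\<tau> \<in> space (canon n). Y l \<tau>} = p\<^sup>2" .
      moreover have "{\<tau> \<in> space (canon n). Y l \<tau>} = space (canon n) - {\<tau> \<in> space (canon n). \<not> Y l \<tau>}"
        by auto
      ultimately show ?thesis using canon.prob_compl[OF meas[OF l]] by simp
    qed
    have "{\<tau> \<in> space (canon n). \<forall>l\<in>{i<..<j}. \<not> (\<tau> (i, l) < p \<and> \<tau> (l, j) < p)}
        = (\<Inter>l\<in>{i<..<j}. (\<lambda>\<tau>. Y l (restrict \<tau> (K l))) -` {False} \<inter> space (canon n))"
      using False unfolding Y_restrict by (auto simp: Y_def)
    then have "measure (canon n) {\<tau> \<in> space (canon n). \<forall>l\<in>{i<..<j}. \<not> (\<tau> (i, l) < p \<and> \<tau> (l, j) < p)}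
        = (\<Prod>l\<in>{i<..<j}. measure (canon n) ((\<lambda>\<tau>. Y l (restrict \<tau> (K l))) -` {False} \<inter> space (canon n)))"
      using canon.indep_varsD_finite[OF ind2 False, of "\<lambda>_. {False}"] by simp
    also have "\<dots> = (\<Prod>l\<in>{i<..<j}. 1 - p\<^sup>2)"
    proof (rule prod.cong[OF refl])
      fix l assume l: "l \<in> {i<..<j}"
      have "(\<lambda>\<tau>. Y l (restrict \<tau> (K l))) -` {False} \<inter> space (canon n) = {\<tau> \<in> space (canon n). \<not> Y l \<tau>}"
        unfolding Y_restrict by auto
      then show "measure (canon n) ((\<lambda>\<tau>. Y l (restrict \<tau> (K l))) -` {False} \<inter> space (canon n)) = 1 - p\<^sup>2"
        using single[OF l] by simp
    qed
    finally show ?thesis by (simp add: card_greaterThanLessThan_int diff_diff_eq)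
  qed
qed

lemma prob_not_connected:
  assumes n: "0 < n" and p: "0 \<le> p" "p \<le> 1" and d: "real (Suc m) \<le> d"
  shows "{\<tau> \<in> space (canon n). \<not> connected_gaps (\<lambda>x. \<tau> x < p) n d} \<in> sets (canon n)"
    and "measure (canon n) {\<tau> \<in> space (canon n). \<not> connected_gaps (\<lambda>x. \<tau> x < p) n d}
      \<le> (real n + 1)\<^sup>2 * (1 - p\<^sup>2) ^ m"
proof -
  define S where "S = {(i, j). 0 \<le> i \<and> i \<le> int n \<and> 0 \<le> j \<and> j \<le> int n \<and> of_int i + d \<le> of_int j}"
  define B where "B = (\<lambda>(i, j). {\<tau> \<in> space (canon n). \<forall>l\<in>{i<..<j}. \<not> (\<tau> (i, l) < p \<and> \<tau> (l, j) < p)})"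
  have S_sub: "S \<subseteq> {0..int n} \<times> {0..int n}" by (auto simp: S_def)
  then have fin: "finite S" by (rule finite_subset) simp
  have "card S \<le> card ({0..int n} \<times> {0..int n})" using S_sub by (intro card_mono) auto
  also have "\<dots> = (n + 1)\<^sup>2"
    by (simp add: card_cartesian_product power2_eq_square nat_add_distrib)
  finally have "real (card S) \<le> real ((n + 1)\<^sup>2)" by (rule of_nat_mono)
  then have card_S: "real (card S) \<le> (real n + 1)\<^sup>2" by (simp add: add.commute)
  have eq: "{\<tau> \<in> space (canon n). \<not> connected_gaps (\<lambda>x. \<tau> x < p) n d} = (\<Union>x\<in>S. B x)"
  proof -
    have "i \<le> int n \<and> 0 \<le> j" if "0 \<le> i" "j \<le> int n" "of_int i + d \<le> of_int j" for i j
    proof -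
      have "of_int i \<le> (of_int j :: real)" using that(3) d by simp
      then show ?thesis using that by simp
    qed
    then have S_iff: "(i, j) \<in> S \<longleftrightarrow> 0 \<le> i \<and> j \<le> int n \<and> of_int i + d \<le> of_int j" for i j
      by (auto simp: S_def)
    have "\<not> connected_gaps (\<lambda>x. \<tau> x < p) n d \<longleftrightarrow>
        (\<exists>i j. (i, j) \<in> S \<and> (\<forall>l. i < l \<and> l < j \<longrightarrow> \<not> (\<tau> (i, l) < p \<and> \<tau> (l, j) < p)))" for \<tau> :: "int \<times> int \<Rightarrow> real"
      unfolding connected_gaps_def S_iff by blast
    then show ?thesis
      unfolding B_def by (simp add: set_eq_iff Bex_def Ball_def split_paired_Ex) blast
  qed
  have B_sets: "B x \<in> sets (canon n)" if "x \<in> S" for x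
    using that prob_no_connection(2)[OF n p] by (auto simp: B_def S_def)
  show "{\<tau> \<in> space (canon n). \<not> connected_gaps (\<lambda>x. \<tau> x < p) n d} \<in> sets (canon n)"
    unfolding eq using fin B_sets by (intro sets.finite_UN) auto
  have p2: "p\<^sup>2 \<le> 1" using p by (simp add: power_le_one)
  have "measure (canon n) (\<Union>x\<in>S. B x) \<le> (\<Sum>x\<in>S. measure (canon n) (B x))"
    using fin B_sets by (intro canon.finite_measure_subadditive_finite) auto
  also have "\<dots> \<le> (\<Sum>x\<in>S. (1 - p\<^sup>2) ^ m)"
  proof (rule sum_mono)
    fix x assume x: "x \<in> S"
    obtain i j where ij: "x = (i, j)" by (cases x)
    have "real (Suc m) \<le> of_int (j - i)" using x d by (simp add: S_def ij)
    then have "m \<le> nat (j - i - 1)" by linarith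
    then have "(1 - p\<^sup>2) ^ nat (j - i - 1) \<le> (1 - p\<^sup>2) ^ m"
      using p2 by (intro power_decreasing) auto
    then show "measure (canon n) (B x) \<le> (1 - p\<^sup>2) ^ m"
      using prob_no_connection(1)[OF n p, of i j] x by (simp add: B_def S_def ij)
  qed
  also have "\<dots> \<le> (real n + 1)\<^sup>2 * (1 - p\<^sup>2) ^ m"
    using card_S p2 by (simp add: mult_right_mono)
  finally show "measure (canon n) {\<tau> \<in> space (canon n). \<not> connected_gaps (\<lambda>x. \<tau> x < p) n d}
      \<le> (real n + 1)\<^sup>2 * (1 - p\<^sup>2) ^ m"
    by (simp add: eq)
qed

lemma prob_not_connected_tendsto_0:
  assumes p: "0 < p" "p \<le> 1"
  shows "(\<lambda>n. measure (canon n) {\<tau> \<in> space (canon n). \<not> connected_gaps (\<lambda>x. \<tau> x < p) n (sqrt n)})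
    \<longlonglongrightarrow> 0"
proof -
  define q where "q = max (1 - p\<^sup>2) (1 / 2)"
  have "p\<^sup>2 \<le> 1" "0 < p\<^sup>2" using p by (auto simp: power_le_one)
  then have q: "0 < q" "q < 1" "1 - p\<^sup>2 \<le> q" "0 \<le> 1 - p\<^sup>2" by (auto simp: q_def)
  define m where "m = (\<lambda>n::nat. nat \<lfloor>sqrt n\<rfloor> - 1)"
  have "filterlim (\<lambda>n::nat. nat \<lfloor>sqrt n\<rfloor>) at_top sequentially"
    by (intro filterlim_compose[OF filterlim_nat_sequentially]
        filterlim_compose[OF filterlim_floor_sequentially]
        filterlim_compose[OF sqrt_at_top] filterlim_real_sequentially)
  then have m: "filterlim m at_top sequentially"
    unfolding m_def by (rule filterlim_compose[OF filterlim_minus_const_nat_at_top])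
  have "(\<lambda>m::nat. ((real m + 2)\<^sup>2 + 1)\<^sup>2 * q ^ m) \<longlonglongrightarrow> 0"
    using q(1,2) by real_asymp
  then have lim: "(\<lambda>n. ((real (m n) + 2)\<^sup>2 + 1)\<^sup>2 * q ^ m n) \<longlonglongrightarrow> 0"
    using m by (rule filterlim_compose)
  show ?thesis
  proof (rule tendsto_sandwich[OF _ _ tendsto_const lim])
    show "\<forall>\<^sub>F n in sequentially. measure (canon n) {\<tau> \<in> space (canon n). \<not> connected_gaps (\<lambda>x. \<tau> x < p) n (sqrt n)}
        \<le> ((real (m n) + 2)\<^sup>2 + 1)\<^sup>2 * q ^ m n"
      using eventually_gt_at_top[of 0]
    proof eventually_elim
      case (elim n)
      have s1: "1 \<le> sqrt n" using elim by simp
      then have fl: "1 \<le> \<lfloor>sqrt n\<rfloor>" by simp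
      have "real (Suc (m n)) = of_int \<lfloor>sqrt n\<rfloor>" using fl by (simp add: m_def of_nat_diff)
      then have sm: "real (Suc (m n)) \<le> sqrt n" "sqrt n \<le> real (m n) + 2" by linarith+
      have "real n = (sqrt n)\<^sup>2" by simp
      also have "\<dots> \<le> (real (m n) + 2)\<^sup>2" using sm s1 by (intro power_mono) auto
      finally have "(real n + 1)\<^sup>2 \<le> ((real (m n) + 2)\<^sup>2 + 1)\<^sup>2" by (intro power_mono) auto
      moreover have "(1 - p\<^sup>2) ^ m n \<le> q ^ m n" using q by (intro power_mono) auto
      ultimately have "(real n + 1)\<^sup>2 * (1 - p\<^sup>2) ^ m n \<le> ((real (m n) + 2)\<^sup>2 + 1)\<^sup>2 * q ^ m n"
        using q by (intro mult_mono) auto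
      then show ?case
        using prob_not_connected(2)[OF elim less_imp_le[OF p(1)] p(2) sm(1)] by linarith
    qed
  qed simp
qed

context heavy_tail
begin

abbreviation "K n \<equiv> real (card (edge_set n))"

definition scaled :: "nat \<Rightarrow> real \<Rightarrow> real" where
  "scaled n t = p powr (- 1 / s) * h (t / K n) / h (p / K n)"

lemma K_at_top: "filterlim K at_top sequentially"
  unfolding real_card_edge_set by real_asymp

lemma inverse_K: "0 < c \<Longrightarrow> filterlim (\<lambda>n. c / K n) (at_right 0) sequentially"
  unfolding real_card_edge_set by real_asymp

lemma scaled_tendsto:
  assumes "0 < t"
  shows "(\<lambda>n. scaled n t) \<longlonglongrightarrow> t powr (- 1 / s)"
proof -
  have "((\<lambda>n. h (t / p * (p / K n)) / h (p / K n)) \<longlonglongrightarrow> (t / p) powr (- 1 / s))"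
    using assms p_pos by (intro filterlim_compose[OF tail_inverse_ratio inverse_K]) auto
  then have "((\<lambda>n. p powr (- 1 / s) * (h (t / p * (p / K n)) / h (p / K n)))
      \<longlonglongrightarrow> p powr (- 1 / s) * (t / p) powr (- 1 / s))"
    by (rule tendsto_mult_left)
  moreover have "p powr (- 1 / s) * (t / p) powr (- 1 / s) = t powr (- 1 / s)"
    using assms p_pos by (simp flip: powr_mult)
  ultimately show ?thesis using p_pos by (simp add: scaled_def)
qed

lemma scaled_bound:
  assumes "s < 2"
  obtains C r where "0 \<le> C" "0 < r" "r * sqrt 2 < 1"
    "eventually (\<lambda>n. \<forall>j. 2 ^ j \<le> K n \<longrightarrow> scaled n (2 ^ j) \<le> C * r ^ j) sequentially"
proof -
  obtain r u0 where r: "0 < r" "r * sqrt 2 < 1" and u0: "0 < u0"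
    and doubling: "\<And>u. 0 < u \<Longrightarrow> u \<le> u0 \<Longrightarrow> h (2 * u) \<le> r * h u"
    using tail_inverse_doubling[OF assms] by blast
  have "r * 1 \<le> r * sqrt 2" using r by (intro mult_left_mono) auto
  then have r1: "r \<le> 1" using r by linarith
  obtain m where "1 / u0 < 2 ^ m" using real_arch_pow[of 2 "1 / u0"] by auto
  then have m: "1 \<le> u0 * 2 ^ m" using u0 by (simp add: field_simps)
  have iter: "h (2 ^ j * u) \<le> r ^ j * h u" if "0 < u" "2 ^ j * u \<le> 2 * u0" for j u
    using that
  proof (induction j)
    case (Suc j)
    have "2 ^ j * u \<le> 2 ^ Suc j * u" using Suc.prems(1) by simp
    then have "2 ^ j * u \<le> 2 * u0" using Suc.prems by linarith
    then have "h (2 ^ j * u) \<le> r ^ j * h u" using Suc by blast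
    moreover have "h (2 * (2 ^ j * u)) \<le> r * h (2 ^ j * u)"
      using Suc.prems by (intro doubling) auto
    ultimately have "h (2 * (2 ^ j * u)) \<le> r * (r ^ j * h u)"
      using r by (meson mult_left_mono less_imp_le order_trans)
    then show ?case by (simp add: mult.assoc)
  qed simp
  have all: "h (2 ^ j * u) \<le> (1 / r) ^ m * r ^ j * h u" if "0 < u" "2 ^ j * u \<le> 1" for j u
  proof (cases "m \<le> j")
    case True
    have split: "(2::real) ^ j = 2 ^ m * 2 ^ (j - m)" "r ^ j = r ^ m * r ^ (j - m)"
      using True by (simp_all flip: power_add)
    have "2 ^ m * (2 ^ (j - m) * u) = 2 ^ j * u" by (simp add: split mult.assoc)
    also have "\<dots> \<le> 2 ^ m * u0" using that m by (simp add: mult.commute)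
    finally have "2 ^ m * (2 ^ (j - m) * u) \<le> 2 ^ m * u0" .
    then have "2 ^ (j - m) * u \<le> 2 * u0" using u0 by simp
    then have "h (2 ^ (j - m) * u) \<le> r ^ (j - m) * h u" using that by (intro iter) auto
    moreover have "h (2 ^ j * u) \<le> h (2 ^ (j - m) * u)"
      using that True by (intro tail_inverse_antimono mult_right_mono power_increasing) auto
    ultimately show ?thesis using r by (simp add: split power_divide)
  next
    case False
    have "h (2 ^ j * u) \<le> h (2 ^ 0 * u)"
      using that by (intro tail_inverse_antimono mult_right_mono power_increasing) auto
    also have "\<dots> \<le> (1 / r) ^ m * r ^ j * h u"
    proof -
      have "r ^ m \<le> r ^ j" using False r r1 by (intro power_decreasing) auto
      then have "1 \<le> (1 / r) ^ m * r ^ j" using r by (simp add: power_divide)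
      then have "1 * h u \<le> (1 / r) ^ m * r ^ j * h u"
        using tail_inverse_in(1)[OF that(1)] by (intro mult_right_mono) auto
      then show ?thesis by simp
    qed
    finally show ?thesis .
  qed
  have "eventually (\<lambda>n. scaled n 1 < 2) sequentially"
    using scaled_tendsto[of 1] by (intro order_tendstoD) auto
  then have ev: "eventually (\<lambda>n. \<forall>j. 2 ^ j \<le> K n \<longrightarrow> scaled n (2 ^ j) \<le> 2 * (1 / r) ^ m * r ^ j) sequentially"
    using eventually_gt_at_top[of 0]
  proof eventually_elim
    case (elim n)
    have K: "0 < K n" using elim(2) by (simp add: real_card_edge_set)
    define c where "c = p powr (- 1 / s) / h (p / K n)"
    have c: "0 \<le> c"
      using tail_inverse_in(1)[of "p / K n"] K p_pos by (simp add: c_def)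
    have sc: "scaled n t = c * h (t / K n)" for t by (simp add: scaled_def c_def)
    show ?case
    proof (intro allI impI)
      fix j assume j: "2 ^ j \<le> K n"
      have "h (2 ^ j * (1 / K n)) \<le> (1 / r) ^ m * r ^ j * h (1 / K n)"
        using j K by (intro all) (auto simp: field_simps)
      then have "scaled n (2 ^ j) \<le> (1 / r) ^ m * r ^ j * scaled n 1"
        using mult_left_mono[OF _ c] by (simp add: sc mult.left_commute)
      also have "\<dots> \<le> (1 / r) ^ m * r ^ j * 2"
        using elim(1) r by (intro mult_left_mono) auto
      finally show "scaled n (2 ^ j) \<le> 2 * (1 / r) ^ m * r ^ j" by simp
    qed
  qed
  show ?thesis using r ev by (intro that[of "2 * (1 / r) ^ m" r]) auto
qed

lemma scaled_tail_sum:
  assumes "s < 2"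
  obtains \<psi> :: "nat \<Rightarrow> real" where "\<psi> \<longlonglongrightarrow> 0"
    "eventually (\<lambda>n. \<forall>i. (\<Sum>j | 2 ^ i * 2 ^ j < K n. scaled n (2 ^ i * 2 ^ j) * (4 * sqrt (2 ^ i * 2 ^ j) / ln 2)) \<le> \<psi> i)
      sequentially"
proof -
  obtain C r where C: "0 \<le> C" and r: "0 < r" "r * sqrt 2 < 1" and
    ev: "eventually (\<lambda>n. \<forall>j. 2 ^ j \<le> K n \<longrightarrow> scaled n (2 ^ j) \<le> C * r ^ j) sequentially"
    using scaled_bound[OF assms] by blast
  define q where "q = r * sqrt 2"
  have q: "0 < q" "q < 1" using r by (auto simp: q_def)
  define D where "D = 4 * C / ln 2"
  have D: "0 \<le> D" using C by (simp add: D_def)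
  show ?thesis
  proof (rule that[of "\<lambda>i. D * q ^ i * (1 / (1 - q))"])
    have "(\<lambda>i. q ^ i) \<longlonglongrightarrow> 0" using q by (intro LIMSEQ_realpow_zero) auto
    then show "(\<lambda>i. D * q ^ i * (1 / (1 - q))) \<longlonglongrightarrow> 0"
      by (intro tendsto_mult_left_zero tendsto_mult_right_zero)
    from ev show "eventually (\<lambda>n. \<forall>i. (\<Sum>j | 2 ^ i * 2 ^ j < K n.
        scaled n (2 ^ i * 2 ^ j) * (4 * sqrt (2 ^ i * 2 ^ j) / ln 2)) \<le> D * q ^ i * (1 / (1 - q))) sequentially"
    proof eventually_elim
      case (elim n)
      show ?case
      proof
        fix i
        obtain N where N: "K n < 2 ^ N" using real_arch_pow[of 2 "K n"] by auto
        have "j < N" if "2 ^ i * 2 ^ j < K n" for j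
        proof (rule ccontr)
          assume "\<not> j < N"
          then have "(2::real) ^ N \<le> 2 ^ (i + j)" by (intro power_increasing) auto
          then show False using that N by (simp add: power_add)
        qed
        then have sub: "{j. 2 ^ i * 2 ^ j < K n} \<subseteq> {..<N}" by auto
        have "(\<Sum>j | 2 ^ i * 2 ^ j < K n. scaled n (2 ^ i * 2 ^ j) * (4 * sqrt (2 ^ i * 2 ^ j) / ln 2))
            \<le> (\<Sum>j | 2 ^ i * 2 ^ j < K n. D * q ^ i * q ^ j)"
        proof (rule sum_mono)
          fix j assume "j \<in> {j. 2 ^ i * 2 ^ j < K n}"
          then have "scaled n (2 ^ (i + j)) \<le> C * r ^ (i + j)"
            using elim[rule_format, of "i + j"] by (simp add: power_add)
          then have "scaled n (2 ^ (i + j)) * (4 * sqrt (2 ^ (i + j)) / ln 2)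
              \<le> C * r ^ (i + j) * (4 * sqrt (2 ^ (i + j)) / ln 2)"
            by (intro mult_right_mono) auto
          also have "\<dots> = D * q ^ (i + j)"
            by (simp add: D_def q_def power_mult_distrib real_sqrt_power)
          finally show "scaled n (2 ^ i * 2 ^ j) * (4 * sqrt (2 ^ i * 2 ^ j) / ln 2) \<le> D * q ^ i * q ^ j"
            by (simp add: power_add mult.assoc)
        qed
        also have "\<dots> \<le> (\<Sum>j<N. D * q ^ i * q ^ j)"
          using D q sub by (intro sum_mono2) auto
        also have "\<dots> = D * q ^ i * (\<Sum>j<N. q ^ j)" by (simp add: sum_distrib_left)
        also have "(\<Sum>j<N. q ^ j) \<le> 1 / (1 - q)"
          using q by (simp add: sum_gp_strict divide_right_mono)
        finally show "(\<Sum>j | 2 ^ i * 2 ^ j < K n. scaled n (2 ^ i * 2 ^ j) * (4 * sqrt (2 ^ i * 2 ^ j) / ln 2))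
            \<le> D * q ^ i * (1 / (1 - q))"
          using D q by (simp add: mult_left_mono)
      qed
    qed
  qed
qed

end

section \<open>The smallest labels\<close>

lemma (in prob_space) AE_indep_vars_neq:
  fixes X :: "'i \<Rightarrow> 'a \<Rightarrow> real"
  assumes ind: "indep_vars (\<lambda>_. borel) X I" and ij: "i \<in> I" "j \<in> I" "i \<noteq> j"
    and atomless: "\<And>y. emeasure (distr M borel (X i)) {y} = 0"
  shows "AE \<omega> in M. X i \<omega> \<noteq> X j \<omega>"
proof -
  have "indep_var (PiM {i} (\<lambda>_. borel)) (\<lambda>\<omega>. restrict (\<lambda>i. X i \<omega>) {i})
      (PiM {j} (\<lambda>_. borel)) (\<lambda>\<omega>. restrict (\<lambda>i. X i \<omega>) {j})"
    using ind ij by (intro indep_var_restrict) auto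
  then have "indep_var borel ((\<lambda>r. r i) \<circ> (\<lambda>\<omega>. restrict (\<lambda>i. X i \<omega>) {i}))
      borel ((\<lambda>r. r j) \<circ> (\<lambda>\<omega>. restrict (\<lambda>i. X i \<omega>) {j}))"
    by (rule indep_var_compose) (auto intro: measurable_component_singleton)
  then have ind2: "indep_var borel (X i) borel (X j)"
    by (simp add: o_def)
  have [measurable]: "X i \<in> borel_measurable M" "X j \<in> borel_measurable M"
    using ind2 by (auto dest: indep_var_rv1 indep_var_rv2)
  interpret X: prob_space "distr M borel (X i)" by (rule prob_space_distr) simp
  interpret Y: prob_space "distr M borel (X j)" by (rule prob_space_distr) simp
  interpret XY: pair_sigma_finite "distr M borel (X i)" "distr M borel (X j)" ..
  let ?D = "{x \<in> space (borel \<Otimes>\<^sub>M borel). fst x = (snd x :: real)}"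
  have D: "?D \<in> sets (borel \<Otimes>\<^sub>M borel)" by measurable
  have "emeasure M {\<omega> \<in> space M. X i \<omega> = X j \<omega>}
      = emeasure (distr M (borel \<Otimes>\<^sub>M borel) (\<lambda>\<omega>. (X i \<omega>, X j \<omega>))) ?D"
    using D by (subst emeasure_distr) (auto simp: space_pair_measure intro!: arg_cong[where f = "emeasure M"])
  also have "\<dots> = emeasure (distr M borel (X i) \<Otimes>\<^sub>M distr M borel (X j)) ?D"
    using ind2 by (simp add: indep_var_distribution_eq)
  also have "\<dots> = (\<integral>\<^sup>+y. emeasure (distr M borel (X i)) ((\<lambda>x. (x, y)) -` ?D) \<partial>distr M borel (X j))"
    using D by (intro XY.emeasure_pair_measure_alt2) (simp cong: sets_pair_measure_cong)
  also have "\<dots> = (\<integral>\<^sup>+y. 0 \<partial>distr M borel (X j))"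
  proof (rule nn_integral_cong)
    fix y
    have "(\<lambda>x. (x, y)) -` ?D = {y}" by (auto simp: space_pair_measure)
    then show "emeasure (distr M borel (X i)) ((\<lambda>x. (x, y)) -` ?D) = 0" by (simp add: atomless)
  qed
  finally show ?thesis by (intro AE_I[of _ _ "{\<omega> \<in> space M. X i \<omega> = X j \<omega>}"]) auto
qed

lemma emeasure_unif_singleton: "emeasure unif {y} = 0"
proof -
  have "emeasure lborel ({0..1} \<inter> {y}) \<le> emeasure lborel {y}" by (intro emeasure_mono) auto
  then show ?thesis by (simp add: unif_def emeasure_uniform_measure)
qed

lemma AE_canon_inj: "AE \<tau> in canon n. inj_on \<tau> (edge_set n)"
proof (cases "n = 0")
  case True
  then have "edge_set n = {}" by (auto simp: edge_set_def)
  then show ?thesis by simp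
next
  case False
  have ind: "canon.indep_vars n (\<lambda>_. borel) (\<lambda>x \<tau>. \<tau> x) (edge_set n)"
    using canon.indep_vars_compose2[OF indep_vars_canon, of n "\<lambda>_ x. x" "\<lambda>_. borel"] False
    by (simp add: measurable_ident_sets)
  have "AE \<tau> in canon n. \<forall>y\<in>edge_set n. x \<noteq> y \<longrightarrow> \<tau> x \<noteq> \<tau> y" if x: "x \<in> edge_set n" for x
  proof (intro AE_finite_allI finite_edge_set)
    fix y assume y: "y \<in> edge_set n"
    have "distr (canon n) borel (\<lambda>\<tau>. \<tau> x) = distr (canon n) unif (\<lambda>\<tau>. \<tau> x)"
      by (rule distr_cong) auto
    also have "\<dots> = unif"
      unfolding canon_def by (rule unif_prod.PiM_component[OF x])
    finally have "emeasure (distr (canon n) borel (\<lambda>\<tau>. \<tau> x)) {z} = 0" for z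
      by (simp add: emeasure_unif_singleton)
    then show "AE \<tau> in canon n. x \<noteq> y \<longrightarrow> \<tau> x \<noteq> \<tau> y"
      using canon.AE_indep_vars_neq[OF ind x y] by (cases "x = y") auto
  qed
  then have "AE \<tau> in canon n. \<forall>x\<in>edge_set n. \<forall>y\<in>edge_set n. x \<noteq> y \<longrightarrow> \<tau> x \<noteq> \<tau> y"
    by (rule AE_finite_allI[OF finite_edge_set])
  then show ?thesis by eventually_elim (auto simp: inj_on_def)
qed

definition tuples :: "nat \<Rightarrow> nat \<Rightarrow> (nat \<Rightarrow> int \<times> int) set" where
  "tuples n k = {x \<in> {..<k} \<rightarrow>\<^sub>E edge_set n. inj_on x {..<k}}"

definition pos_increasing :: "nat \<Rightarrow> (nat \<Rightarrow> real) \<Rightarrow> bool" where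
  "pos_increasing k u \<longleftrightarrow> (\<forall>i<k. (if i = 0 then 0 else u (i - 1)) < u i)"

definition smallest :: "nat \<Rightarrow> nat \<Rightarrow> (nat \<Rightarrow> int \<times> int) \<Rightarrow> (int \<times> int \<Rightarrow> real) \<Rightarrow> bool" where
  "smallest n k x \<tau> \<longleftrightarrow> pos_increasing k (\<lambda>i. \<tau> (x i)) \<and>
     (\<forall>y \<in> edge_set n - x ` {..<k}. \<tau> (x (k - 1)) < \<tau> y)"

lemma finite_tuples: "finite (tuples n k)"
  by (rule finite_subset[of _ "{..<k} \<rightarrow>\<^sub>E edge_set n"]) (auto simp: tuples_def finite_PiE finite_edge_set)

lemma pos_increasing_less:
  assumes "pos_increasing k u" "i < j" "j < k"
  shows "u i < u j"
  using assms(2,3)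
proof (induction j)
  case (Suc j)
  have "u j < u (Suc j)" using assms(1) Suc.prems by (auto simp: pos_increasing_def)
  then show ?case using Suc by (cases "i = j") auto
qed simp

lemma pos_increasing_sorted: "pos_increasing k u \<Longrightarrow> sorted_wrt (<) (map u [0..<k])"
  by (auto simp: sorted_wrt_iff_nth_less intro: pos_increasing_less)

lemma smallest_sorted:
  assumes inj: "inj_on \<tau> (edge_set n)" and k: "0 < k" and x: "x \<in> tuples n k" and S: "smallest n k x \<tau>" and i: "i < k"
  shows "\<tau> (x i) = sorted_list_of_set (\<tau> ` edge_set n) ! i"
proof -
  define ys where "ys = sorted_list_of_set (\<tau> ` (edge_set n - x ` {..<k}))"
  have fin: "finite (\<tau> ` A)" if "A \<subseteq> edge_set n" for A
    using that finite_edge_set finite_subset by blast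
  have xE: "x j \<in> edge_set n" if "j < k" for j using x that by (auto simp: tuples_def)
  have set_ys: "set ys = \<tau> ` (edge_set n - x ` {..<k})" by (simp add: ys_def fin)
  have "sorted_wrt (<) (map (\<lambda>i. \<tau> (x i)) [0..<k] @ ys)"
    unfolding sorted_wrt_append
  proof (intro conjI ballI)
    show "sorted_wrt (<) (map (\<lambda>i. \<tau> (x i)) [0..<k])"
      using S by (intro pos_increasing_sorted) (simp add: smallest_def)
    show "sorted_wrt (<) ys" by (simp add: ys_def)
    fix a b assume a: "a \<in> set (map (\<lambda>i. \<tau> (x i)) [0..<k])" and b: "b \<in> set ys"
    obtain j where j: "j < k" "a = \<tau> (x j)" using a by auto
    have "\<tau> (x j) \<le> \<tau> (x (k - 1))"
    proof (cases "j = k - 1")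
      case False
      then have "j < k - 1" "k - 1 < k" using j k by auto
      then show ?thesis
        using pos_increasing_less[of k "\<lambda>i. \<tau> (x i)" j "k - 1"] S by (simp add: smallest_def)
    qed simp
    moreover have "\<tau> (x (k - 1)) < b" using S b by (auto simp: smallest_def set_ys)
    ultimately show "a < b" using j by simp
  qed
  moreover have "set (map (\<lambda>i. \<tau> (x i)) [0..<k] @ ys) = \<tau> ` edge_set n"
    using xE by (auto simp: set_ys)
  ultimately have "map (\<lambda>i. \<tau> (x i)) [0..<k] @ ys = sorted_list_of_set (\<tau> ` edge_set n)"
    by (intro strict_sorted_equal) (auto simp: fin)
  then show ?thesis using i by (metis (no_types, lifting) add_0 diff_zero length_map length_upt nth_append nth_map nth_upt)
qed

lemma ex1_smallest:
  assumes inj: "inj_on \<tau> (edge_set n)" and pos: "\<And>x. x \<in> edge_set n \<Longrightarrow> 0 < \<tau> x"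
    and k: "0 < k" "k \<le> card (edge_set n)"
  shows "\<exists>!x. x \<in> tuples n k \<and> smallest n k x \<tau>"
proof (rule ex_ex1I)
  define l where "l = sorted_list_of_set (\<tau> ` edge_set n)"
  have fin: "finite (\<tau> ` edge_set n)" by (simp add: finite_edge_set)
  have len: "length l = card (edge_set n)" by (simp add: l_def card_image[OF inj])
  have set_l: "set l = \<tau> ` edge_set n" by (simp add: l_def fin)
  have l_less: "l ! i < l ! j" if "i < j" "j < length l" for i j
  proof -
    have "sorted_wrt (<) l" by (simp add: l_def)
    then show ?thesis using that by (simp add: sorted_wrt_iff_nth_less)
  qed
  define x where "x = (\<lambda>i\<in>{..<k}. the_inv_into (edge_set n) \<tau> (l ! i))"
  have x: "x i \<in> edge_set n" "\<tau> (x i) = l ! i" if "i < k" for i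
  proof -
    have "l ! i \<in> \<tau> ` edge_set n" using that k(2) len by (simp flip: set_l)
    then show "x i \<in> edge_set n" "\<tau> (x i) = l ! i"
      using the_inv_into_into[OF inj _ subset_refl] f_the_inv_into_f[OF inj] that by (auto simp: x_def)
  qed
  have "inj_on x {..<k}"
    by (rule inj_onI) (metis l_less x(2) k(2) len lessThan_iff less_le_trans nat_neq_iff order_less_irrefl)
  then have "x \<in> tuples n k" using x(1) by (auto simp: tuples_def x_def)
  moreover have "smallest n k x \<tau>"
    unfolding smallest_def pos_increasing_def
  proof (intro conjI allI impI ballI)
    fix i assume i: "i < k"
    show "(if i = 0 then 0 else \<tau> (x (i - 1))) < \<tau> (x i)"
      using x[OF i] pos[of "x i"] x(2)[of "i - 1"] l_less[of "i - 1" i] i k(2) len by auto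
  next
    fix y assume y: "y \<in> edge_set n - x ` {..<k}"
    then have "\<tau> y \<in> set l" by (simp add: set_l)
    then obtain j where j: "j < length l" "l ! j = \<tau> y" by (auto simp: in_set_conv_nth)
    have "k \<le> j"
    proof (rule ccontr)
      assume "\<not> k \<le> j"
      then have "x j = y" using x[of j] j y inj by (auto simp: inj_on_def)
      then show False using y \<open>\<not> k \<le> j\<close> by auto
    qed
    then show "\<tau> (x (k - 1)) < \<tau> y" using x(2)[of "k - 1"] l_less[of "k - 1" j] j k(1) by simp
  qed
  ultimately show "\<exists>x. x \<in> tuples n k \<and> smallest n k x \<tau>" by blast
next
  fix x x' assume x: "x \<in> tuples n k \<and> smallest n k x \<tau>" and x': "x' \<in> tuples n k \<and> smallest n k x' \<tau>"
  show "x = x'"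
  proof
    fix i
    show "x i = x' i"
    proof (cases "i < k")
      case True
      have "\<tau> (x i) = \<tau> (x' i)"
        using smallest_sorted[OF inj k(1) _ _ True, of x] smallest_sorted[OF inj k(1) _ _ True, of x'] x x'
        by simp
      moreover have "x i \<in> edge_set n" "x' i \<in> edge_set n"
        using x x' True by (auto simp: tuples_def)
      ultimately show ?thesis using inj by (auto simp: inj_on_def)
    next
      case False
      then show ?thesis using x x' by (auto simp: tuples_def PiE_def extensional_def)
    qed
  qed
qed

lemma measure_unif_greaterThan: "measure unif {c<..} = max 0 (min 1 (1 - c))"
proof -
  consider "c < 0" | "0 \<le> c" "c \<le> 1" | "1 < c" by linarith
  then show ?thesis
  proof cases
    case 1
    then have "{0..1} \<inter> {c<..} = {0..1}" by auto
    then show ?thesis using 1 by (simp add: unif_def measure_uniform_measure)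
  next
    case 2
    then have "{0..1} \<inter> {c<..} = {c<..1}" by auto
    then show ?thesis using 2 by (simp add: unif_def measure_uniform_measure)
  next
    case 3
    then have "{0..1} \<inter> {c<..} = {}" by auto
    then show ?thesis using 3 by (simp add: unif_def measure_uniform_measure)
  qed
qed

lemma pos_increasing_measurable [measurable]:
  assumes "\<And>i. i < k \<Longrightarrow> (\<lambda>\<omega>. u \<omega> i) \<in> borel_measurable M"
  shows "Measurable.pred M (\<lambda>\<omega>. pos_increasing k (u \<omega>))"
proof -
  have "Measurable.pred M (\<lambda>\<omega>. (if i = 0 then 0 else u \<omega> (i - 1)) < u \<omega> i)" if "i < k" for i
  proof -
    have "(\<lambda>\<omega>. u \<omega> i) \<in> borel_measurable M" "(\<lambda>\<omega>. if i = 0 then 0 else u \<omega> (i - 1)) \<in> borel_measurable M"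
      using that assms by (cases "i = 0"; simp)+
    then show ?thesis by (intro borel_measurable_pred_less)
  qed
  then have "Measurable.pred M (\<lambda>\<omega>. \<forall>i\<in>{..<k}. (if i = 0 then 0 else u \<omega> (i - 1)) < u \<omega> i)"
    by (intro pred_intros_finite(3) finite_lessThan) (simp only: lessThan_iff)
  then show ?thesis unfolding pos_increasing_def by (simp only: Ball_def lessThan_iff)
qed

lemma smallest_measurable:
  assumes x: "x \<in> tuples n k" and k: "0 < k"
  shows "Measurable.pred (canon n) (smallest n k x)"
proof -
  have xE: "x i \<in> edge_set n" if "i < k" for i using x that by (auto simp: tuples_def)
  have "Measurable.pred (canon n) (\<lambda>\<tau>. \<forall>y \<in> edge_set n - x ` {..<k}. \<tau> (x (k - 1)) < \<tau> y)"
  proof (intro pred_intros_finite(3))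
    fix y assume y: "y \<in> edge_set n - x ` {..<k}"
    have "Measurable.pred (canon n) (\<lambda>\<tau>. \<tau> a < \<tau> b)" if "a \<in> edge_set n" "b \<in> edge_set n" for a b
      using that by (intro borel_measurable_pred_less measurable_canon_component)
    then show "Measurable.pred (canon n) (\<lambda>\<tau>. \<tau> (x (k - 1)) < \<tau> y)"
      using xE[of "k - 1"] k y by simp
  qed (simp add: finite_edge_set)
  moreover have "Measurable.pred (canon n) (\<lambda>\<tau>. pos_increasing k (\<lambda>i. \<tau> (x i)))"
    using xE by (intro pos_increasing_measurable) auto
  ultimately have "Measurable.pred (canon n) (\<lambda>\<tau>. pos_increasing k (\<lambda>i. \<tau> (x i)) \<and>
     (\<forall>y \<in> edge_set n - x ` {..<k}. \<tau> (x (k - 1)) < \<tau> y))"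
    by (intro pred_intros_logic(3))
  then show ?thesis by (simp add: smallest_def[abs_def])
qed

definition smallest_value ::
  "nat \<Rightarrow> nat \<Rightarrow> ((nat \<Rightarrow> int \<times> int) \<Rightarrow> (nat \<Rightarrow> real) \<Rightarrow> real) \<Rightarrow> (int \<times> int \<Rightarrow> real) \<Rightarrow> real" where
  "smallest_value n k \<Phi> \<tau> =
     (\<Sum>x\<in>tuples n k. if smallest n k x \<tau> then \<Phi> x (\<lambda>i\<in>{..<k}. \<tau> (x i)) else 0)"

lemma smallest_value_eq:
  assumes "\<exists>!x. x \<in> tuples n k \<and> smallest n k x \<tau>" "x0 \<in> tuples n k" "smallest n k x0 \<tau>"
  shows "smallest_value n k \<Phi> \<tau> = \<Phi> x0 (\<lambda>i\<in>{..<k}. \<tau> (x0 i))"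
proof -
  have "smallest_value n k \<Phi> \<tau> = (\<Sum>x\<in>tuples n k. if x = x0 then \<Phi> x (\<lambda>i\<in>{..<k}. \<tau> (x i)) else 0)"
    unfolding smallest_value_def using assms by (intro sum.cong refl if_cong) auto
  then show ?thesis using assms(2) by (simp add: finite_tuples)
qed

lemma smallest_value_measurable:
  assumes k: "0 < k" and meas: "\<And>x. x \<in> tuples n k \<Longrightarrow> \<Phi> x \<in> borel_measurable (PiM {..<k} (\<lambda>_. borel))"
  shows "smallest_value n k \<Phi> \<in> borel_measurable (canon n)"
  unfolding smallest_value_def[abs_def]
proof (intro borel_measurable_sum)
  fix x assume x: "x \<in> tuples n k"
  have [measurable]: "Measurable.pred (canon n) (smallest n k x)" by (rule smallest_measurable[OF x k])
  have [measurable]: "(\<lambda>\<tau>. \<lambda>i\<in>{..<k}. \<tau> (x i)) \<in> measurable (canon n) (PiM {..<k} (\<lambda>_. borel))"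
    using x by (intro measurable_restrict measurable_canon_component) (auto simp: tuples_def)
  show "(\<lambda>\<tau>. if smallest n k x \<tau> then \<Phi> x (\<lambda>i\<in>{..<k}. \<tau> (x i)) else 0) \<in> borel_measurable (canon n)"
    using meas[OF x] by measurable
qed

lemma smallest_value_integrable:
  assumes k: "0 < k" and meas: "\<And>x. x \<in> tuples n k \<Longrightarrow> \<Phi> x \<in> borel_measurable (PiM {..<k} (\<lambda>_. borel))"
    and bound: "\<And>x u. 0 \<le> \<Phi> x u" "\<And>x u. \<Phi> x u \<le> B"
  shows "integrable (canon n) (smallest_value n k \<Phi>)"
proof (rule canon.integrable_const_bound[where B = "\<Sum>x\<in>tuples n k. B"])
  have B: "0 \<le> B" using bound order_trans by blast
  have "norm (smallest_value n k \<Phi> \<tau>) \<le> (\<Sum>x\<in>tuples n k. B)" for \<tau>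
    unfolding smallest_value_def using bound B by (intro order_trans[OF norm_sum] sum_mono) auto
  then show "AE \<tau> in canon n. norm (smallest_value n k \<Phi> \<tau>) \<le> (\<Sum>x\<in>tuples n k. B)" by simp
qed (rule smallest_value_measurable[OF k meas])

lemma nn_integral_smallest:
  assumes x: "x \<in> tuples n k" and k: "0 < k"
    and \<Psi>: "\<Psi> \<in> borel_measurable (PiM {..<k} (\<lambda>_. borel))"
  shows "(\<integral>\<^sup>+\<tau>. (if smallest n k x \<tau> then \<Psi> (\<lambda>i\<in>{..<k}. \<tau> (x i)) else 0) \<partial>canon n) =
    (\<integral>\<^sup>+u. (if pos_increasing k u then
        ennreal (max 0 (min 1 (1 - u (k - 1)))) ^ (card (edge_set n) - k) * \<Psi> u else 0)
      \<partial>PiM {..<k} (\<lambda>_. unif))"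
proof -
  define I where "I = x ` {..<k}"
  define J where "J = edge_set n - I"
  have xE: "x i \<in> edge_set n" "x i \<in> I" if "i < k" for i using x that by (auto simp: tuples_def I_def)
  have inj: "inj_on x {..<k}" using x by (simp add: tuples_def)
  have IJ: "I \<inter> J = {}" "I \<union> J = edge_set n" "finite I" "finite J"
    using xE finite_edge_set by (auto simp: I_def J_def)
  have card_J: "card J = card (edge_set n) - k"
  proof -
    have "card J = card (edge_set n) - card I"
      unfolding J_def using IJ by (intro card_Diff_subset) auto
    then show ?thesis by (simp add: I_def card_image[OF inj])
  qed
  have sets_unif_PiM: "sets (PiM A (\<lambda>_. unif)) = sets (PiM A (\<lambda>_. borel :: real measure))" for A :: "'z set"
    by (rule sets_PiM_cong) auto
  have \<Psi>'[measurable]: "\<Psi> \<in> borel_measurable (PiM {..<k} (\<lambda>_. unif))"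
    using \<Psi> by (simp add: measurable_cong_sets[OF sets_unif_PiM refl])
  define G where "G = (\<lambda>u. if pos_increasing k u then
        ennreal (max 0 (min 1 (1 - u (k - 1)))) ^ (card (edge_set n) - k) * \<Psi> u else 0)"
  have comp: "(\<lambda>u. u i) \<in> borel_measurable (PiM {..<k} (\<lambda>_. unif))" if "i < k" for i
    by (rule measurable_PiM_unif_component) (use that in simp)
  have [measurable]: "(\<lambda>u. u (k - 1)) \<in> borel_measurable (PiM {..<k} (\<lambda>_. unif))"
    using comp[of "k - 1"] k by simp
  have [measurable]: "Measurable.pred (PiM {..<k} (\<lambda>_. unif)) (\<lambda>u. pos_increasing k u)"
    by (intro pos_increasing_measurable comp)
  have G_meas: "G \<in> borel_measurable (PiM {..<k} (\<lambda>_. unif))"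
    unfolding G_def by measurable
  have res_meas: "(\<lambda>\<tau>. \<lambda>i\<in>{..<k}. \<tau> (x i)) \<in> measurable (PiM A (\<lambda>_. unif)) (PiM {..<k} (\<lambda>_. unif))"
    if "I \<subseteq> A" for A
    using that xE by (intro measurable_restrict measurable_component_singleton) auto
  have f_meas: "(\<lambda>\<tau>. if smallest n k x \<tau> then \<Psi> (\<lambda>i\<in>{..<k}. \<tau> (x i)) else 0) \<in> borel_measurable (canon n)"
    using smallest_measurable[OF x k] measurable_compose[OF res_meas \<Psi>', of "edge_set n"] IJ
    unfolding canon_def by (intro measurable_If) auto
  have "(\<integral>\<^sup>+\<tau>. (if smallest n k x \<tau> then \<Psi> (\<lambda>i\<in>{..<k}. \<tau> (x i)) else 0) \<partial>canon n) =
    (\<integral>\<^sup>+a. \<integral>\<^sup>+b. (if smallest n k x (merge I J (a, b)) then \<Psi> (\<lambda>i\<in>{..<k}. merge I J (a, b) (x i)) else 0)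
       \<partial>PiM J (\<lambda>_. unif) \<partial>PiM I (\<lambda>_. unif))"
    using f_meas unfolding canon_def IJ(2)[symmetric]
    by (intro unif_prod.product_nn_integral_fold IJ) simp_all
  also have "\<dots> = (\<integral>\<^sup>+a. G (\<lambda>i\<in>{..<k}. a (x i)) \<partial>PiM I (\<lambda>_. unif))"
  proof (rule nn_integral_cong)
    fix a :: "int \<times> int \<Rightarrow> real"
    define c where "c = a (x (k - 1))"
    define B where "B = {b \<in> space (PiM J (\<lambda>_. unif)). \<forall>y\<in>J. b y \<in> {c<..}}"
    have m1: "merge I J (a, b) (x i) = a (x i)" if "i < k" for i b
      using xE(2)[OF that] by (simp add: merge_def)
    have m2: "merge I J (a, b) y = b y" if "y \<in> J" for y b
      using that by (auto simp: merge_def J_def)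
    have inc: "pos_increasing k (\<lambda>i. merge I J (a, b) (x i)) \<longleftrightarrow> pos_increasing k (\<lambda>i. a (x i))" for b
      by (auto simp: pos_increasing_def m1)
    have inc2: "pos_increasing k (\<lambda>i\<in>{..<k}. a (x i)) \<longleftrightarrow> pos_increasing k (\<lambda>i. a (x i))"
      by (auto simp: pos_increasing_def)
    have res: "(\<lambda>i\<in>{..<k}. merge I J (a, b) (x i)) = (\<lambda>i\<in>{..<k}. a (x i))" for b
      by (auto simp: m1)
    have "(\<integral>\<^sup>+b. (if smallest n k x (merge I J (a, b)) then \<Psi> (\<lambda>i\<in>{..<k}. merge I J (a, b) (x i)) else 0)
       \<partial>PiM J (\<lambda>_. unif)) =
       (\<integral>\<^sup>+b. (if pos_increasing k (\<lambda>i. a (x i)) then \<Psi> (\<lambda>i\<in>{..<k}. a (x i)) else 0) * indicator B b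
       \<partial>PiM J (\<lambda>_. unif))"
    proof (rule nn_integral_cong)
      fix b assume b: "b \<in> space (PiM J (\<lambda>_. unif))"
      have "smallest n k x (merge I J (a, b)) \<longleftrightarrow> pos_increasing k (\<lambda>i. a (x i)) \<and> b \<in> B"
      proof -
        have "(\<forall>y\<in>J. merge I J (a, b) (x (k - 1)) < merge I J (a, b) y) \<longleftrightarrow> (\<forall>y\<in>J. c < b y)"
          using k m1[of "k - 1" b] by (simp add: m2 c_def)
        then show ?thesis using b by (simp add: smallest_def inc B_def flip: I_def J_def)
      qed
      then show "(if smallest n k x (merge I J (a, b)) then \<Psi> (\<lambda>i\<in>{..<k}. merge I J (a, b) (x i)) else 0)
         = (if pos_increasing k (\<lambda>i. a (x i)) then \<Psi> (\<lambda>i\<in>{..<k}. a (x i)) else 0) * indicator B b"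
        by (simp add: res)
    qed
    also have "\<dots> = (if pos_increasing k (\<lambda>i. a (x i)) then \<Psi> (\<lambda>i\<in>{..<k}. a (x i)) else 0) *
        emeasure (PiM J (\<lambda>_. unif)) B"
    proof (rule nn_integral_cmult_indicator)
      have [measurable]: "(\<lambda>b. b y) \<in> borel_measurable (PiM J (\<lambda>_. unif))" if "y \<in> J" for y
        using that by (rule measurable_PiM_unif_component)
      show "B \<in> sets (PiM J (\<lambda>_. unif))" unfolding B_def using IJ by measurable
    qed
    also have "emeasure (PiM J (\<lambda>_. unif)) B = (\<Prod>y\<in>J. emeasure unif {c<..})"
      unfolding B_def using IJ by (intro unif_prod.emeasure_PiM_Collect) auto
    also have "\<dots> = ennreal (max 0 (min 1 (1 - c))) ^ (card (edge_set n) - k)"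
      by (simp add: unif.emeasure_eq_measure measure_unif_greaterThan card_J)
    finally show "(\<integral>\<^sup>+b. (if smallest n k x (merge I J (a, b)) then \<Psi> (\<lambda>i\<in>{..<k}. merge I J (a, b) (x i)) else 0)
       \<partial>PiM J (\<lambda>_. unif)) = G (\<lambda>i\<in>{..<k}. a (x i))"
      using k by (simp add: G_def inc2 c_def mult.commute)
  qed
  also have "\<dots> = (\<integral>\<^sup>+u. G u \<partial>distr (PiM I (\<lambda>_. unif)) (PiM {..<k} (\<lambda>_. unif)) (\<lambda>a. \<lambda>i\<in>{..<k}. a (x i)))"
    using res_meas[of I] G_meas by (subst nn_integral_distr) auto
  also have "distr (PiM I (\<lambda>_. unif)) (PiM {..<k} (\<lambda>_. unif)) (\<lambda>a. \<lambda>i\<in>{..<k}. a (x i)) = PiM {..<k} (\<lambda>_. unif)"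
    using distr_PiM_reindex[of I "\<lambda>_. unif" x "{..<k}"] inj xE(2) unif.prob_space_axioms by auto
  finally show ?thesis unfolding G_def .
qed

section \<open>Comparison with partial sums of exponential variables\<close>

definition expo :: "real measure" where
  "expo = density lborel (exponential_density 1)"

lemma sets_expo [simp, measurable_cong]: "sets expo = sets borel"
  by (simp add: expo_def)

lemma space_expo [simp]: "space expo = UNIV"
  by (simp add: expo_def)

interpretation expo: prob_space expo
  unfolding expo_def by (rule prob_space_exponential_density) simp

interpretation expo_prod: product_prob_space "\<lambda>_. expo" I for I
  by standard

lemma nn_integral_unif_above:
  fixes c S :: real
  assumes [measurable]: "f \<in> borel_measurable borel" and c: "0 < c"
  shows "(\<integral>\<^sup>+y. (if c * S < y then f y else 0) \<partial>unif)
    = (\<integral>\<^sup>+v. ennreal (c * exp v) * (if c * (S + v) \<in> {0..1} then f (c * (S + v)) else 0) \<partial>expo)"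
proof -
  have "(\<integral>\<^sup>+y. (if c * S < y then f y else 0) \<partial>unif)
      = (\<integral>\<^sup>+y. (if c * S < y then f y else 0) * indicator {0..1} y \<partial>lborel)"
    unfolding unif_def by (subst nn_integral_uniform_measure) (auto simp: divide_ennreal_def)
  also have "\<dots> = ennreal c * (\<integral>\<^sup>+v. (if c * S < c * S + c * v then f (c * S + c * v) else 0)
      * indicator {0..1} (c * S + c * v) \<partial>lborel)"
    using c by (subst nn_integral_real_affine[where c = c and t = "c * S"]) auto
  also have "\<dots> = (\<integral>\<^sup>+v. ennreal c * ((if c * S < c * S + c * v then f (c * S + c * v) else 0)
      * indicator {0..1} (c * S + c * v)) \<partial>lborel)"
    by (rule nn_integral_cmult[symmetric]) measurable
  also have "\<dots> = (\<integral>\<^sup>+v. ennreal (exponential_density 1 v) * (ennreal (c * exp v) *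
      (if c * (S + v) \<in> {0..1} then f (c * (S + v)) else 0)) \<partial>lborel)"
  proof (rule nn_integral_cong_AE)
    show "AE v in lborel. ennreal c * ((if c * S < c * S + c * v then f (c * S + c * v) else 0)
        * indicator {0..1} (c * S + c * v)) = ennreal (exponential_density 1 v) * (ennreal (c * exp v) *
      (if c * (S + v) \<in> {0..1} then f (c * (S + v)) else 0))"
      using AE_lborel_singleton[of 0]
    proof eventually_elim
      case (elim v)
      have "ennreal (exp (- v)) * ennreal (c * exp v) = ennreal c"
        using c by (simp add: ennreal_mult[symmetric] exp_minus)
      then have "ennreal (exp (- v)) * (ennreal (c * exp v) * z) = ennreal c * z" for z
        by (simp add: mult.assoc[symmetric])
      then show ?case using elim c
        by (cases "0 < v") (auto simp: exponential_density_def distrib_left indicator_def zero_less_mult_iff)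
    qed
  qed
  also have "\<dots> = (\<integral>\<^sup>+v. ennreal (c * exp v) *
      (if c * (S + v) \<in> {0..1} then f (c * (S + v)) else 0) \<partial>expo)"
    unfolding expo_def by (subst nn_integral_density) auto
  finally show ?thesis .
qed

lemma nn_integral_pos_increasing:
  fixes c :: real
  assumes c: "0 < c" and H: "H \<in> borel_measurable (PiM {..<k} (\<lambda>_. borel))"
  shows "(\<integral>\<^sup>+u. (if pos_increasing k u then H u else 0) \<partial>PiM {..<k} (\<lambda>_. unif)) =
    (\<integral>\<^sup>+w. ennreal (c ^ k * exp (\<Sum>j<k. w j)) * (if \<forall>i<k. c * (\<Sum>j\<le>i. w j) \<in> {0..1}
        then H (\<lambda>i\<in>{..<k}. c * (\<Sum>j\<le>i. w j)) else 0) \<partial>PiM {..<k} (\<lambda>_. expo))"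
  using H
proof (induction k arbitrary: H)
  case 0
  have "pos_increasing 0 u" for u by (simp add: pos_increasing_def)
  then show ?case by (simp add: unif_prod.nn_integral_empty expo_prod.nn_integral_empty restrict_def
        expo_prod.P.emeasure_space_1)
next
  case (Suc k)
  note [measurable] = Suc.prems
  define last where "last = (\<lambda>t :: nat \<Rightarrow> real. if k = 0 then 0 else t (k - 1))"
  define H' where "H' = (\<lambda>t. \<integral>\<^sup>+y. (if last t < y then H (t(k := y)) else 0) \<partial>unif)"
  define R where "R = (\<lambda>w. \<lambda>i\<in>{..<k}. c * (\<Sum>j\<le>i. w j :: real))"
  have last_meas [measurable]: "last \<in> borel_measurable (PiM {..<k} (\<lambda>_. borel))"
    unfolding last_def by (cases "k = 0") auto
  have upd [measurable]: "(\<lambda>(t, y). t(k := y)) \<in> measurable (PiM {..<k} (\<lambda>_. borel) \<Otimes>\<^sub>M borel) (PiM {..<Suc k} (\<lambda>_. borel))"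
    unfolding lessThan_Suc by (rule measurable_add_dim)
  have H'_meas: "H' \<in> borel_measurable (PiM {..<k} (\<lambda>_. borel))"
  proof -
    have "(\<lambda>(t, y). if last t < y then H (t(k := y)) else 0) \<in> borel_measurable (PiM {..<k} (\<lambda>_. borel) \<Otimes>\<^sub>M unif)"
    proof -
      have "(\<lambda>z. H ((\<lambda>(t, y). t(k := y)) z)) \<in> borel_measurable (PiM {..<k} (\<lambda>_. borel) \<Otimes>\<^sub>M borel)"
        by (rule measurable_compose[OF upd Suc.prems])
      then have [measurable]: "(\<lambda>z. H ((fst z)(k := snd z))) \<in> borel_measurable (PiM {..<k} (\<lambda>_. borel) \<Otimes>\<^sub>M borel)"
        by (simp add: split_def)
      have "(\<lambda>z. if last (fst z) < snd z then H ((fst z)(k := snd z)) else 0)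
          \<in> borel_measurable (PiM {..<k} (\<lambda>_. borel) \<Otimes>\<^sub>M borel)"
        by measurable
      then show ?thesis
        by (simp add: split_def cong: measurable_cong_sets sets_pair_measure_cong)
    qed
    then show ?thesis unfolding H'_def by (rule unif.borel_measurable_nn_integral)
  qed
  have comp: "(\<lambda>u. u i) \<in> borel_measurable (PiM {..<Suc k} (\<lambda>_. unif))" if "i < Suc k" for i
    by (rule measurable_PiM_unif_component) (use that in simp)
  have meas1: "(\<lambda>u. if pos_increasing (Suc k) u then H u else 0) \<in> borel_measurable (PiM {..<Suc k} (\<lambda>_. unif))"
  proof -
    have [measurable]: "Measurable.pred (PiM {..<Suc k} (\<lambda>_. unif)) (\<lambda>u. pos_increasing (Suc k) u)"
      by (intro pos_increasing_measurable comp)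
    show ?thesis by measurable
  qed
  have meas2: "(\<lambda>w. ennreal (c ^ Suc k * exp (\<Sum>j<Suc k. w j)) * (if \<forall>i<Suc k. c * (\<Sum>j\<le>i. w j) \<in> {0..1}
        then H (\<lambda>i\<in>{..<Suc k}. c * (\<Sum>j\<le>i. w j)) else 0)) \<in> borel_measurable (PiM {..<Suc k} (\<lambda>_. expo))"
  proof -
    have [measurable]: "(\<lambda>w. w j) \<in> borel_measurable (PiM {..<Suc k} (\<lambda>_. borel))" if "j < Suc k" for j
      using that by (intro measurable_component_singleton) simp
    have ps: "(\<lambda>w. c * (\<Sum>j\<le>i. w j)) \<in> borel_measurable (PiM {..<Suc k} (\<lambda>_. borel))" if "i < Suc k" for i
      using that by (intro borel_measurable_times borel_measurable_const borel_measurable_sum) auto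
    have [measurable]: "(\<lambda>w. \<lambda>i\<in>{..<Suc k}. c * (\<Sum>j\<le>i. w j))
        \<in> measurable (PiM {..<Suc k} (\<lambda>_. borel)) (PiM {..<Suc k} (\<lambda>_. borel))"
      using ps by (intro measurable_restrict) simp
    have "Measurable.pred (PiM {..<Suc k} (\<lambda>_. borel)) (\<lambda>w. c * (\<Sum>j\<le>i. w j) \<in> {0..1})" if "i < Suc k" for i
      by (rule pred_sets2[OF _ ps[OF that]]) simp
    then have "Measurable.pred (PiM {..<Suc k} (\<lambda>_. borel)) (\<lambda>w. \<forall>i\<in>{..<Suc k}. c * (\<Sum>j\<le>i. w j) \<in> {0..1})"
      by (intro pred_intros_finite(3) finite_lessThan) (simp only: lessThan_iff)
    then have [measurable]: "Measurable.pred (PiM {..<Suc k} (\<lambda>_. borel)) (\<lambda>w. \<forall>i<Suc k. c * (\<Sum>j\<le>i. w j) \<in> {0..1})"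
      by (simp only: Ball_def lessThan_iff)
    have [measurable]: "(\<lambda>w. \<Sum>j<Suc k. w j :: real) \<in> borel_measurable (PiM {..<Suc k} (\<lambda>_. borel))"
      by (rule borel_measurable_sum[of "{..<Suc k}" "\<lambda>j w. w j"]) simp
    show ?thesis by measurable
  qed
  have "(\<integral>\<^sup>+u. (if pos_increasing (Suc k) u then H u else 0) \<partial>PiM {..<Suc k} (\<lambda>_. unif)) =
      (\<integral>\<^sup>+t. \<integral>\<^sup>+y. (if pos_increasing (Suc k) (t(k := y)) then H (t(k := y)) else 0) \<partial>unif \<partial>PiM {..<k} (\<lambda>_. unif))"
    using meas1 unfolding lessThan_Suc by (intro unif_prod.product_nn_integral_insert) auto
  also have "\<dots> = (\<integral>\<^sup>+t. (if pos_increasing k t then H' t else 0) \<partial>PiM {..<k} (\<lambda>_. unif))"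
  proof (rule nn_integral_cong)
    fix t :: "nat \<Rightarrow> real"
    have "pos_increasing (Suc k) (t(k := y)) \<longleftrightarrow> pos_increasing k t \<and> last t < y" for y
    proof -
      have "(if i = 0 then 0 else (t(k := y)) (i - 1)) < (t(k := y)) i
          \<longleftrightarrow> (if i = 0 then 0 else t (i - 1)) < t i" if "i < k" for i
      proof -
        have "i \<noteq> k" "i - 1 \<noteq> k" using that by auto
        then show ?thesis by simp
      qed
      then have "pos_increasing k (t(k := y)) \<longleftrightarrow> pos_increasing k t"
        unfolding pos_increasing_def by (simp only: cong: imp_cong)
      moreover have "pos_increasing (Suc k) (t(k := y)) \<longleftrightarrow>
          last t < y \<and> pos_increasing k (t(k := y))"
        unfolding pos_increasing_def All_less_Suc by (cases k) (simp_all add: last_def)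
      ultimately show ?thesis by blast
    qed
    then show "(\<integral>\<^sup>+y. (if pos_increasing (Suc k) (t(k := y)) then H (t(k := y)) else 0) \<partial>unif)
        = (if pos_increasing k t then H' t else 0)"
      by (simp add: H'_def)
  qed
  also have "\<dots> = (\<integral>\<^sup>+w. ennreal (c ^ k * exp (\<Sum>j<k. w j)) * (if \<forall>i<k. c * (\<Sum>j\<le>i. w j) \<in> {0..1}
        then H' (R w) else 0) \<partial>PiM {..<k} (\<lambda>_. expo))"
    unfolding R_def by (rule Suc.IH[OF H'_meas])
  also have "\<dots> = (\<integral>\<^sup>+w. \<integral>\<^sup>+v. ennreal (c ^ Suc k * exp (\<Sum>j<Suc k. (w(k := v)) j)) *
        (if \<forall>i<Suc k. c * (\<Sum>j\<le>i. (w(k := v)) j) \<in> {0..1}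
        then H (\<lambda>i\<in>{..<Suc k}. c * (\<Sum>j\<le>i. (w(k := v)) j)) else 0) \<partial>expo \<partial>PiM {..<k} (\<lambda>_. expo))"
  proof (rule nn_integral_cong)
    fix w :: "nat \<Rightarrow> real"
    define S where "S = (\<Sum>j<k. w j)"
    have last_R: "last (R w) = c * S"
      by (cases k) (auto simp: last_def R_def S_def lessThan_Suc_atMost)
    have H_meas: "(\<lambda>y. H ((R w)(k := y))) \<in> borel_measurable borel"
    proof (rule measurable_compose[of "\<lambda>y. (R w)(k := y)" borel "PiM {..<Suc k} (\<lambda>_. borel)", OF _ Suc.prems])
      show "(\<lambda>y. (R w)(k := y)) \<in> measurable borel (PiM {..<Suc k} (\<lambda>_. borel))"
      proof -
        have "R w \<in> space (PiM {..<k} (\<lambda>_. borel))" by (simp add: R_def space_PiM)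
        moreover have "k \<notin> {..<k}" by simp
        ultimately show ?thesis unfolding lessThan_Suc by (rule measurable_component_update)
      qed
    qed
    have sum_k: "(\<Sum>j<Suc k. (w(k := v)) j) = S + v" for v by (simp add: S_def)
    have sum_le: "(\<Sum>j\<le>i. (w(k := v)) j) = (\<Sum>j\<le>i. w j)" if "i < k" for i v
      using that by (intro sum.cong) auto
    have sum_le_k: "(\<Sum>j\<le>k. (w(k := v)) j) = S + v" for v
      using sum_k[of v] by (simp add: lessThan_Suc_atMost)
    define Q where "Q \<longleftrightarrow> (\<forall>i<k. c * (\<Sum>j\<le>i. w j) \<in> {0..1})"
    have cond: "(\<forall>i<Suc k. c * (\<Sum>j\<le>i. (w(k := v)) j) \<in> {0..1}) \<longleftrightarrow>
        (\<forall>i<k. c * (\<Sum>j\<le>i. w j) \<in> {0..1}) \<and> c * (S + v) \<in> {0..1}" for v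
    proof -
      have "(\<forall>i<k. c * (\<Sum>j\<le>i. (w(k := v)) j) \<in> {0..1}) \<longleftrightarrow> (\<forall>i<k. c * (\<Sum>j\<le>i. w j) \<in> {0..1})"
        by (simp only: sum_le cong: imp_cong)
      then show ?thesis unfolding All_less_Suc sum_le_k by blast
    qed
    have R_upd: "(\<lambda>i\<in>{..<Suc k}. c * (\<Sum>j\<le>i. (w(k := v)) j)) = (R w)(k := c * (S + v))" for v
    proof
      fix i
      consider "i < k" | "i = k" | "k < i" by linarith
      then show "(\<lambda>i\<in>{..<Suc k}. c * (\<Sum>j\<le>i. (w(k := v)) j)) i = ((R w)(k := c * (S + v))) i"
      proof cases
        case 1
        then have "(\<lambda>i\<in>{..<Suc k}. c * (\<Sum>j\<le>i. (w(k := v)) j)) i = c * (\<Sum>j\<le>i. (w(k := v)) j)"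
          by simp
        then show ?thesis using 1 unfolding sum_le[OF 1] by (simp add: R_def)
      next
        case 2
        then have "(\<lambda>i\<in>{..<Suc k}. c * (\<Sum>j\<le>i. (w(k := v)) j)) i = c * (\<Sum>j\<le>k. (w(k := v)) j)"
          by simp
        then show ?thesis unfolding sum_le_k 2 by simp
      qed (simp add: R_def)
    qed
    have "H' (R w) = (\<integral>\<^sup>+v. ennreal (c * exp v) * (if c * (S + v) \<in> {0..1} then H ((R w)(k := c * (S + v))) else 0) \<partial>expo)"
      unfolding H'_def last_R by (rule nn_integral_unif_above[OF H_meas c])
    moreover have prod: "ennreal (c ^ k * exp S) * (ennreal (c * exp v) * z) = ennreal (c ^ Suc k * exp (S + v)) * z" for v z
    proof -
      have "ennreal (c ^ k * exp S) * ennreal (c * exp v) = ennreal ((c ^ k * exp S) * (c * exp v))"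
        using c by (intro ennreal_mult[symmetric]) auto
      also have "(c ^ k * exp S) * (c * exp v) = c ^ Suc k * exp (S + v)" by (simp add: exp_add)
      finally show ?thesis by (simp only: mult.assoc[symmetric])
    qed
    moreover have meas_in: "(\<lambda>v. ennreal (c * exp v) * (if c * (S + v) \<in> {0..1} then H ((R w)(k := c * (S + v))) else 0))
        \<in> borel_measurable expo"
    proof -
      have [measurable]: "(\<lambda>v. H ((R w)(k := c * (S + v)))) \<in> borel_measurable borel"
        by (rule measurable_compose[of "\<lambda>v. c * (S + v)" borel borel, OF _ H_meas]) measurable
      show ?thesis by measurable
    qed
    ultimately have "ennreal (c ^ k * exp S) * H' (R w) = (\<integral>\<^sup>+v. ennreal (c ^ Suc k * exp (S + v)) *
        (if c * (S + v) \<in> {0..1} then H ((R w)(k := c * (S + v))) else 0) \<partial>expo)"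
      by (simp only: nn_integral_cmult[symmetric] prod)
    then show "ennreal (c ^ k * exp (\<Sum>j<k. w j)) * (if \<forall>i<k. c * (\<Sum>j\<le>i. w j) \<in> {0..1} then H' (R w) else 0)
      = (\<integral>\<^sup>+v. ennreal (c ^ Suc k * exp (\<Sum>j<Suc k. (w(k := v)) j)) *
        (if \<forall>i<Suc k. c * (\<Sum>j\<le>i. (w(k := v)) j) \<in> {0..1}
        then H (\<lambda>i\<in>{..<Suc k}. c * (\<Sum>j\<le>i. (w(k := v)) j)) else 0) \<partial>expo)"
      unfolding cond R_upd sum_k S_def[symmetric] Q_def[symmetric]
      by (cases Q) (simp_all del: atLeastAtMost_iff)
  qed
  also have "\<dots> = (\<integral>\<^sup>+w. ennreal (c ^ Suc k * exp (\<Sum>j<Suc k. w j)) * (if \<forall>i<Suc k. c * (\<Sum>j\<le>i. w j) \<in> {0..1}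
        then H (\<lambda>i\<in>{..<Suc k}. c * (\<Sum>j\<le>i. w j)) else 0) \<partial>PiM {..<Suc k} (\<lambda>_. expo))"
    using meas2 unfolding lessThan_Suc
    by (intro expo_prod.product_nn_integral_insert[symmetric]) auto
  finally show ?case .
qed

text \<open>For a fixed tuple of \<open>k\<close> out of \<open>K\<close> edges, the density of the law of their labels, on the event that these are
  the \<open>k\<close> smallest in increasing order, relative to the law of \<open>(w\<^sub>0 + \<dots> + w\<^sub>i) / K\<close> for \<open>i < k\<close>.\<close>

definition label_density :: "nat \<Rightarrow> nat \<Rightarrow> (nat \<Rightarrow> real) \<Rightarrow> real" where
  "label_density n k w = (let K = real (card (edge_set n)) in
     if \<forall>i<k. (\<Sum>j\<le>i. w j) / K \<in> {0..1}
     then (1 / K) ^ k * exp (\<Sum>j<k. w j) * (max 0 (min 1 (1 - (\<Sum>j<k. w j) / K))) ^ (card (edge_set n) - k)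
     else 0)"

definition rescaled_sums :: "nat \<Rightarrow> nat \<Rightarrow> (nat \<Rightarrow> real) \<Rightarrow> nat \<Rightarrow> real" where
  "rescaled_sums n k w = (\<lambda>i\<in>{..<k}. (\<Sum>j\<le>i. w j) / real (card (edge_set n)))"

lemma nn_integral_smallest_expo:
  assumes x: "x \<in> tuples n k" and k: "0 < k" and n: "0 < n"
    and \<Psi>[measurable]: "\<Psi> \<in> borel_measurable (PiM {..<k} (\<lambda>_. borel))"
  shows "(\<integral>\<^sup>+\<tau>. (if smallest n k x \<tau> then \<Psi> (\<lambda>i\<in>{..<k}. \<tau> (x i)) else 0) \<partial>canon n) =
    (\<integral>\<^sup>+w. ennreal (label_density n k w) * \<Psi> (rescaled_sums n k w) \<partial>PiM {..<k} (\<lambda>_. expo))"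
proof -
  define K where "K = real (card (edge_set n))"
  have K: "0 < K" using n by (simp add: K_def real_card_edge_set)
  define H where "H = (\<lambda>u. ennreal (max 0 (min 1 (1 - u (k - 1)))) ^ (card (edge_set n) - k) * \<Psi> u)"
  have [measurable]: "(\<lambda>u. u (k - 1)) \<in> borel_measurable (PiM {..<k} (\<lambda>_. borel))"
    using k by (intro measurable_component_singleton) auto
  have H: "H \<in> borel_measurable (PiM {..<k} (\<lambda>_. borel))"
    unfolding H_def by measurable
  have "(\<integral>\<^sup>+\<tau>. (if smallest n k x \<tau> then \<Psi> (\<lambda>i\<in>{..<k}. \<tau> (x i)) else 0) \<partial>canon n)
      = (\<integral>\<^sup>+u. (if pos_increasing k u then H u else 0) \<partial>PiM {..<k} (\<lambda>_. unif))"
    unfolding H_def by (rule nn_integral_smallest[OF x k \<Psi>])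
  also have "\<dots> = (\<integral>\<^sup>+w. ennreal ((1 / K) ^ k * exp (\<Sum>j<k. w j)) * (if \<forall>i<k. (1 / K) * (\<Sum>j\<le>i. w j) \<in> {0..1}
        then H (\<lambda>i\<in>{..<k}. (1 / K) * (\<Sum>j\<le>i. w j)) else 0) \<partial>PiM {..<k} (\<lambda>_. expo))"
    using K by (intro nn_integral_pos_increasing H) auto
  also have "\<dots> = (\<integral>\<^sup>+w. ennreal (label_density n k w) * \<Psi> (rescaled_sums n k w) \<partial>PiM {..<k} (\<lambda>_. expo))"
  proof (rule nn_integral_cong)
    fix w :: "nat \<Rightarrow> real"
    have lt: "{..k - 1} = {..<k}" using k by auto
    have R: "(\<lambda>i\<in>{..<k}. (1 / K) * (\<Sum>j\<le>i. w j)) = rescaled_sums n k w"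
      by (simp add: rescaled_sums_def K_def)
    have last: "rescaled_sums n k w (k - 1) = (\<Sum>j<k. w j) / K"
      using k by (simp add: rescaled_sums_def K_def flip: lt)
    show "ennreal ((1 / K) ^ k * exp (\<Sum>j<k. w j)) * (if \<forall>i<k. (1 / K) * (\<Sum>j\<le>i. w j) \<in> {0..1}
        then H (\<lambda>i\<in>{..<k}. (1 / K) * (\<Sum>j\<le>i. w j)) else 0)
      = ennreal (label_density n k w) * \<Psi> (rescaled_sums n k w)"
    proof -
      define Q where "Q \<longleftrightarrow> (\<forall>i<k. (\<Sum>j\<le>i. w j) / K \<in> {0..1})"
      have Q: "(\<forall>i<k. (1 / K) * (\<Sum>j\<le>i. w j) \<in> {0..1}) \<longleftrightarrow> Q" by (simp add: Q_def)
      define A where "A = (1 / K) ^ k * exp (\<Sum>j<k. w j)"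
      define m where "m = max 0 (min 1 (1 - (\<Sum>j<k. w j) / K))"
      have "0 \<le> A" "0 \<le> m" using K by (auto simp: A_def m_def)
      then have "ennreal (A * m ^ N) = ennreal A * ennreal m ^ N" for N
        by (simp add: ennreal_mult ennreal_power)
      then show ?thesis
        unfolding Q R H_def last label_density_def Let_def K_def[symmetric] Q_def[symmetric]
          A_def[symmetric] m_def[symmetric]
        by (cases Q) (simp_all add: mult.assoc)
    qed
  qed
  finally show ?thesis .
qed

section \<open>Comparison with the continuous model\<close>

text \<open>The uniform point \<open>(a, b)\<close> of the unit square is sent to the pair of the cells of side \<open>1 / (n + 1)\<close> that contain
  \<open>a\<close> and \<open>b\<close>, so that every edge inside \<open>{0..n}\<close> is hit with probability \<open>2 / (n + 1)\<^sup>2\<close>.\<close>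

definition cell_edge :: "nat \<Rightarrow> real \<Rightarrow> real \<Rightarrow> int \<times> int" where
  "cell_edge n a b = (\<lfloor>(real n + 1) * min a b\<rfloor>, \<lfloor>(real n + 1) * max a b\<rfloor>)"

lemma measure_unif_cell:
  assumes "0 \<le> a" "a \<le> int n"
  shows "measure unif {t. \<lfloor>(real n + 1) * t\<rfloor> = a} = 1 / (real n + 1)"
proof -
  define m where "m = real n + 1"
  have m: "0 < m" by (simp add: m_def)
  have a: "0 \<le> real_of_int a" "real_of_int a + 1 \<le> m"
    using assms by (simp_all add: m_def)
  have "{t. \<lfloor>m * t\<rfloor> = a} = {a / m..<(a + 1) / m}"
    using m by (auto simp: floor_eq_iff field_simps)
  moreover have "{0..1} \<inter> {a / m..<(a + 1) / m} = {a / m..<(a + 1) / m}"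
  proof -
    have "0 \<le> a / m" "(a + 1) / m \<le> 1" using a m by simp_all
    then show ?thesis by auto
  qed
  ultimately show ?thesis
    using m unfolding m_def[symmetric] by (simp add: unif_def measure_uniform_measure field_simps)
qed

lemma cell_edge_eq_iff:
  assumes "i < j"
  shows "cell_edge n a b = (i, j) \<longleftrightarrow>
    (\<lfloor>(real n + 1) * a\<rfloor> = i \<and> \<lfloor>(real n + 1) * b\<rfloor> = j) \<or> (\<lfloor>(real n + 1) * a\<rfloor> = j \<and> \<lfloor>(real n + 1) * b\<rfloor> = i)"
proof (cases "a \<le> b")
  case True
  then have "\<lfloor>(real n + 1) * a\<rfloor> \<le> \<lfloor>(real n + 1) * b\<rfloor>" by (intro floor_mono mult_left_mono) auto
  then show ?thesis using True assms by (auto simp: cell_edge_def min_def max_def)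
next
  case False
  then have "\<lfloor>(real n + 1) * b\<rfloor> \<le> \<lfloor>(real n + 1) * a\<rfloor>" by (intro floor_mono mult_left_mono) auto
  then show ?thesis using False assms by (auto simp: cell_edge_def min_def max_def)
qed

context continuous_model
begin

abbreviation "X \<equiv> case_sum W (case_sum U V)"

lemma X_measurable: "X i \<in> borel_measurable N"
  using indep by (simp add: indep_vars_def)

lemma W_measurable [measurable]: "W i \<in> borel_measurable N"
  and U_measurable [measurable]: "U i \<in> borel_measurable N"
  and V_measurable [measurable]: "V i \<in> borel_measurable N"
  using X_measurable[of "Inl i"] X_measurable[of "Inr (Inl i)"] X_measurable[of "Inr (Inr i)"] by simp_all

lemma distr_W: "distr N borel (W i) = expo"
proof -
  have "distr N borel (W i) = distr N lborel (W i)" by (intro distr_cong) auto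
  then show ?thesis using distributed_distr_eq_density[OF W_distr[of i]] by (simp add: expo_def)
qed

lemma distr_U: "distr N borel (U i) = unif" and distr_V: "distr N borel (V i) = unif"
  using U_distr V_distr by (simp_all add: unif_def)

definition W_vec :: "nat \<Rightarrow> 'b \<Rightarrow> nat \<Rightarrow> real" where
  "W_vec k \<omega> = (\<lambda>i\<in>{..<k}. W i \<omega>)"

definition grid :: "nat \<Rightarrow> nat \<Rightarrow> 'b \<Rightarrow> nat \<Rightarrow> int \<times> int" where
  "grid n k \<omega> = (\<lambda>i\<in>{..<k}. cell_edge n (U i \<omega>) (V i \<omega>))"

lemma W_vec_measurable [measurable]: "W_vec k \<in> measurable N (PiM {..<k} (\<lambda>_. borel))"
  unfolding W_vec_def by measurable

lemma distr_W_vec: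
  assumes "0 < k"
  shows "distr N (PiM {..<k} (\<lambda>_. borel)) (W_vec k) = PiM {..<k} (\<lambda>_. expo)"
proof -
  define J where "J = (Inl ` {..<k} :: (nat + nat + nat) set)"
  have ne: "J \<noteq> {}" using assms by (auto simp: J_def)
  have ind: "indep_vars (\<lambda>_. borel) X J" using indep by (rule indep_vars_subset) simp
  have XJ: "distr N borel (X j) = expo" if "j \<in> J" for j
    using that by (auto simp: J_def distr_W)
  have "distr N (PiM J (\<lambda>_. borel)) (\<lambda>\<omega>. \<lambda>j\<in>J. X j \<omega>) = PiM J (\<lambda>j. distr N borel (X j))"
    using indep_vars_iff_distr_eq_PiM'[OF ne X_measurable] ind by simp
  also have "\<dots> = PiM J (\<lambda>_. expo)" using XJ by (intro PiM_cong) auto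
  finally have law: "distr N (PiM J (\<lambda>_. borel)) (\<lambda>\<omega>. \<lambda>j\<in>J. X j \<omega>) = PiM J (\<lambda>_. expo)" .
  have m1: "(\<lambda>\<omega>. \<lambda>j\<in>J. X j \<omega>) \<in> measurable N (PiM J (\<lambda>_. borel))"
    by (intro measurable_restrict X_measurable)
  have m2: "(\<lambda>r. \<lambda>i\<in>{..<k}. r (Inl i)) \<in> measurable (PiM J (\<lambda>_. borel)) (PiM {..<k} (\<lambda>_. borel :: real measure))"
    by (intro measurable_restrict measurable_component_singleton) (auto simp: J_def)
  have "distr N (PiM {..<k} (\<lambda>_. borel)) (W_vec k)
      = distr N (PiM {..<k} (\<lambda>_. borel)) ((\<lambda>r. \<lambda>i\<in>{..<k}. r (Inl i)) \<circ> (\<lambda>\<omega>. \<lambda>j\<in>J. X j \<omega>))"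
    by (intro arg_cong[where f = "distr N (PiM {..<k} (\<lambda>_. borel))"]) (auto simp: W_vec_def J_def fun_eq_iff)
  also have "\<dots> = distr (PiM J (\<lambda>_. expo)) (PiM {..<k} (\<lambda>_. borel)) (\<lambda>r. \<lambda>i\<in>{..<k}. r (Inl i))"
    using distr_distr[OF m2 m1] by (simp add: law)
  also have "\<dots> = distr (PiM J (\<lambda>_. expo)) (PiM {..<k} (\<lambda>_. expo)) (\<lambda>r. \<lambda>i\<in>{..<k}. r (Inl i))"
    by (intro distr_cong refl sets_PiM_cong) auto
  also have "\<dots> = PiM {..<k} (\<lambda>_. expo)"
    using distr_PiM_reindex[of J "\<lambda>_. expo" Inl "{..<k}"] expo.prob_space_axioms by (auto simp: J_def)
  finally show ?thesis .
qed

lemma prob_cell_edge: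
  assumes "(a, b) \<in> edge_set n"
  shows "prob {\<omega> \<in> space N. cell_edge n (U i \<omega>) (V i \<omega>) = (a, b)} = 2 / (real n + 1)\<^sup>2"
proof -
  have ab: "0 \<le> a" "a < b" "b \<le> int n" using assms by (auto simp: edge_set_def)
  define C where "C = (\<lambda>a. {t. \<lfloor>(real n + 1) * t\<rfloor> = a})"
  have C[measurable]: "C a \<in> sets borel" for a unfolding C_def by measurable
  have C_prob: "prob (X j -` C c \<inter> space N) = 1 / (real n + 1)"
    if "j \<in> {Inr (Inl i), Inr (Inr i)}" "c \<in> {a, b}" for j c
  proof -
    have "prob (X j -` C c \<inter> space N) = measure (distr N borel (X j)) (C c)"
      by (simp add: measure_distr X_measurable)
    also have "distr N borel (X j) = unif" using that by (auto simp: distr_U distr_V)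
    finally show ?thesis using measure_unif_cell[of c n] that ab by (auto simp: C_def)
  qed
  have pair: "prob {\<omega> \<in> space N. U i \<omega> \<in> C c \<and> V i \<omega> \<in> C d} = 1 / (real n + 1)\<^sup>2"
    if cd: "c \<in> {a, b}" "d \<in> {a, b}" for c d
  proof -
    let ?J = "{Inr (Inl i), Inr (Inr i)} :: (nat + nat + nat) set"
    define A where "A = (\<lambda>j :: nat + nat + nat. if j = Inr (Inl i) then C c else C d)"
    have "indep_vars (\<lambda>_. borel) X ?J" using indep by (rule indep_vars_subset) simp
    then have "prob (\<Inter>j\<in>?J. X j -` A j \<inter> space N) = (\<Prod>j\<in>?J. prob (X j -` A j \<inter> space N))"
      by (rule indep_varsD_finite) (auto simp: A_def)
    also have "\<dots> = 1 / (real n + 1)\<^sup>2"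
      using C_prob[of "Inr (Inl i)" c] C_prob[of "Inr (Inr i)" d] cd by (simp add: A_def power2_eq_square)
    also have "(\<Inter>j\<in>?J. X j -` A j \<inter> space N) = {\<omega> \<in> space N. U i \<omega> \<in> C c \<and> V i \<omega> \<in> C d}"
      by (auto simp: A_def)
    finally show ?thesis .
  qed
  have "{\<omega> \<in> space N. cell_edge n (U i \<omega>) (V i \<omega>) = (a, b)} =
      {\<omega> \<in> space N. U i \<omega> \<in> C a \<and> V i \<omega> \<in> C b} \<union> {\<omega> \<in> space N. U i \<omega> \<in> C b \<and> V i \<omega> \<in> C a}"
    unfolding cell_edge_eq_iff[OF ab(2)] C_def by auto
  also have "prob \<dots> = prob {\<omega> \<in> space N. U i \<omega> \<in> C a \<and> V i \<omega> \<in> C b} + prob {\<omega> \<in> space N. U i \<omega> \<in> C b \<and> V i \<omega> \<in> C a}"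
  proof (rule finite_measure_Union)
    show "{\<omega> \<in> space N. U i \<omega> \<in> C a \<and> V i \<omega> \<in> C b} \<in> sets N" by measurable
    show "{\<omega> \<in> space N. U i \<omega> \<in> C b \<and> V i \<omega> \<in> C a} \<in> sets N" by measurable
    have "C a \<inter> C b = {}" using ab by (auto simp: C_def)
    then show "{\<omega> \<in> space N. U i \<omega> \<in> C a \<and> V i \<omega> \<in> C b} \<inter> {\<omega> \<in> space N. U i \<omega> \<in> C b \<and> V i \<omega> \<in> C a} = {}"
      by blast
  qed
  finally show ?thesis by (simp add: pair)
qed

lemma cell_edge_event [measurable]:
  "{\<omega> \<in> space N. cell_edge n (U i \<omega>) (V i \<omega>) = z} \<in> sets N"
  unfolding cell_edge_def prod_eq_iff by measurable

lemma grid_eq_iff: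
  assumes "x \<in> tuples n k"
  shows "grid n k \<omega> = x \<longleftrightarrow> (\<forall>i\<in>{..<k}. cell_edge n (U i \<omega>) (V i \<omega>) = x i)"
  using assms by (auto simp: grid_def tuples_def PiE_def extensional_def fun_eq_iff)

lemma grid_event [measurable]:
  assumes "x \<in> tuples n k"
  shows "{\<omega> \<in> space N. grid n k \<omega> = x} \<in> sets N"
  unfolding grid_eq_iff[OF assms] by measurable

lemma prob_grid:
  assumes x: "x \<in> tuples n k" and k: "0 < k"
  shows "prob {\<omega> \<in> space N. grid n k \<omega> = x} = (2 / (real n + 1)\<^sup>2) ^ k"
proof -
  define K where "K = (\<lambda>i. {Inr (Inl i), Inr (Inr i)} :: (nat + nat + nat) set)"
  define Y where "Y = (\<lambda>i (r :: nat + nat + nat \<Rightarrow> real). cell_edge n (r (Inr (Inl i))) (r (Inr (Inr i))) = x i)"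
  have "disjoint_family_on K {..<k}" by (auto simp: disjoint_family_on_def K_def)
  then have ind: "indep_vars (\<lambda>i. PiM (K i) (\<lambda>_. borel)) (\<lambda>i \<omega>. restrict (\<lambda>j. X j \<omega>) (K i)) {..<k}"
    by (intro indep_vars_restrict[OF indep]) auto
  have Ym: "Y i \<in> measurable (PiM (K i) (\<lambda>_. borel)) (count_space UNIV)" for i
  proof -
    have [measurable]: "(\<lambda>r. r (Inr (Inl i))) \<in> borel_measurable (PiM (K i) (\<lambda>_. borel :: real measure))"
      "(\<lambda>r. r (Inr (Inr i))) \<in> borel_measurable (PiM (K i) (\<lambda>_. borel :: real measure))"
      by (rule measurable_component_singleton, simp add: K_def)+
    show ?thesis unfolding Y_def cell_edge_def prod_eq_iff by measurable
  qed
  have ind2: "indep_vars (\<lambda>_. count_space UNIV) (\<lambda>i \<omega>. Y i (restrict (\<lambda>j. X j \<omega>) (K i))) {..<k}"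
    using indep_vars_compose2[OF ind Ym] .
  have Y_eq: "Y i (restrict (\<lambda>j. X j \<omega>) (K i)) \<longleftrightarrow> cell_edge n (U i \<omega>) (V i \<omega>) = x i" for i \<omega>
    by (simp add: Y_def K_def)
  have ne: "{..<k} \<noteq> {}" using k by auto
  have "{\<omega> \<in> space N. grid n k \<omega> = x}
      = (\<Inter>i\<in>{..<k}. (\<lambda>\<omega>. Y i (restrict (\<lambda>j. X j \<omega>) (K i))) -` {True} \<inter> space N)"
    unfolding grid_eq_iff[OF x] Y_eq using ne by auto
  then have "prob {\<omega> \<in> space N. grid n k \<omega> = x}
      = (\<Prod>i\<in>{..<k}. prob ((\<lambda>\<omega>. Y i (restrict (\<lambda>j. X j \<omega>) (K i))) -` {True} \<inter> space N))"
    using indep_varsD_finite[OF ind2 ne, of "\<lambda>_. {True}"] by simp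
  also have "\<dots> = (\<Prod>i\<in>{..<k}. 2 / (real n + 1)\<^sup>2)"
  proof (rule prod.cong[OF refl])
    fix i assume i: "i \<in> {..<k}"
    have "(\<lambda>\<omega>. Y i (restrict (\<lambda>j. X j \<omega>) (K i))) -` {True} \<inter> space N
        = {\<omega> \<in> space N. cell_edge n (U i \<omega>) (V i \<omega>) = (fst (x i), snd (x i))}"
      unfolding Y_eq by auto
    moreover have "(fst (x i), snd (x i)) \<in> edge_set n" using x i by (auto simp: tuples_def)
    ultimately show "prob ((\<lambda>\<omega>. Y i (restrict (\<lambda>j. X j \<omega>) (K i))) -` {True} \<inter> space N) = 2 / (real n + 1)\<^sup>2"
      using prob_cell_edge[of "fst (x i)" "snd (x i)"] by simp
  qed
  finally show ?thesis by simp
qed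

lemma grid_pred:
  assumes "x \<in> tuples n k"
  shows "Measurable.pred N (\<lambda>\<omega>. grid n k \<omega> = x)"
  using grid_event[OF assms] by (simp add: pred_def)

lemma nn_integral_grid:
  assumes x: "x \<in> tuples n k" and k: "0 < k" and G[measurable]: "G \<in> borel_measurable (PiM {..<k} (\<lambda>_. borel))"
  shows "(\<integral>\<^sup>+\<omega>. (if grid n k \<omega> = x then G (W_vec k \<omega>) else 0) \<partial>N)
      = ennreal ((2 / (real n + 1)\<^sup>2) ^ k) * (\<integral>\<^sup>+w. G w \<partial>PiM {..<k} (\<lambda>_. expo))"
proof -
  define A where "A = (range Inl :: (nat + nat + nat) set)"
  define B where "B = (range Inr :: (nat + nat + nat) set)"
  define E where "E = {\<omega> \<in> space N. grid n k \<omega> = x}"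
  define f where "f = (\<lambda>r :: nat + nat + nat \<Rightarrow> real. \<lambda>i\<in>{..<k}. r (Inl i))"
  define g where "g = (\<lambda>r :: nat + nat + nat \<Rightarrow> real. \<forall>i\<in>{..<k}. cell_edge n (r (Inr (Inl i))) (r (Inr (Inr i))) = x i)"
  let ?PA = "PiM A (\<lambda>_. borel :: real measure)" and ?PB = "PiM B (\<lambda>_. borel :: real measure)"
  define XA where "XA = (\<lambda>\<omega>. restrict (\<lambda>j. X j \<omega>) A)"
  define XB where "XB = (\<lambda>\<omega>. restrict (\<lambda>j. X j \<omega>) B)"
  have ind: "indep_var ?PA XA ?PB XB"
    unfolding XA_def XB_def by (intro indep_var_restrict[OF indep]) (auto simp: A_def B_def)
  have [measurable]: "XA \<in> measurable N ?PA" "XB \<in> measurable N ?PB"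
    using indep_var_rv1[OF ind] indep_var_rv2[OF ind] by auto
  have [measurable]: "f \<in> measurable ?PA (PiM {..<k} (\<lambda>_. borel))"
    unfolding f_def by (intro measurable_restrict measurable_component_singleton) (auto simp: A_def)
  have [measurable]: "Measurable.pred ?PB g"
  proof -
    have [measurable]: "(\<lambda>r. r (Inr j)) \<in> borel_measurable ?PB" for j
      by (rule measurable_component_singleton) (simp add: B_def)
    show ?thesis unfolding g_def cell_edge_def prod_eq_iff by measurable
  qed
  have fX: "f (XA \<omega>) = W_vec k \<omega>" for \<omega>
    by (auto simp: W_vec_def A_def XA_def f_def fun_eq_iff)
  have gX: "g (XB \<omega>) \<longleftrightarrow> grid n k \<omega> = x" for \<omega>
    by (simp add: B_def XB_def g_def grid_eq_iff[OF x])
  let ?D1 = "distr N ?PA XA" and ?D2 = "distr N ?PB XB"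
  interpret D1: prob_space ?D1 by (rule prob_space_distr) measurable
  interpret D2: prob_space ?D2 by (rule prob_space_distr) measurable
  have m: "(\<lambda>z. if g (snd z) then G (f (fst z)) else 0) \<in> borel_measurable (?PA \<Otimes>\<^sub>M ?PB)"
    by measurable
  have "(\<integral>\<^sup>+\<omega>. (if grid n k \<omega> = x then G (W_vec k \<omega>) else 0) \<partial>N)
      = (\<integral>\<^sup>+\<omega>. (if g (snd (XA \<omega>, XB \<omega>)) then G (f (fst (XA \<omega>, XB \<omega>))) else 0) \<partial>N)"
    by (simp add: fX gX cong del: if_weak_cong)
  also have "\<dots> = (\<integral>\<^sup>+z. (if g (snd z) then G (f (fst z)) else 0) \<partial>distr N (?PA \<Otimes>\<^sub>M ?PB) (\<lambda>\<omega>. (XA \<omega>, XB \<omega>)))"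
  proof (rule nn_integral_distr[symmetric])
    show "(\<lambda>z. if g (snd z) then G (f (fst z)) else 0)
        \<in> borel_measurable (distr N (?PA \<Otimes>\<^sub>M ?PB) (\<lambda>\<omega>. (XA \<omega>, XB \<omega>)))"
      using m by simp
  qed measurable
  also have "distr N (?PA \<Otimes>\<^sub>M ?PB) (\<lambda>\<omega>. (XA \<omega>, XB \<omega>)) = ?D1 \<Otimes>\<^sub>M ?D2"
    using ind by (simp add: indep_var_distribution_eq)
  also have "(\<integral>\<^sup>+z. (if g (snd z) then G (f (fst z)) else 0) \<partial>(?D1 \<Otimes>\<^sub>M ?D2))
      = (\<integral>\<^sup>+a. \<integral>\<^sup>+b. (if g (snd (a, b)) then G (f (fst (a, b))) else 0) \<partial>?D2 \<partial>?D1)"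
    by (rule D2.nn_integral_fst[symmetric]) (use m in \<open>simp cong: measurable_cong_sets sets_pair_measure_cong\<close>)
  also have "\<dots> = (\<integral>\<^sup>+a. ennreal ((2 / (real n + 1)\<^sup>2) ^ k) * G (f a) \<partial>?D1)"
  proof (rule nn_integral_cong)
    fix a
    have "(\<integral>\<^sup>+b. (if g (snd (a, b)) then G (f (fst (a, b))) else 0) \<partial>?D2)
        = (\<integral>\<^sup>+b. (if g b then G (f a) else 0) \<partial>?D2)"
      by (simp cong del: if_weak_cong)
    also have "\<dots> = (\<integral>\<^sup>+\<omega>. (if g (XB \<omega>) then G (f a) else 0) \<partial>N)"
      by (rule nn_integral_distr) measurable
    also have "\<dots> = (\<integral>\<^sup>+\<omega>. G (f a) * indicator E \<omega> \<partial>N)"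
      by (rule nn_integral_cong) (simp add: gX E_def)
    also have "\<dots> = G (f a) * emeasure N E"
      by (rule nn_integral_cmult_indicator) (simp add: E_def grid_event[OF x])
    also have "emeasure N E = ennreal ((2 / (real n + 1)\<^sup>2) ^ k)"
      using prob_grid[OF x k] by (simp add: E_def emeasure_eq_measure)
    finally show "(\<integral>\<^sup>+b. (if g (snd (a, b)) then G (f (fst (a, b))) else 0) \<partial>?D2)
        = ennreal ((2 / (real n + 1)\<^sup>2) ^ k) * G (f a)"
      by (simp add: mult.commute)
  qed
  also have "\<dots> = ennreal ((2 / (real n + 1)\<^sup>2) ^ k) * (\<integral>\<^sup>+a. G (f a) \<partial>?D1)"
    by (rule nn_integral_cmult) measurable
  also have "(\<integral>\<^sup>+a. G (f a) \<partial>?D1) = (\<integral>\<^sup>+\<omega>. G (W_vec k \<omega>) \<partial>N)"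
    by (subst nn_integral_distr) (simp_all add: fX)
  also have "\<dots> = (\<integral>\<^sup>+w. G w \<partial>distr N (PiM {..<k} (\<lambda>_. borel)) (W_vec k))"
    by (rule nn_integral_distr[symmetric]) measurable
  finally show ?thesis by (simp add: distr_W_vec[OF k])
qed

lemma label_density_measurable [measurable]:
  "label_density n k \<in> borel_measurable (PiM {..<k} (\<lambda>_. borel))"
proof -
  have sum: "(\<lambda>w. (\<Sum>j\<in>J. w j :: real)) \<in> borel_measurable (PiM {..<k} (\<lambda>_. borel))" if "J \<subseteq> {..<k}" for J
    using that by (intro borel_measurable_sum measurable_component_singleton) auto
  have "Measurable.pred (PiM {..<k} (\<lambda>_. borel)) (\<lambda>w. (\<Sum>j\<le>i. w j) / K \<in> {0..1})" if "i < k" for i and K :: real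
  proof -
    have [measurable]: "(\<lambda>w. (\<Sum>j\<le>i. w j :: real)) \<in> borel_measurable (PiM {..<k} (\<lambda>_. borel))"
      using that by (intro sum) auto
    show ?thesis by measurable
  qed
  then have "Measurable.pred (PiM {..<k} (\<lambda>_. borel)) (\<lambda>w. \<forall>i\<in>{..<k}. (\<Sum>j\<le>i. w j) / K \<in> {0..1})" for K :: real
    by (intro pred_intros_finite(3) finite_lessThan) (simp only: lessThan_iff)
  then have [measurable]: "Measurable.pred (PiM {..<k} (\<lambda>_. borel)) (\<lambda>w. \<forall>i<k. (\<Sum>j\<le>i. w j) / K \<in> {0..1})" for K :: real
    by (simp only: Ball_def lessThan_iff)
  have [measurable]: "(\<lambda>w. (\<Sum>j<k. w j :: real)) \<in> borel_measurable (PiM {..<k} (\<lambda>_. borel))"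
    by (rule sum) simp
  show ?thesis unfolding label_density_def[abs_def] Let_def by measurable
qed

lemma rescaled_sums_measurable [measurable]:
  "rescaled_sums n k \<in> measurable (PiM {..<k} (\<lambda>_. borel)) (PiM {..<k} (\<lambda>_. borel))"
  unfolding rescaled_sums_def[abs_def]
  by (intro measurable_restrict borel_measurable_divide borel_measurable_sum measurable_component_singleton) auto

lemma label_density_nonneg: "0 \<le> label_density n k w"
  by (simp add: label_density_def Let_def)

lemma nn_integral_smallest_grid:
  assumes k: "0 < k" and n: "0 < n"
    and \<Phi>: "\<And>x. x \<in> tuples n k \<Longrightarrow> \<Phi> x \<in> borel_measurable (PiM {..<k} (\<lambda>_. borel))"
  shows "(\<integral>\<^sup>+\<tau>. (\<Sum>x\<in>tuples n k. if smallest n k x \<tau> then \<Phi> x (\<lambda>i\<in>{..<k}. \<tau> (x i)) else 0) \<partial>canon n) =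
    (\<integral>\<^sup>+\<omega>. (\<Sum>x\<in>tuples n k. if grid n k \<omega> = x then
      ennreal (((real n + 1)\<^sup>2 / 2) ^ k * label_density n k (W_vec k \<omega>)) * \<Phi> x (rescaled_sums n k (W_vec k \<omega>)) else 0) \<partial>N)"
proof -
  define c where "c = ((real n + 1)\<^sup>2 / 2) ^ k"
  have c: "0 \<le> c" "c * (2 / (real n + 1)\<^sup>2) ^ k = 1"
    by (simp_all add: c_def power_divide)
  note [measurable] = \<Phi>
  have m1: "(\<lambda>\<tau>. if smallest n k x \<tau> then \<Phi> x (\<lambda>i\<in>{..<k}. \<tau> (x i)) else 0) \<in> borel_measurable (canon n)"
    if x: "x \<in> tuples n k" for x
  proof -
    have [measurable]: "Measurable.pred (canon n) (smallest n k x)" by (rule smallest_measurable[OF x k])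
    have [measurable]: "(\<lambda>\<tau>. \<lambda>i\<in>{..<k}. \<tau> (x i)) \<in> measurable (canon n) (PiM {..<k} (\<lambda>_. borel))"
      using x by (intro measurable_restrict measurable_canon_component) (auto simp: tuples_def)
    show ?thesis using \<Phi>[OF x] by measurable
  qed
  have m2: "(\<lambda>w. ennreal (c * label_density n k w) * \<Phi> x (rescaled_sums n k w)) \<in> borel_measurable (PiM {..<k} (\<lambda>_. borel))"
    if x: "x \<in> tuples n k" for x
    using \<Phi>[OF x] by measurable
  have m3: "(\<lambda>\<omega>. if grid n k \<omega> = x then ennreal (c * label_density n k (W_vec k \<omega>)) * \<Phi> x (rescaled_sums n k (W_vec k \<omega>)) else 0)
      \<in> borel_measurable N" if x: "x \<in> tuples n k" for x
  proof -
    note [measurable] = grid_pred[OF x]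
    have [measurable]: "(\<lambda>\<omega>. ennreal (c * label_density n k (W_vec k \<omega>)) * \<Phi> x (rescaled_sums n k (W_vec k \<omega>))) \<in> borel_measurable N"
      by (rule measurable_compose[OF W_vec_measurable m2[OF x]])
    show ?thesis by measurable
  qed
  have eq: "(\<integral>\<^sup>+\<tau>. (if smallest n k x \<tau> then \<Phi> x (\<lambda>i\<in>{..<k}. \<tau> (x i)) else 0) \<partial>canon n) =
      (\<integral>\<^sup>+\<omega>. (if grid n k \<omega> = x then ennreal (c * label_density n k (W_vec k \<omega>)) * \<Phi> x (rescaled_sums n k (W_vec k \<omega>)) else 0) \<partial>N)"
    if x: "x \<in> tuples n k" for x
  proof -
    have m4: "(\<lambda>w. ennreal (label_density n k w) * \<Phi> x (rescaled_sums n k w)) \<in> borel_measurable (PiM {..<k} (\<lambda>_. expo))"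
      using \<Phi>[OF x] by measurable
    have "(\<integral>\<^sup>+\<omega>. (if grid n k \<omega> = x then ennreal (c * label_density n k (W_vec k \<omega>)) * \<Phi> x (rescaled_sums n k (W_vec k \<omega>)) else 0) \<partial>N)
        = ennreal ((2 / (real n + 1)\<^sup>2) ^ k) *
          (\<integral>\<^sup>+w. ennreal (c * label_density n k w) * \<Phi> x (rescaled_sums n k w) \<partial>PiM {..<k} (\<lambda>_. expo))"
      by (rule nn_integral_grid[OF x k m2[OF x]])
    also have "(\<integral>\<^sup>+w. ennreal (c * label_density n k w) * \<Phi> x (rescaled_sums n k w) \<partial>PiM {..<k} (\<lambda>_. expo))
        = (\<integral>\<^sup>+w. ennreal c * (ennreal (label_density n k w) * \<Phi> x (rescaled_sums n k w)) \<partial>PiM {..<k} (\<lambda>_. expo))"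
      using c(1) label_density_nonneg by (simp add: ennreal_mult mult.assoc)
    also have "\<dots> = ennreal c * (\<integral>\<^sup>+w. ennreal (label_density n k w) * \<Phi> x (rescaled_sums n k w) \<partial>PiM {..<k} (\<lambda>_. expo))"
      by (rule nn_integral_cmult[OF m4])
    also have "ennreal ((2 / (real n + 1)\<^sup>2) ^ k) * (ennreal c * z) = z" for z
    proof -
      have "ennreal ((2 / (real n + 1)\<^sup>2) ^ k) * ennreal c = ennreal ((2 / (real n + 1)\<^sup>2) ^ k * c)"
        using c(1) by (intro ennreal_mult[symmetric]) auto
      also have "(2 / (real n + 1)\<^sup>2) ^ k * c = 1" using c(2) by (simp only: mult.commute)
      finally show ?thesis by (simp add: mult.assoc[symmetric])
    qed
    finally show ?thesis by (simp add: nn_integral_smallest_expo[OF x k n \<Phi>[OF x]])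
  qed
  show ?thesis
    unfolding c_def[symmetric] using m1 m3 eq by (simp add: nn_integral_sum)
qed

end

section \<open>Convergence of the heaviest edges\<close>

lemma max_weight_tendsto:
  assumes I: "finite I" and c: "\<And>i. i \<in> I \<Longrightarrow> ((\<lambda>n. c n i) \<longlongrightarrow> c' i) F"
  shows "((\<lambda>n. max_weight pos (c n) I) \<longlongrightarrow> max_weight pos c' I) F"
proof (rule LIM_zero_cancel, rule tendsto_rabs_zero_cancel, rule tendsto_sandwich[OF _ _ tendsto_const])
  have le: "max_weight pos a I \<le> max_weight pos b I + (\<Sum>i\<in>I. \<bar>a i - b i\<bar>)" for a b
  proof (rule max_weight_le[OF I])
    fix A assume A: "A \<in> edge_chains pos I"
    then have "A \<subseteq> I" by (simp add: edge_chains_def)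
    have "sum a A \<le> sum b A + (\<Sum>i\<in>A. \<bar>a i - b i\<bar>)"
      by (simp add: sum.distrib[symmetric] sum_mono)
    also have "(\<Sum>i\<in>A. \<bar>a i - b i\<bar>) \<le> (\<Sum>i\<in>I. \<bar>a i - b i\<bar>)"
      using \<open>A \<subseteq> I\<close> I by (intro sum_mono2) auto
    also have "sum b A \<le> max_weight pos b I" by (rule max_weight_ge[OF I A])
    finally show "sum a A \<le> max_weight pos b I + (\<Sum>i\<in>I. \<bar>a i - b i\<bar>)" by simp
  qed
  have "\<bar>max_weight pos (c n) I - max_weight pos c' I\<bar> \<le> (\<Sum>i\<in>I. \<bar>c n i - c' i\<bar>)" for n
    using le[of "c n" c'] le[of c' "c n"] by (simp add: abs_minus_commute abs_le_iff)
  then show "\<forall>\<^sub>F n in F. \<bar>max_weight pos (c n) I - max_weight pos c' I\<bar> \<le> (\<Sum>i\<in>I. \<bar>c n i - c' i\<bar>)"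
    by simp
  have "((\<lambda>n. \<Sum>i\<in>I. \<bar>c n i - c' i\<bar>) \<longlongrightarrow> (\<Sum>i\<in>I. 0)) F"
    using c by (intro tendsto_sum tendsto_rabs_zero LIM_zero) auto
  then show "((\<lambda>n. \<Sum>i\<in>I. \<bar>c n i - c' i\<bar>) \<longlongrightarrow> 0) F" by simp
qed simp

lemma max_weight_cong:
  "(\<And>i. i \<in> I \<Longrightarrow> c i = c' i) \<Longrightarrow> max_weight pos c I = max_weight pos c' I"
  unfolding max_weight_def by (intro arg_cong[where f = Max] image_cong refl sum.cong) (auto simp: edge_chains_def)

lemma floor_gap:
  assumes "a < b"
  shows "eventually (\<lambda>n. of_int \<lfloor>(real n + 1) * a\<rfloor> + sqrt n \<le> of_int \<lfloor>(real n + 1) * b\<rfloor>) sequentially"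
proof -
  define c where "c = b - a"
  have "0 < c" using assms by (simp add: c_def)
  then have "eventually (\<lambda>n. sqrt (real n) + 1 \<le> (real n + 1) * c) sequentially" by real_asymp
  then show ?thesis
  proof eventually_elim
    case (elim n)
    have "(real n + 1) * c = (real n + 1) * b - (real n + 1) * a" by (simp add: c_def algebra_simps)
    then show ?case using elim by linarith
  qed
qed

lemma label_density_tendsto:
  assumes w: "\<And>i. 0 < w i" and k: "0 < k"
  shows "(\<lambda>n. ((real n + 1)\<^sup>2 / 2) ^ k * label_density n k w) \<longlonglongrightarrow> 1"
proof -
  define K where "K = (\<lambda>n. card (edge_set n))"
  define G where "G = (\<Sum>j<k. w j)"
  have G: "0 < G" unfolding G_def using w k by (intro sum_pos) auto
  have K_lim: "filterlim (\<lambda>n. real (K n)) at_top sequentially"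
    unfolding K_def real_card_edge_set by real_asymp
  then have K_nat: "filterlim K at_top sequentially"
    by (simp add: filterlim_sequentially_iff_filterlim_real)
  have "(\<lambda>n. (1 + (- G) / real (K n)) ^ K n) \<longlonglongrightarrow> exp (- G)"
    by (rule filterlim_compose[OF tendsto_exp_limit_sequentially K_nat])
  moreover have "(\<lambda>n. (1 - G / real (K n)) ^ k) \<longlonglongrightarrow> (1 - 0) ^ k"
    by (intro tendsto_intros real_tendsto_divide_at_top[OF tendsto_const K_lim])
  moreover have "(\<lambda>n. ((real n + 1)\<^sup>2 / 2 / (real n * (real n + 1) / 2)) ^ k) \<longlonglongrightarrow> 1 ^ k"
  proof (intro tendsto_power)
    show "(\<lambda>n. (real n + 1)\<^sup>2 / 2 / (real n * (real n + 1) / 2)) \<longlonglongrightarrow> 1" by real_asymp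
  qed
  ultimately have "(\<lambda>n. ((real n + 1)\<^sup>2 / 2 / (real n * (real n + 1) / 2)) ^ k * exp G *
      ((1 + (- G) / real (K n)) ^ K n / (1 - G / real (K n)) ^ k)) \<longlonglongrightarrow> 1 ^ k * exp G * (exp (- G) / (1 - 0) ^ k)"
    by (intro tendsto_mult tendsto_divide tendsto_const) simp_all
  moreover have "1 ^ k * exp G * (exp (- G) / (1 - 0) ^ k) = 1" by (simp add: exp_minus)
  moreover have "eventually (\<lambda>n. ((real n + 1)\<^sup>2 / 2 / (real n * (real n + 1) / 2)) ^ k * exp G *
      ((1 + (- G) / real (K n)) ^ K n / (1 - G / real (K n)) ^ k) = ((real n + 1)\<^sup>2 / 2) ^ k * label_density n k w) sequentially"
    using filterlim_at_top_dense[THEN iffD1, OF K_lim, rule_format, of "max G (real k)"]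
  proof eventually_elim
    case (elim n)
    then have Kn: "G < real (K n)" "k \<le> K n" "0 < real (K n)" using G by auto
    have part: "(\<Sum>j\<le>i. w j) / real (K n) \<in> {0..1}" if "i < k" for i
    proof -
      have "0 \<le> (\<Sum>j\<le>i. w j)" using w by (intro sum_nonneg) (simp add: less_imp_le)
      moreover have "(\<Sum>j\<le>i. w j) \<le> G"
        unfolding G_def using that w by (intro sum_mono2) (auto simp: less_imp_le)
      ultimately show ?thesis using Kn by simp
    qed
    have y: "0 < G / real (K n)" "G / real (K n) < 1" using Kn G by auto
    have Kn_eq: "card (edge_set n) = K n" by (simp add: K_def)
    have "max 0 (min 1 (1 - G / real (K n))) = 1 - G / real (K n)" using y by simp
    then have "label_density n k w = (1 / real (K n)) ^ k * exp G * (1 - G / real (K n)) ^ (K n - k)"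
      unfolding label_density_def Let_def Kn_eq G_def[symmetric] using part by (simp del: atLeastAtMost_iff)
    also have "(1 - G / real (K n)) ^ (K n - k) = (1 - G / real (K n)) ^ K n / (1 - G / real (K n)) ^ k"
      using y Kn by (intro power_diff) auto
    finally have "label_density n k w = (1 / real (K n)) ^ k * exp G *
        ((1 + (- G) / real (K n)) ^ K n / (1 - G / real (K n)) ^ k)" by simp
    moreover have "((real n + 1)\<^sup>2 / 2) ^ k * (1 / real (K n)) ^ k = ((real n + 1)\<^sup>2 / 2 / (real n * (real n + 1) / 2)) ^ k"
      by (simp add: power_mult_distrib[symmetric] K_def real_card_edge_set)
    ultimately show ?case by (simp only: mult.assoc[symmetric])
  qed
  ultimately show ?thesis by (simp add: tendsto_cong)
qed

lemma label_density_le: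
  assumes k: "0 < k" and n: "0 < n" "2 * k \<le> card (edge_set n)"
  shows "((real n + 1)\<^sup>2 / 2) ^ k * label_density n k w \<le> 2 ^ k * exp ((\<Sum>j<k. w j) / 2)"
proof (cases "\<forall>i<k. (\<Sum>j\<le>i. w j) / real (card (edge_set n)) \<in> {0..1}")
  case False
  then have "label_density n k w = 0" by (simp only: label_density_def Let_def if_False)
  then show ?thesis by simp
next
  case True
  define K where "K = card (edge_set n)"
  define G where "G = (\<Sum>j<k. w j)"
  have "{..k - 1} = {..<k}" using k by auto
  then have "G / real K \<in> {0..1}"
    using True[rule_format, of "k - 1"] k by (simp add: G_def K_def)
  then have y: "0 \<le> G / real K" "G / real K \<le> 1" by auto
  have K: "0 < real K" using n(1) by (simp add: K_def real_card_edge_set)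
  have Kk: "2 * real k \<le> real K" using of_nat_mono[OF n(2), where 'a = real] by (simp add: K_def)
  have G: "0 \<le> G" using y(1) K by (simp add: zero_le_divide_iff)
  have "(1 - G / real K) ^ (K - k) \<le> exp (- (G / real K)) ^ (K - k)"
    using y exp_ge_add_one_self[of "- (G / real K)"] by (intro power_mono) auto
  also have "\<dots> = exp (- (G / real K) * (real K - real k))"
    using Kk by (simp add: exp_of_nat_mult[symmetric] of_nat_diff mult.commute)
  also have "- (G / real K) * (real K - real k) = G * real k / real K - G"
    using K by (simp add: field_simps)
  also have "\<dots> \<le> G / 2 - G"
  proof -
    have "G * (2 * real k) \<le> G * real K" using Kk G by (intro mult_left_mono) auto
    then show ?thesis using K by (simp add: field_simps)
  qed
  finally have pow: "(1 - G / real K) ^ (K - k) \<le> exp (G / 2 - G)" by simp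
  have "max 0 (min 1 (1 - G / real K)) = 1 - G / real K" using y by simp
  then have "label_density n k w = (1 / real K) ^ k * exp G * (1 - G / real K) ^ (K - k)"
    using True by (simp add: label_density_def Let_def flip: K_def G_def)
  also have "\<dots> \<le> (1 / real K) ^ k * exp G * exp (G / 2 - G)"
    using pow K by (intro mult_left_mono) auto
  also have "\<dots> = (1 / real K) ^ k * exp (G / 2)" by (simp add: mult.assoc flip: exp_add)
  finally have "((real n + 1)\<^sup>2 / 2) ^ k * label_density n k w
      \<le> ((real n + 1)\<^sup>2 / 2) ^ k * ((1 / real K) ^ k * exp (G / 2))"
    by (intro mult_left_mono) auto
  also have "\<dots> = ((real n + 1) / real n) ^ k * exp (G / 2)"
    using n by (simp add: K_def real_card_edge_set power2_eq_square flip: mult.assoc power_mult_distrib)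
  also have "\<dots> \<le> 2 ^ k * exp (G / 2)"
    using n by (intro mult_right_mono power_mono) (auto simp: field_simps)
  finally show ?thesis by (simp add: G_def)
qed

lemma nn_integral_expo_half: "(\<integral>\<^sup>+w. ennreal (exp (w / 2)) \<partial>expo) = 2"
proof -
  have "(\<integral>\<^sup>+w. ennreal (exp (w / 2)) \<partial>expo) = (\<integral>\<^sup>+w. ennreal (exponential_density 1 w) * ennreal (exp (w / 2)) \<partial>lborel)"
    unfolding expo_def by (subst nn_integral_density) auto
  also have "\<dots> = (\<integral>\<^sup>+w. 2 * ennreal (exponential_density (1 / 2) w) \<partial>lborel)"
  proof (rule nn_integral_cong)
    fix w :: real
    have "exponential_density 1 w * exp (w / 2) = 2 * exponential_density (1 / 2) w"
      by (simp add: exponential_density_def flip: exp_add)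
    then have "ennreal (exponential_density 1 w * exp (w / 2)) = ennreal (2 * exponential_density (1 / 2) w)" by simp
    then show "ennreal (exponential_density 1 w) * ennreal (exp (w / 2)) = 2 * ennreal (exponential_density (1 / 2) w)"
      by (simp add: ennreal_mult' ennreal_mult'')
  qed
  also have "\<dots> = 2 * (\<integral>\<^sup>+w. ennreal (exponential_density (1 / 2) w) \<partial>lborel)"
    by (rule nn_integral_cmult) measurable
  also have "(\<integral>\<^sup>+w. ennreal (exponential_density (1 / 2) w) \<partial>lborel) = 1"
  proof -
    interpret P: prob_space "density lborel (exponential_density (1 / 2))"
      by (rule prob_space_exponential_density) simp
    show ?thesis using P.emeasure_space_1 by (simp add: emeasure_density)
  qed
  finally show ?thesis by simp
qed

context continuous_model
begin

definition good :: "'b \<Rightarrow> bool" where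
  "good \<omega> \<longleftrightarrow> (\<forall>i. 0 < W i \<omega>) \<and> (\<forall>j. 0 < X (Inr j) \<omega> \<and> X (Inr j) \<omega> < 1) \<and>
     (\<forall>j j'. j \<noteq> j' \<longrightarrow> X (Inr j) \<omega> \<noteq> X (Inr j') \<omega>)"

lemma AE_good: "AE \<omega> in N. good \<omega>"
proof -
  have "AE x::real in lborel. 0 < ennreal (exponential_density 1 x) \<longrightarrow> 0 < x"
    using AE_lborel_singleton[of 0] by eventually_elim (auto simp: exponential_density_def)
  then have "AE x in expo. 0 < x" unfolding expo_def by (subst AE_density) auto
  then have "AE x in distr N borel (W i). 0 < x" for i by (simp only: distr_W)
  then have "AE \<omega> in N. 0 < W i \<omega>" for i by (rule AE_distrD[OF W_measurable])
  moreover have X_distr: "distr N borel (X (Inr j)) = unif" for j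
    by (cases j) (auto simp: distr_U distr_V)
  moreover have "AE \<omega> in N. 0 < X (Inr j) \<omega> \<and> X (Inr j) \<omega> < 1" for j
  proof (rule AE_distrD[OF X_measurable])
    show "AE x in distr N borel (X (Inr j)). 0 < x \<and> x < 1" unfolding X_distr by (rule AE_unif)
  qed
  moreover have "AE \<omega> in N. j \<noteq> j' \<longrightarrow> X (Inr j) \<omega> \<noteq> X (Inr j') \<omega>" for j j'
    using AE_indep_vars_neq[OF indep, of "Inr j" "Inr j'"] X_distr emeasure_unif_singleton by (cases "j = j'") auto
  ultimately show ?thesis
    unfolding good_def by (simp add: AE_all_countable)
qed

lemma integrable_exp_half:
  assumes "0 < k"
  shows "integrable N (\<lambda>\<omega>. exp ((\<Sum>j<k. W_vec k \<omega> j) / 2))"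
proof (rule integrableI_nonneg)
  have "(\<integral>\<^sup>+\<omega>. ennreal (exp ((\<Sum>j<k. W_vec k \<omega> j) / 2)) \<partial>N)
      = (\<integral>\<^sup>+\<omega>. (\<Prod>j<k. ennreal (exp (W_vec k \<omega> j / 2))) \<partial>N)"
    by (simp add: prod_ennreal exp_sum sum_divide_distrib)
  also have "\<dots> = (\<integral>\<^sup>+w. (\<Prod>j<k. ennreal (exp (w j / 2))) \<partial>distr N (PiM {..<k} (\<lambda>_. borel)) (W_vec k))"
    by (rule nn_integral_distr[symmetric]) measurable
  also have "\<dots> = (\<integral>\<^sup>+w. (\<Prod>j<k. ennreal (exp (w j / 2))) \<partial>PiM {..<k} (\<lambda>_. expo))"
    by (simp add: distr_W_vec[OF assms])
  also have "\<dots> = (\<Prod>j<k. \<integral>\<^sup>+w. ennreal (exp (w / 2)) \<partial>expo)"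
    by (rule expo_prod.product_nn_integral_prod) auto
  also have "\<dots> < \<infinity>"
    by (simp add: nn_integral_expo_half power_less_top_ennreal)
  finally show "(\<integral>\<^sup>+\<omega>. ennreal (exp ((\<Sum>j<k. W_vec k \<omega> j) / 2)) \<partial>N) < \<infinity>" .
  have [measurable]: "(\<lambda>\<omega>. W_vec k \<omega> j) \<in> borel_measurable N" if "j < k" for j
    using that by (simp add: W_vec_def)
  show "(\<lambda>\<omega>. exp ((\<Sum>j<k. W_vec k \<omega> j) / 2)) \<in> borel_measurable N"
    by measurable
qed simp

lemma smallest_limit:
  fixes \<Phi> :: "nat \<Rightarrow> (nat \<Rightarrow> int \<times> int) \<Rightarrow> (nat \<Rightarrow> real) \<Rightarrow> real"
  assumes k: "0 < k"
    and meas: "\<And>n x. x \<in> tuples n k \<Longrightarrow> \<Phi> n x \<in> borel_measurable (PiM {..<k} (\<lambda>_. borel))"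
    and bound: "\<And>n x u. 0 \<le> \<Phi> n x u" "\<And>n x u. \<Phi> n x u \<le> B"
    and tuples: "AE \<omega> in N. eventually (\<lambda>n. grid n k \<omega> \<in> tuples n k) sequentially"
    and Z: "Z \<in> borel_measurable N"
    and lim: "AE \<omega> in N. (\<lambda>n. \<Phi> n (grid n k \<omega>) (rescaled_sums n k (W_vec k \<omega>))) \<longlonglongrightarrow> Z \<omega>"
  shows "(\<lambda>n. \<integral>\<tau>. smallest_value n k (\<Phi> n) \<tau> \<partial>canon n) \<longlonglongrightarrow> (\<integral>\<omega>. Z \<omega> \<partial>N)"
proof -
  define c where "c = (\<lambda>n \<omega>. ((real n + 1)\<^sup>2 / 2) ^ k * label_density n k (W_vec k \<omega>))"
  define Y where "Y = (\<lambda>n \<omega>. \<Sum>x\<in>tuples n k. if grid n k \<omega> = x then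
      c n \<omega> * \<Phi> n x (rescaled_sums n k (W_vec k \<omega>)) else 0)"
  have c0: "0 \<le> c n \<omega>" for n \<omega> unfolding c_def using label_density_nonneg by simp
  have Y_eq: "Y n \<omega> = (if grid n k \<omega> \<in> tuples n k then
      c n \<omega> * \<Phi> n (grid n k \<omega>) (rescaled_sums n k (W_vec k \<omega>)) else 0)" for n \<omega>
    unfolding Y_def by (simp add: finite_tuples)
  have c_meas [measurable]: "c n \<in> borel_measurable N" for n
    unfolding c_def by (intro borel_measurable_times borel_measurable_const measurable_compose[OF W_vec_measurable label_density_measurable])
  have Y_meas: "Y n \<in> borel_measurable N" for n
    unfolding Y_def
  proof (intro borel_measurable_sum)
    fix x assume x: "x \<in> tuples n k"
    note [measurable] = grid_pred[OF x]
    have [measurable]: "(\<lambda>\<omega>. \<Phi> n x (rescaled_sums n k (W_vec k \<omega>))) \<in> borel_measurable N"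
      by (rule measurable_compose[OF W_vec_measurable measurable_compose[OF rescaled_sums_measurable meas[OF x]]])
    show "(\<lambda>\<omega>. if grid n k \<omega> = x then c n \<omega> * \<Phi> n x (rescaled_sums n k (W_vec k \<omega>)) else 0) \<in> borel_measurable N"
      by measurable
  qed
  have Y_nonneg: "0 \<le> Y n \<omega>" for n \<omega>
    unfolding Y_eq using c0 bound(1) by simp
  define S where "S = (\<lambda>n. smallest_value n k (\<Phi> n))"
  have S_meas: "S n \<in> borel_measurable (canon n)" for n
    unfolding S_def by (rule smallest_value_measurable[OF k meas])
  have S_nonneg: "0 \<le> S n \<tau>" for n \<tau>
    unfolding S_def smallest_value_def using bound(1) by (intro sum_nonneg) auto
  have eq: "(\<integral>\<tau>. S n \<tau> \<partial>canon n) = (\<integral>\<omega>. Y n \<omega> \<partial>N)" if n: "0 < n" for n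
  proof -
    have "(\<integral>\<^sup>+\<tau>. ennreal (S n \<tau>) \<partial>canon n)
        = (\<integral>\<^sup>+\<tau>. (\<Sum>x\<in>tuples n k. if smallest n k x \<tau> then ennreal (\<Phi> n x (\<lambda>i\<in>{..<k}. \<tau> (x i))) else 0) \<partial>canon n)"
      unfolding S_def smallest_value_def using bound(1) by (simp add: sum_ennreal[symmetric] if_distrib[of ennreal] cong: if_cong)
    also have "\<dots> = (\<integral>\<^sup>+\<omega>. (\<Sum>x\<in>tuples n k. if grid n k \<omega> = x then
        ennreal (c n \<omega>) * ennreal (\<Phi> n x (rescaled_sums n k (W_vec k \<omega>))) else 0) \<partial>N)"
      unfolding c_def using meas by (intro nn_integral_smallest_grid k n) auto
    also have "\<dots> = (\<integral>\<^sup>+\<omega>. ennreal (Y n \<omega>) \<partial>N)"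
      unfolding Y_def using bound(1) c0
      by (simp add: sum_ennreal[symmetric] ennreal_mult if_distrib[of ennreal] cong: if_cong)
    finally show ?thesis
      using S_meas Y_meas S_nonneg Y_nonneg by (simp add: integral_eq_nn_integral)
  qed
  have "filterlim (\<lambda>n. real (card (edge_set n))) at_top sequentially"
    unfolding real_card_edge_set by real_asymp
  then have "eventually (\<lambda>n. 2 * real k \<le> real (card (edge_set n))) sequentially"
    by (simp add: filterlim_at_top)
  then obtain n0 where n0: "\<And>n. n0 \<le> n \<Longrightarrow> 2 * real k \<le> real (card (edge_set n))"
    by (auto simp: eventually_sequentially)
  define m where "m = n0 + 1"
  have m: "0 < n + m" "2 * k \<le> card (edge_set (n + m))" for n
    using n0[of "n + m"] by (auto simp: m_def)
  have B: "0 \<le> B" using bound order_trans by blast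
  have "(\<lambda>n. \<integral>\<omega>. Y (n + m) \<omega> \<partial>N) \<longlonglongrightarrow> (\<integral>\<omega>. Z \<omega> \<partial>N)"
  proof (rule integral_dominated_convergence[where w = "\<lambda>\<omega>. 2 ^ k * exp ((\<Sum>j<k. W_vec k \<omega> j) / 2) * B"])
    show "integrable N (\<lambda>\<omega>. 2 ^ k * exp ((\<Sum>j<k. W_vec k \<omega> j) / 2) * B)"
      using integrable_exp_half[OF k] by simp
    have "norm (Y (n + m) \<omega>) \<le> 2 ^ k * exp ((\<Sum>j<k. W_vec k \<omega> j) / 2) * B" for n \<omega>
    proof -
      have "c (n + m) \<omega> \<le> 2 ^ k * exp ((\<Sum>j<k. W_vec k \<omega> j) / 2)"
        unfolding c_def by (rule label_density_le[OF k m])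
      then have "c (n + m) \<omega> * \<Phi> (n + m) x u \<le> 2 ^ k * exp ((\<Sum>j<k. W_vec k \<omega> j) / 2) * B" for x u
        using bound c0 by (intro mult_mono) auto
      then show ?thesis
        using Y_nonneg[of "n + m" \<omega>] B by (simp add: Y_eq)
    qed
    then show "AE \<omega> in N. norm (Y (n + m) \<omega>) \<le> 2 ^ k * exp ((\<Sum>j<k. W_vec k \<omega> j) / 2) * B" for n by simp
    show "AE \<omega> in N. (\<lambda>n. Y (n + m) \<omega>) \<longlonglongrightarrow> Z \<omega>"
      using AE_good tuples lim
    proof eventually_elim
      case (elim \<omega>)
      have w: "0 < (if i < k then W_vec k \<omega> i else 1)" for i
        using elim(1) by (auto simp: W_vec_def good_def)
      have "label_density n k (\<lambda>i. if i < k then W_vec k \<omega> i else 1) = label_density n k (W_vec k \<omega>)" for n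
      proof -
        have s1: "(\<Sum>j\<le>i. if j < k then W_vec k \<omega> j else 1) = (\<Sum>j\<le>i. W_vec k \<omega> j)" if "i < k" for i
          using that by (intro sum.cong) auto
        have s2: "(\<Sum>j<k. if j < k then W_vec k \<omega> j else 1) = (\<Sum>j<k. W_vec k \<omega> j)"
          by (intro sum.cong) auto
        show ?thesis
          unfolding label_density_def Let_def s2 by (simp only: s1 cong: imp_cong)
      qed
      then have "(\<lambda>n. c n \<omega>) \<longlonglongrightarrow> 1"
        using label_density_tendsto[where w = "\<lambda>i. if i < k then W_vec k \<omega> i else 1", OF w k]
        by (simp add: c_def)
      then have "(\<lambda>n. c n \<omega> * \<Phi> n (grid n k \<omega>) (rescaled_sums n k (W_vec k \<omega>))) \<longlonglongrightarrow> 1 * Z \<omega>"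
        using elim(3) by (intro tendsto_mult)
      moreover have "eventually (\<lambda>n. c n \<omega> * \<Phi> n (grid n k \<omega>) (rescaled_sums n k (W_vec k \<omega>)) = Y n \<omega>) sequentially"
        using elim(2) by eventually_elim (simp add: Y_eq)
      ultimately have "(\<lambda>n. Y n \<omega>) \<longlonglongrightarrow> Z \<omega>"
        by (simp add: tendsto_cong)
      then show ?case by (rule LIMSEQ_ignore_initial_segment)
    qed
  qed (use Y_meas Z in auto)
  then have "(\<lambda>n. \<integral>\<tau>. S (n + m) \<tau> \<partial>canon (n + m)) \<longlonglongrightarrow> (\<integral>\<omega>. Z \<omega> \<partial>N)"
    using eq[OF m(1)] by simp
  then have "(\<lambda>n. \<integral>\<tau>. S n \<tau> \<partial>canon n) \<longlonglongrightarrow> (\<integral>\<omega>. Z \<omega> \<partial>N)"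
    by (rule LIMSEQ_offset)
  then show ?thesis by (simp add: S_def)
qed

lemma grid_eventually:
  assumes "good \<omega>"
  shows "eventually (\<lambda>n. grid n k \<omega> \<in> tuples n k \<and> separated n (sqrt n) k (grid n k \<omega>) \<and>
    edge_chains (grid n k \<omega>) {..<k} = edge_chains (\<lambda>i. position U V i \<omega>) {..<k}) sequentially"
proof -
  define J where "J = (Inl ` {..<k} \<union> Inr ` {..<k} :: (nat + nat) set)"
  define P where "P = (\<lambda>j. X (Inr j) \<omega>) ` J"
  have fin: "finite P" by (simp add: P_def J_def)
  have P01: "0 < a \<and> a < 1" if "a \<in> P" for a using assms that by (auto simp: P_def good_def)
  define fl where "fl = (\<lambda>n a. \<lfloor>(real n + 1) * a\<rfloor>)"
  define L where "L = (\<lambda>i. min (U i \<omega>) (V i \<omega>))"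
  define R where "R = (\<lambda>i. max (U i \<omega>) (V i \<omega>))"
  have distinct: "X (Inr j) \<omega> \<noteq> X (Inr j') \<omega>" if "j \<noteq> j'" for j j'
    using assms that by (auto simp: good_def)
  have UV: "U i \<omega> \<noteq> V j \<omega>" for i j using distinct[of "Inl i" "Inr j"] by simp
  have UU: "U i \<omega> \<noteq> U j \<omega>" "V i \<omega> \<noteq> V j \<omega>" if "i \<noteq> j" for i j
    using distinct[of "Inl i" "Inl j"] distinct[of "Inr i" "Inr j"] that by auto
  have "U i \<omega> \<in> P" "V i \<omega> \<in> P" if "i < k" for i
    using that by (force simp: P_def J_def)+
  then have LR_P: "L i \<in> P" "R i \<in> P" if "i < k" for i
    using that by (auto simp: L_def R_def min_def max_def)
  have LR: "L i < R i" for i using UV[of i i] by (auto simp: L_def R_def min_def max_def)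
  have LR_neq: "R i \<noteq> L j" "L i \<noteq> L j" if "i \<noteq> j" for i j
    using that UV[of i j] UV[of j i] UU[of i j] by (auto simp: L_def R_def min_def max_def)
  have grid: "grid n k \<omega> i = (fl n (L i), fl n (R i))" if "i < k" for n i
    using that by (simp add: grid_def cell_edge_def fl_def L_def R_def)
  have pos: "position U V i \<omega> = (L i, R i)" for i
    by (simp add: position_def L_def R_def)
  have "eventually (\<lambda>n. \<forall>a\<in>P. \<forall>b\<in>P. a < b \<longrightarrow> of_int (fl n a) + sqrt n \<le> of_int (fl n b)) sequentially"
    using fin floor_gap by (intro eventually_ball_finite ballI) (auto simp: fl_def)
  moreover have "eventually (\<lambda>n. \<forall>a\<in>P. sqrt n \<le> of_int (fl n a)) sequentially"
    using fin floor_gap[of 0] P01 by (intro eventually_ball_finite ballI) (auto simp: fl_def)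
  moreover have "eventually (\<lambda>n. \<forall>a\<in>P. of_int (fl n a) + sqrt n \<le> real n) sequentially"
  proof (intro eventually_ball_finite ballI fin)
    fix a assume a: "a \<in> P"
    define c where "c = 1 - a"
    have "0 < c" using P01[OF a] by (simp add: c_def)
    then have "eventually (\<lambda>n. sqrt (real n) + 1 \<le> (real n + 1) * c) sequentially" by real_asymp
    then show "eventually (\<lambda>n. of_int (fl n a) + sqrt n \<le> real n) sequentially"
    proof eventually_elim
      case (elim n)
      have "(real n + 1) * c = (real n + 1) - (real n + 1) * a" by (simp add: c_def algebra_simps)
      then show ?case using elim unfolding fl_def by linarith
    qed
  qed
  moreover have "eventually (\<lambda>n::nat. 0 < n) sequentially" by (rule eventually_gt_at_top)
  ultimately show ?thesis
  proof eventually_elim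
    case (elim n)
    have d: "1 \<le> sqrt n" using elim(4) by simp
    have gap: "of_int (fl n a) + sqrt n \<le> (of_int (fl n b) :: real)" if "a \<in> P" "b \<in> P" "a < b" for a b
      using elim(1) that by blast
    have less: "fl n a < fl n b" if "a \<in> P" "b \<in> P" "a < b" for a b
      using gap[OF that] d by linarith
    have le_iff: "fl n a \<le> fl n b \<longleftrightarrow> a \<le> b" if "a \<in> P" "b \<in> P" for a b
      using less[of a b] less[of b a] that by (cases a b rule: linorder_cases) auto
    have edge: "(fl n (L i), fl n (R i)) \<in> edge_set n" if "i < k" for i
    proof -
      have "sqrt n \<le> of_int (fl n (L i))" using elim(2) LR_P(1)[OF that] by blast
      then have "0 \<le> fl n (L i)" using d by linarith
      moreover have "of_int (fl n (R i)) + sqrt n \<le> real n" using elim(3) LR_P(2)[OF that] by blast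
      then have "fl n (R i) \<le> int n" using d by linarith
      ultimately show ?thesis using less[OF LR_P[OF that] LR] by (simp add: edge_set_def)
    qed
    have "grid n k \<omega> \<in> tuples n k"
      unfolding tuples_def
    proof (intro CollectI conjI PiE_I inj_onI)
      show "grid n k \<omega> i \<in> edge_set n" if "i \<in> {..<k}" for i using that edge grid by simp
      show "grid n k \<omega> i = undefined" if "i \<notin> {..<k}" for i using that by (simp add: grid_def)
      fix i j assume ij: "i \<in> {..<k}" "j \<in> {..<k}" "grid n k \<omega> i = grid n k \<omega> j"
      then have "fl n (L i) = fl n (L j)" using grid by simp
      then have "L i = L j"
        using le_iff[OF LR_P(1) LR_P(1), of i j] le_iff[OF LR_P(1) LR_P(1), of j i] ij by simp
      then show "i = j" using LR_neq(2) by blast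
    qed
    moreover have "separated n (sqrt n) k (grid n k \<omega>)"
      unfolding separated_def
    proof (intro allI impI conjI)
      fix i assume i: "i < k"
      show "sqrt n \<le> of_int (fst (grid n k \<omega> i))" using elim(2) LR_P[OF i] by (simp add: grid[OF i])
      show "of_int (snd (grid n k \<omega> i)) + sqrt n \<le> real n" using elim(3) LR_P[OF i] by (simp add: grid[OF i])
      fix j assume j: "j < k" "i \<noteq> j"
      show "sqrt n \<le> \<bar>of_int (snd (grid n k \<omega> i)) - of_int (fst (grid n k \<omega> j))\<bar>"
        using gap[of "R i" "L j"] gap[of "L j" "R i"] LR_neq(1)[OF j(2)] LR_P[OF i] LR_P[OF j(1)]
        by (cases "R i" "L j" rule: linorder_cases) (auto simp: grid[OF i] grid[OF j(1)])
    qed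
    moreover have "nonoverlapping (grid n k \<omega> i) (grid n k \<omega> j) \<longleftrightarrow>
        nonoverlapping (position U V i \<omega>) (position U V j \<omega>)" if "i < k" "j < k" for i j
      using that le_iff LR_P by (simp add: nonoverlapping_def grid pos)
    then have "edge_chains (grid n k \<omega>) {..<k} = edge_chains (\<lambda>i. position U V i \<omega>) {..<k}"
      unfolding edge_chains_def pairwise_def by (intro Collect_cong conj_cong refl) (metis lessThan_iff subsetD)
    ultimately show ?case by blast
  qed
qed

definition top_weight :: "real \<Rightarrow> nat \<Rightarrow> 'b \<Rightarrow> real" where
  "top_weight s k \<omega> = max_weight (\<lambda>i. position U V i \<omega>) (\<lambda>i. weight s W i \<omega>) {..<k}"

lemma top_weight_measurable [measurable]: "top_weight s k \<in> borel_measurable N"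
proof -
  have w [measurable]: "weight s W i \<in> borel_measurable N" for i
    unfolding weight_def[abs_def] by measurable
  define c where "c = (\<lambda>A \<omega>. \<forall>i\<in>A. \<forall>j\<in>A. i \<noteq> j \<longrightarrow> nonoverlapping (position U V i \<omega>) (position U V j \<omega>))"
  have c_meas: "Measurable.pred N (c A)" if "A \<in> Pow {..<k}" for A
  proof -
    have fin: "finite A" using that by (auto intro: finite_subset)
    have m: "Measurable.pred N (\<lambda>\<omega>. i \<noteq> j \<longrightarrow> nonoverlapping (position U V i \<omega>) (position U V j \<omega>))" for i j
      unfolding nonoverlapping_def position_def fst_conv snd_conv by measurable
    show ?thesis
      unfolding c_def by (intro pred_intros_finite(3) fin m)
  qed
  have eq: "top_weight s k \<omega> = Max ((\<lambda>A. if c A \<omega> then \<Sum>i\<in>A. weight s W i \<omega> else 0) ` Pow {..<k})" for \<omega>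
  proof (rule antisym)
    let ?f = "\<lambda>A. if c A \<omega> then \<Sum>i\<in>A. weight s W i \<omega> else 0"
    have chain: "A \<in> edge_chains (\<lambda>i. position U V i \<omega>) {..<k} \<longleftrightarrow> A \<in> Pow {..<k} \<and> c A \<omega>" for A
      by (auto simp: edge_chains_def c_def pairwise_def)
    show "top_weight s k \<omega> \<le> Max (?f ` Pow {..<k})"
      unfolding top_weight_def
    proof (rule max_weight_le)
      fix A assume A: "A \<in> edge_chains (\<lambda>i. position U V i \<omega>) {..<k}"
      then have cA: "c A \<omega>" "A \<in> Pow {..<k}" by (simp_all add: chain)
      then have "?f A \<le> Max (?f ` Pow {..<k})" by (intro Max_ge imageI finite_imageI) simp_all
      then show "(\<Sum>i\<in>A. weight s W i \<omega>) \<le> Max (?f ` Pow {..<k})" using cA(1) by (simp only: if_True)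
    qed simp
    have le: "?f A \<le> top_weight s k \<omega>" if "A \<in> Pow {..<k}" for A
      unfolding top_weight_def using that
        max_weight_ge[of "{..<k}" A "\<lambda>i. position U V i \<omega>" "\<lambda>i. weight s W i \<omega>"]
      by (simp add: chain max_weight_nonneg)
    show "Max (?f ` Pow {..<k}) \<le> top_weight s k \<omega>"
    proof (rule Max.boundedI)
      fix a assume "a \<in> ?f ` Pow {..<k}"
      then show "a \<le> top_weight s k \<omega>" using le by blast
    qed auto
  qed
  have "(\<lambda>\<omega>. Max ((\<lambda>A. if c A \<omega> then \<Sum>i\<in>A. weight s W i \<omega> else 0) ` Pow {..<k})) \<in> borel_measurable N"
  proof (rule borel_measurable_Max)
    fix A assume "A \<in> Pow {..<k}"
    note [measurable] = c_meas[OF this]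
    show "(\<lambda>\<omega>. if c A \<omega> then \<Sum>i\<in>A. weight s W i \<omega> else 0) \<in> borel_measurable N" by measurable
  qed simp
  then show ?thesis by (simp add: eq[abs_def])
qed

lemma continuous_last_passage_eq:
  "continuous_last_passage s W U V \<omega> = (SUP k. ereal (top_weight s k \<omega>))"
proof (rule antisym)
  have compat: "compatible x y \<longleftrightarrow> nonoverlapping x y" for x y
    by (simp add: compatible_def nonoverlapping_def)
  show "continuous_last_passage s W U V \<omega> \<le> (SUP k. ereal (top_weight s k \<omega>))"
    unfolding continuous_last_passage_def
  proof (rule SUP_least)
    fix A assume A: "A \<in> compatible_sets U V \<omega>"
    have le: "(\<Sum>i\<in>F. ereal (weight s W i \<omega>)) \<le> (SUP k. ereal (top_weight s k \<omega>))"
      if F: "F \<in> {F. finite F \<and> F \<subseteq> A}" for F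
    proof -
      obtain k where k: "F \<subseteq> {..<k}" using F finite_nat_bounded[of F] by auto
      then have "F \<in> edge_chains (\<lambda>i. position U V i \<omega>) {..<k}"
        using A F by (auto simp: edge_chains_def compatible_sets_def compat pairwise_def)
      then have "(\<Sum>i\<in>F. weight s W i \<omega>) \<le> top_weight s k \<omega>"
        unfolding top_weight_def by (intro max_weight_ge) auto
      then have "(\<Sum>i\<in>F. ereal (weight s W i \<omega>)) \<le> ereal (top_weight s k \<omega>)"
        by (simp add: sum_ereal)
      then show ?thesis by (rule SUP_upper2[OF UNIV_I])
    qed
    show "(\<Sum>\<^sub>\<infinity>i\<in>A. ereal (weight s W i \<omega>)) \<le> (SUP k. ereal (top_weight s k \<omega>))"
    proof (cases "(\<lambda>i. ereal (weight s W i \<omega>)) summable_on A")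
      case True
      then show ?thesis using le by (intro infsum_le_finite_sums) auto
    next
      case False
      then show ?thesis using le[of "{}"] by (simp add: infsum_not_exists zero_ereal_def)
    qed
  qed
  show "(SUP k. ereal (top_weight s k \<omega>)) \<le> continuous_last_passage s W U V \<omega>"
  proof (rule SUP_least)
    fix k
    obtain A where A: "A \<in> edge_chains (\<lambda>i. position U V i \<omega>) {..<k}"
      "top_weight s k \<omega> = (\<Sum>i\<in>A. weight s W i \<omega>)"
      using max_weight_attained[of "{..<k}"] unfolding top_weight_def by (metis finite_lessThan)
    have "finite A" using A finite_subset by (auto simp: edge_chains_def)
    then have "ereal (top_weight s k \<omega>) = (\<Sum>\<^sub>\<infinity>i\<in>A. ereal (weight s W i \<omega>))"
      using A(2) by (simp add: sum_ereal)
    moreover have "A \<in> compatible_sets U V \<omega>"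
      using A(1) by (auto simp: edge_chains_def compatible_sets_def compat pairwise_def)
    ultimately show "ereal (top_weight s k \<omega>) \<le> continuous_last_passage s W U V \<omega>"
      unfolding continuous_last_passage_def by (auto intro: SUP_upper)
  qed
qed

lemma top_weight_tendsto: "(\<lambda>k. ereal (top_weight s k \<omega>)) \<longlonglongrightarrow> continuous_last_passage s W U V \<omega>"
proof -
  have "incseq (\<lambda>k. ereal (top_weight s k \<omega>))"
  proof (rule incseq_SucI)
    fix k
    have "max_weight (\<lambda>i. position U V i \<omega>) (\<lambda>i. weight s W i \<omega>) {..<k}
        \<le> max_weight (\<lambda>i. position U V i \<omega>) (\<lambda>i. weight s W i \<omega>) {..<Suc k}"
      by (intro max_weight_le max_weight_ge) (auto simp: edge_chains_def)
    then show "ereal (top_weight s k \<omega>) \<le> ereal (top_weight s (Suc k) \<omega>)" by (simp add: top_weight_def)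
  qed
  then show ?thesis unfolding continuous_last_passage_eq by (rule LIMSEQ_SUP)
qed

lemma continuous_last_passage_measurable: "continuous_last_passage s W U V \<in> borel_measurable N"
  unfolding continuous_last_passage_eq[abs_def] by measurable

end

section \<open>The passage time in terms of labels\<close>

lemma path_edge_in_edge_set:
  assumes "is \<in> paths E 0 (int n)" "Suc k < length is"
  shows "(is ! k, is ! Suc k) \<in> edge_set n"
proof -
  obtain A where "A \<in> edge_chains id (edge_set n)" "(is ! k, is ! Suc k) \<in> A"
    using path_edges[OF assms(1)] assms(2) by metis
  then show ?thesis by (auto simp: edge_chains_def)
qed

lemma paths_cong:
  assumes "\<And>x. x \<in> edge_set n \<Longrightarrow> E x = E' x"
  shows "paths E 0 (int n) = paths E' 0 (int n)"
proof -
  have "is \<in> paths E' 0 (int n)" if "is \<in> paths E 0 (int n)" "\<And>x. x \<in> edge_set n \<Longrightarrow> E x = E' x" for E E' "is"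
    using that path_edge_in_edge_set[OF that(1)] by (auto simp: paths_def)
  then show ?thesis using assms by blast
qed

lemma path_weight_cong:
  assumes "is \<in> paths E 0 (int n)" "\<And>x. x \<in> edge_set n \<Longrightarrow> c x = c' x"
  shows "path_weight c is = path_weight c' is"
  unfolding path_weight_def
  using assms path_edge_in_edge_set[OF assms(1)] by (intro sum.cong) auto

lemma measurable_SUP_paths:
  assumes c: "\<And>x. x \<in> edge_set n \<Longrightarrow> (\<lambda>\<omega>. c \<omega> x) \<in> borel_measurable M"
    and E: "\<And>x. x \<in> edge_set n \<Longrightarrow> Measurable.pred M (\<lambda>\<omega>. E \<omega> x)"
  shows "(\<lambda>\<omega>. SUP is \<in> paths (E \<omega>) 0 (int n). ereal (path_weight (c \<omega>) is)) \<in> borel_measurable M"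
proof -
  define P where "P = paths (\<lambda>_. True) 0 (int n)"
  define ok where "ok = (\<lambda>is \<omega>. \<forall>k\<in>{..<length is - 1}. E \<omega> (is ! k, is ! Suc k))"
  have in_paths: "is \<in> paths (E \<omega>) 0 (int n) \<longleftrightarrow> is \<in> P \<and> ok is \<omega>" for "is" \<omega>
    by (auto simp: paths_def P_def ok_def)
  have eq: "(SUP is \<in> paths (E \<omega>) 0 (int n). ereal (path_weight (c \<omega>) is))
      = (SUP is \<in> P. if ok is \<omega> then ereal (path_weight (c \<omega>) is) else - \<infinity>)" for \<omega>
  proof (rule antisym)
    show "(SUP is \<in> paths (E \<omega>) 0 (int n). ereal (path_weight (c \<omega>) is))
      \<le> (SUP is \<in> P. if ok is \<omega> then ereal (path_weight (c \<omega>) is) else - \<infinity>)"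
    proof (rule SUP_least)
      fix "is" assume "is \<in> paths (E \<omega>) 0 (int n)"
      then have "is \<in> P" "ok is \<omega>" by (simp_all add: in_paths)
      then show "ereal (path_weight (c \<omega>) is) \<le> (SUP is \<in> P. if ok is \<omega> then ereal (path_weight (c \<omega>) is) else - \<infinity>)"
        by (intro SUP_upper2[of "is"]) auto
    qed
    show "(SUP is \<in> P. if ok is \<omega> then ereal (path_weight (c \<omega>) is) else - \<infinity>)
      \<le> (SUP is \<in> paths (E \<omega>) 0 (int n). ereal (path_weight (c \<omega>) is))"
      by (rule SUP_least) (auto simp: in_paths intro: SUP_upper)
  qed
  have "(\<lambda>\<omega>. if ok is \<omega> then ereal (path_weight (c \<omega>) is) else - \<infinity>) \<in> borel_measurable M" if "is \<in> P" for "is"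
  proof -
    have edge: "(is ! k, is ! Suc k) \<in> edge_set n" if "k < length is - 1" for k
      using path_edge_in_edge_set[of "is" "\<lambda>_. True" n k] \<open>is \<in> P\<close> that by (simp add: P_def)
    have [measurable]: "Measurable.pred M (ok is)"
      unfolding ok_def using edge by (intro pred_intros_finite(3) E finite_lessThan) auto
    have [measurable]: "(\<lambda>\<omega>. path_weight (c \<omega>) is) \<in> borel_measurable M"
      unfolding path_weight_def using edge by (intro borel_measurable_sum c) auto
    show ?thesis by measurable
  qed
  then have "(\<lambda>\<omega>. SUP is \<in> P. if ok is \<omega> then ereal (path_weight (c \<omega>) is) else - \<infinity>) \<in> borel_measurable M"
    by (intro borel_measurable_SUP) auto
  then show ?thesis by (simp add: eq)
qed

lemma lpp_cmult:
  assumes "0 < a"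
  shows "ereal a * lpp n c = lpp n (\<lambda>x. a * c x)"
proof (cases "paths (\<lambda>x. 0 < c x) 0 (int n) = {}")
  case True
  then show ?thesis using assms by (simp add: lpp_def zero_less_mult_iff bot_ereal_def)
next
  case False
  have "path_weight (\<lambda>x. a * c x) is = a * path_weight c is" for "is"
    by (simp add: path_weight_def sum_distrib_left)
  then show ?thesis
    using assms False Sup_ereal_mult_left'[of "paths (\<lambda>x. 0 < c x) 0 (int n)" a "\<lambda>is. ereal (path_weight c is)"]
    by (simp add: lpp_def zero_less_mult_iff)
qed

lemma lpp_cong: "(\<And>x. x \<in> edge_set n \<Longrightarrow> c x = c' x) \<Longrightarrow> lpp n c = lpp n c'"
  unfolding lpp_def using paths_cong[of n "\<lambda>x. 0 < c x" "\<lambda>x. 0 < c' x"] path_weight_cong[of _ _ n c c']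
  by (intro SUP_cong) auto

lemma ereal_uniformly_continuous:
  fixes f :: "ereal \<Rightarrow> real"
  assumes f: "continuous_on UNIV f" and e: "0 < e"
  obtains d where "0 < d" "\<And>x y. \<bar>x - y\<bar> \<le> d \<Longrightarrow> \<bar>f (ereal x) - f (ereal y)\<bar> < e"
proof -
  define g where "g = (\<lambda>x. f (ereal x))"
  have f_at: "(f \<longlongrightarrow> f a) (at a)" for a
    using f by (simp add: continuous_on_def)
  have half: "0 < e / 2" using e by simp
  have "(g \<longlongrightarrow> f \<infinity>) at_top"
    unfolding g_def
    by (rule filterlim_compose[OF f_at]) (simp add: filterlim_at tendsto_PInfty eventually_gt_at_top)
  then have "eventually (\<lambda>x. \<bar>g x - f \<infinity>\<bar> < e / 2) at_top"
    unfolding dist_real_def[symmetric] using half by (rule tendstoD)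
  then obtain a where a: "\<And>x. a \<le> x \<Longrightarrow> \<bar>g x - f \<infinity>\<bar> < e / 2" by (auto simp: eventually_at_top_linorder)
  have "(g \<longlongrightarrow> f (- \<infinity>)) at_bot"
    unfolding g_def
    by (rule filterlim_compose[OF f_at]) (simp add: filterlim_at tendsto_MInfty eventually_gt_at_bot)
  then have "eventually (\<lambda>x. \<bar>g x - f (- \<infinity>)\<bar> < e / 2) at_bot"
    unfolding dist_real_def[symmetric] using half by (rule tendstoD)
  then obtain b where b: "\<And>x. x \<le> b \<Longrightarrow> \<bar>g x - f (- \<infinity>)\<bar> < e / 2" by (auto simp: eventually_at_bot_linorder)
  have "continuous_on {b - 1..a + 1} g"
    unfolding g_def by (intro continuous_on_compose2[OF f] continuous_on_ereal continuous_intros) auto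
  then have "uniformly_continuous_on {b - 1..a + 1} g"
    by (rule compact_uniformly_continuous) simp
  then obtain d where d: "0 < d" "\<And>x y. x \<in> {b - 1..a + 1} \<Longrightarrow> y \<in> {b - 1..a + 1} \<Longrightarrow> dist y x < d \<Longrightarrow> dist (g y) (g x) < e"
    unfolding uniformly_continuous_on_def using e by metis
  show ?thesis
  proof (rule that[of "min 1 d / 2"])
    fix x y :: real assume xy: "\<bar>x - y\<bar> \<le> min 1 d / 2"
    consider "a \<le> x" "a \<le> y" | "x \<le> b" "y \<le> b" | "x \<in> {b - 1..a + 1}" "y \<in> {b - 1..a + 1}"
      using xy by (fastforce simp: abs_if split: if_splits)
    then show "\<bar>f (ereal x) - f (ereal y)\<bar> < e"
    proof cases
      case 1
      then show ?thesis using a[of x] a[of y] unfolding g_def by linarith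
    next
      case 2
      then show ?thesis using b[of x] b[of y] unfolding g_def by linarith
    next
      case 3
      then show ?thesis using d(2)[of y x] xy d(1) by (simp add: g_def dist_real_def)
    qed
  qed (use d in simp)
qed

context heavy_tail
begin

lemma tail_inverse_measurable [measurable]: "h \<in> borel_measurable borel"
proof (rule borel_measurableI_le)
  fix a
  have nonpos: "h u = Inf {}" if "u \<le> 0" for u
  proof -
    have "{x. 0 \<le> x \<and> T x \<le> u} = {}" using that T_pos by (auto simp: not_le intro: order_le_less_trans)
    then show ?thesis unfolding tail_inverse_def by (simp only:)
  qed
  have pos: "h u \<le> a \<longleftrightarrow> 0 \<le> a \<and> T a \<le> u" if "0 < u" for u
    using tail_inverse_le_iff[OF that, of a] tail_inverse_in(1)[OF that] by (cases "0 \<le> a") auto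
  have "{u \<in> space borel. h u \<le> a} = (if (Inf {} :: real) \<le> a then {..0} else {}) \<union>
      (if 0 \<le> a then {0<..} \<inter> {T a..} else {})"
  proof (rule set_eqI)
    fix u :: real
    show "u \<in> {u \<in> space borel. h u \<le> a} \<longleftrightarrow> u \<in> (if (Inf {} :: real) \<le> a then {..0} else {}) \<union>
      (if 0 \<le> a then {0<..} \<inter> {T a..} else {})"
      using nonpos[of u] pos[of u] by (cases "u \<le> 0") auto
  qed
  then show "{u \<in> space borel. h u \<le> a} \<in> sets borel" by simp
qed

definition normalizer :: "nat \<Rightarrow> real" where
  "normalizer n = p powr (- 1 / s) / h (p / K n)"

lemma scaled_eq: "scaled n t = normalizer n * h (t / K n)"
  by (simp add: scaled_def normalizer_def)

lemma K_pos: "0 < n \<Longrightarrow> 0 < K n"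
  by (simp add: real_card_edge_set)

lemma normalizer_pos: "2 \<le> n \<Longrightarrow> 0 < normalizer n"
proof -
  assume n: "2 \<le> n"
  have "2 * (2 + 1) \<le> real n * (real n + 1)" using n by (intro mult_mono) auto
  then have "1 < K n" by (simp add: real_card_edge_set)
  then have "p / K n < p" "0 < p / K n" using p_pos by (auto simp: divide_less_eq)
  then have "0 < h (p / K n)" using tail_inverse_pos_iff by blast
  then show ?thesis using p_pos by (simp add: normalizer_def)
qed

definition passage :: "nat \<Rightarrow> (int \<times> int \<Rightarrow> real) \<Rightarrow> ereal" where
  "passage n \<tau> = lpp n (\<lambda>x. normalizer n * h (\<tau> x))"

lemma passage_measurable [measurable]: "passage n \<in> borel_measurable (canon n)"
  unfolding passage_def[abs_def] lpp_def
proof (rule measurable_SUP_paths)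
  fix x assume x: "x \<in> edge_set n"
  show m: "(\<lambda>\<tau>. normalizer n * h (\<tau> x)) \<in> borel_measurable (canon n)"
    by (intro borel_measurable_times borel_measurable_const
        measurable_compose[OF measurable_canon_component[OF x] tail_inverse_measurable])
  show "Measurable.pred (canon n) (\<lambda>\<tau>. 0 < normalizer n * h (\<tau> x))"
    using m by (intro borel_measurable_pred_less) auto
qed

lemma passage_sandwich:
  assumes n: "2 \<le> n" and k: "0 < k" and x: "x \<in> tuples n k" and sm: "smallest n k x \<tau>"
    and \<tau>: "\<And>y. y \<in> edge_set n \<Longrightarrow> 0 < \<tau> y \<and> \<tau> y < 1"
    and sep: "separated n (sqrt n) k x" and pres: "\<tau> (x (k - 1)) < p"
    and conn: "connected_gaps (\<lambda>y. \<tau> y < p) n (sqrt n)"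
    and few: "card {y \<in> edge_set n. \<tau> y \<le> \<theta> / K n} < k"
    and R: "\<And>A. A \<in> edge_chains id (edge_set n) \<Longrightarrow> (\<And>y. y \<in> A \<Longrightarrow> \<tau> y \<le> 1 \<and> \<theta> \<le> K n * \<tau> y) \<Longrightarrow>
      (\<Sum>y\<in>A. scaled n (K n * \<tau> y)) \<le> R"
  shows "ereal (max_weight x (\<lambda>i. normalizer n * h (\<tau> (x i))) {..<k}) \<le> passage n \<tau>"
    and "passage n \<tau> \<le> ereal (max_weight x (\<lambda>i. normalizer n * h (\<tau> (x i))) {..<k} + R)"
proof -
  define c where "c = (\<lambda>y. normalizer n * h (\<tau> y))"
  have an: "0 < normalizer n" by (rule normalizer_pos[OF n])
  have Kn: "0 < K n" using n by (intro K_pos) simp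
  have c_pos: "0 < c y \<longleftrightarrow> \<tau> y < p" if "y \<in> edge_set n" for y
    using tail_inverse_pos_iff[of "\<tau> y"] \<tau>[OF that] an by (simp add: c_def zero_less_mult_iff)
  have xE: "x i \<in> edge_set n" if "i < k" for i using x that by (auto simp: tuples_def)
  have inj: "inj_on x {..<k}" using x by (simp add: tuples_def)
  have le_last: "\<tau> (x i) \<le> \<tau> (x (k - 1))" if "i < k" for i
  proof (cases "i = k - 1")
    case False
    then have "i < k - 1" "k - 1 < k" using that by auto
    then show ?thesis
      using sm pos_increasing_less[of k "\<lambda>i. \<tau> (x i)" i "k - 1"] by (simp add: smallest_def)
  qed simp
  have sqrt_n: "0 < sqrt n" "sqrt n \<le> real n"
  proof -
    have "1 \<le> sqrt n" using n by simp
    then have "sqrt n * 1 \<le> sqrt n * sqrt n" by (intro mult_left_mono) auto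
    then show "sqrt n \<le> real n" by simp
  qed (use n in simp)
  have gaps: "connected_gaps (\<lambda>y. 0 < c y) n (sqrt n)"
    unfolding connected_gaps_def
  proof (intro allI impI)
    fix i j :: int assume ij: "0 \<le> i" "j \<le> int n" "of_int i + sqrt n \<le> of_int j"
    obtain l where l: "i < l" "l < j" "\<tau> (i, l) < p" "\<tau> (l, j) < p"
      using conn ij by (auto simp: connected_gaps_def)
    have "(i, l) \<in> edge_set n" "(l, j) \<in> edge_set n" using l ij by (auto simp: edge_set_def)
    then show "\<exists>l>i. l < j \<and> 0 < c (i, l) \<and> 0 < c (l, j)" using l c_pos by blast
  qed
  have "0 < c (x i)" if "i < k" for i
    using c_pos[OF xE[OF that]] le_last[OF that] pres by simp
  then have "ereal (max_weight x (\<lambda>i. c (x i)) {..<k}) \<le> lpp n c"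
    using xE by (intro lpp_ge[OF _ inj _ gaps sep sqrt_n]) auto
  then show "ereal (max_weight x (\<lambda>i. normalizer n * h (\<tau> (x i))) {..<k}) \<le> passage n \<tau>"
    by (simp add: passage_def c_def)
  have \<theta>: "\<theta> / K n < \<tau> (x (k - 1))"
  proof (rule ccontr)
    assume "\<not> \<theta> / K n < \<tau> (x (k - 1))"
    then have "x ` {..<k} \<subseteq> {y \<in> edge_set n. \<tau> y \<le> \<theta> / K n}"
      using xE le_last by (fastforce intro: order_trans)
    then have "card (x ` {..<k}) \<le> card {y \<in> edge_set n. \<tau> y \<le> \<theta> / K n}"
      by (intro card_mono) (auto simp: finite_edge_set)
    then show False using few by (simp add: card_image[OF inj])
  qed
  have "lpp n c \<le> ereal (max_weight x (\<lambda>i. c (x i)) {..<k} + R)"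
  proof (rule lpp_le[OF _ inj])
    fix A assume A: "A \<in> edge_chains id (edge_set n - x ` {..<k})"
    then have A': "A \<in> edge_chains id (edge_set n)" by (auto simp: edge_chains_def)
    have "\<tau> y \<le> 1 \<and> \<theta> \<le> K n * \<tau> y" if "y \<in> A" for y
    proof -
      have y: "y \<in> edge_set n - x ` {..<k}" using A that by (auto simp: edge_chains_def)
      then have "\<tau> (x (k - 1)) < \<tau> y" using sm by (simp add: smallest_def)
      then have "\<theta> / K n < \<tau> y" using \<theta> by linarith
      then show ?thesis using Kn \<tau>[of y] y by (simp add: field_simps less_imp_le)
    qed
    then have "(\<Sum>y\<in>A. scaled n (K n * \<tau> y)) \<le> R" by (intro R A')
    then show "sum c A \<le> R" using Kn by (simp add: scaled_eq c_def)
  qed (use xE in auto)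
  then show "passage n \<tau> \<le> ereal (max_weight x (\<lambda>i. normalizer n * h (\<tau> (x i))) {..<k} + R)"
    by (simp add: passage_def c_def)
qed

end

section \<open>Convergence of the passage time of the labels\<close>

lemma max_weight_measurable:
  assumes "finite I" "\<And>i. i \<in> I \<Longrightarrow> (\<lambda>\<omega>. c \<omega> i) \<in> borel_measurable M"
  shows "(\<lambda>\<omega>. max_weight pos (c \<omega>) I) \<in> borel_measurable M"
  unfolding max_weight_def using assms
  by (intro borel_measurable_Max finite_edge_chains borel_measurable_sum) (auto simp: edge_chains_def)

lemma many_small_sets:
  "{\<tau> \<in> space (canon n). k \<le> card {x \<in> edge_set n. \<tau> x \<le> q}} \<in> sets (canon n)"
proof -
  have eq: "real (card {x \<in> edge_set n. \<tau> x \<le> q}) = (\<Sum>x\<in>edge_set n. indicator {..q} (\<tau> x))" for \<tau> :: "int \<times> int \<Rightarrow> real"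
  proof -
    have "{x \<in> edge_set n. \<tau> x \<le> q} = edge_set n \<inter> {x. \<tau> x \<le> q}" by auto
    then show ?thesis by (simp add: indicator_def of_bool_def sum.If_cases finite_edge_set)
  qed
  have "{\<tau> \<in> space (canon n). k \<le> card {x \<in> edge_set n. \<tau> x \<le> q}}
      = {\<tau> \<in> space (canon n). real k \<le> real (card {x \<in> edge_set n. \<tau> x \<le> q})}"
    by (simp only: of_nat_le_iff)
  also have "\<dots> = {\<tau> \<in> space (canon n). real k \<le> (\<Sum>x\<in>edge_set n. indicator {..q} (\<tau> x))}"
    by (simp only: eq)
  also have "\<dots> \<in> sets (canon n)"
  proof -
    have [measurable]: "(\<lambda>\<tau>. \<Sum>x\<in>edge_set n. indicator {..q} (\<tau> x) :: real) \<in> borel_measurable (canon n)"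
      by (intro borel_measurable_sum measurable_compose[OF measurable_canon_component borel_measurable_indicator]) auto
    show ?thesis by measurable
  qed
  finally show ?thesis .
qed

context heavy_tail
begin

lemma scaled_antimono:
  assumes "2 \<le> n" "0 < t" "t \<le> t'"
  shows "scaled n t' \<le> scaled n t"
  using assms normalizer_pos[of n] K_pos[of n] unfolding scaled_eq
  by (intro mult_left_mono tail_inverse_antimono divide_right_mono divide_pos_pos) auto

lemma scaled_nonneg: "2 \<le> n \<Longrightarrow> 0 < t \<Longrightarrow> 0 \<le> scaled n t"
  using normalizer_pos[of n] K_pos[of n] tail_inverse_in(1)[of "t / K n"] unfolding scaled_eq by simp

definition chain_value :: "(ereal \<Rightarrow> real) \<Rightarrow> nat \<Rightarrow> nat \<Rightarrow> (nat \<Rightarrow> int \<times> int) \<Rightarrow> (nat \<Rightarrow> real) \<Rightarrow> real" where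
  "chain_value f n k x u = f (ereal (max_weight x (\<lambda>i. normalizer n * h (u i)) {..<k}))"

definition bad_tuple :: "nat \<Rightarrow> nat \<Rightarrow> (nat \<Rightarrow> int \<times> int) \<Rightarrow> (nat \<Rightarrow> real) \<Rightarrow> real" where
  "bad_tuple n k x u = of_bool (\<not> (separated n (sqrt n) k x \<and> u (k - 1) < p))"

lemma chain_value_measurable:
  assumes "f \<in> borel_measurable borel"
  shows "chain_value f n k x \<in> borel_measurable (PiM {..<k} (\<lambda>_. borel))"
  unfolding chain_value_def[abs_def]
proof (rule measurable_compose[OF _ assms], rule borel_measurable_ereal, rule max_weight_measurable)
  show "(\<lambda>u. normalizer n * h (u i)) \<in> borel_measurable (PiM {..<k} (\<lambda>_. borel))" if "i \<in> {..<k}" for i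
    by (intro borel_measurable_times borel_measurable_const
        measurable_compose[OF measurable_component_singleton[OF that] tail_inverse_measurable])
qed simp

lemma bad_tuple_measurable:
  assumes "0 < k"
  shows "bad_tuple n k x \<in> borel_measurable (PiM {..<k} (\<lambda>_. borel))"
proof -
  have [measurable]: "(\<lambda>u. u (k - 1)) \<in> borel_measurable (PiM {..<k} (\<lambda>_. borel :: real measure))"
    using assms by (intro measurable_component_singleton) auto
  show ?thesis unfolding bad_tuple_def[abs_def] by measurable
qed

lemma passage_approximation:
  fixes f :: "ereal \<Rightarrow> real"
  assumes n: "2 \<le> n" and k: "0 < k" "k \<le> card (edge_set n)" and \<theta>: "0 < \<theta>" "\<theta> < K n"
    and f: "f \<in> borel_measurable borel" "\<And>x. 0 \<le> f x" "\<And>x. f x \<le> B"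
    and \<delta>: "0 < \<delta>" "\<And>x y. \<bar>x - y\<bar> \<le> \<delta> \<Longrightarrow> \<bar>f (ereal x) - f (ereal y)\<bar> \<le> \<eta>"
  defines "Q \<equiv> (\<Sum>j | \<theta> * 2 ^ j < K n. scaled n (\<theta> * 2 ^ j) * (4 * sqrt (\<theta> * 2 ^ j) / ln 2))"
  shows "\<bar>(\<integral>\<tau>. f (passage n \<tau>) \<partial>canon n) - (\<integral>\<tau>. smallest_value n k (chain_value f n k) \<tau> \<partial>canon n)\<bar>
    \<le> \<eta> + B * ((\<integral>\<tau>. smallest_value n k (bad_tuple n k) \<tau> \<partial>canon n)
      + measure (canon n) {\<tau> \<in> space (canon n). \<not> connected_gaps (\<lambda>x. \<tau> x < p) n (sqrt n)}
      + \<theta> / k + Q / \<delta>)"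
proof -
  have n0: "0 < n" using n by simp
  have Kn: "0 < K n" by (rule K_pos[OF n0])
  have B: "0 \<le> B" using f(2,3) order_trans by blast
  have \<eta>: "0 \<le> \<eta>" using \<delta>(2)[of 0 0] \<delta>(1) by simp
  obtain R where R_int: "integrable (canon n) R" and R_nonneg: "\<And>\<tau>. 0 \<le> R \<tau>"
    and R_exp: "(\<integral>\<tau>. R \<tau> \<partial>canon n) \<le> Q"
    and R: "\<And>\<tau> A. A \<in> edge_chains id (edge_set n) \<Longrightarrow> (\<And>x. x \<in> A \<Longrightarrow> \<tau> x \<le> 1 \<and> \<theta> \<le> K n * \<tau> x) \<Longrightarrow>
      (\<Sum>x\<in>A. scaled n (K n * \<tau> x)) \<le> R \<tau>"
    unfolding Q_def
    by (rule expected_chain_weight[OF n0, of "scaled n" "K n" \<theta>])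
      (use scaled_antimono[OF n] scaled_nonneg[OF n] \<theta> in auto)
  define S1 where "S1 = smallest_value n k (chain_value f n k)"
  define S2 where "S2 = smallest_value n k (bad_tuple n k)"
  have S1_int: "integrable (canon n) S1"
    unfolding S1_def by (rule smallest_value_integrable[OF k(1) chain_value_measurable[OF f(1)], where B = B])
      (auto simp: chain_value_def f)
  have S2_int: "integrable (canon n) S2"
    unfolding S2_def by (rule smallest_value_integrable[OF k(1) bad_tuple_measurable[OF k(1)], where B = 1])
      (auto simp: bad_tuple_def)
  have f_int: "integrable (canon n) (\<lambda>\<tau>. f (passage n \<tau>))"
    by (rule canon.integrable_const_bound[where B = B])
      (use f in \<open>auto intro: measurable_compose[OF passage_measurable f(1)]\<close>)
  define C1 where "C1 = {\<tau> \<in> space (canon n). \<not> connected_gaps (\<lambda>x. \<tau> x < p) n (sqrt n)}"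
  define C2 where "C2 = {\<tau> \<in> space (canon n). k \<le> card {x \<in> edge_set n. \<tau> x \<le> \<theta> / K n}}"
  define C3 where "C3 = {\<tau> \<in> space (canon n). \<delta> \<le> R \<tau>}"
  have C1: "C1 \<in> sets (canon n)"
    unfolding C1_def by (rule prob_not_connected(1)[OF n0, where m = 0]) (use p_pos p_le n in auto)
  have C2: "C2 \<in> sets (canon n)" unfolding C2_def by (rule many_small_sets)
  have [measurable]: "R \<in> borel_measurable (canon n)" using R_int by simp
  have C3: "C3 \<in> sets (canon n)" unfolding C3_def by measurable
  have ind_int: "integrable (canon n) (indicator C :: _ \<Rightarrow> real)" if "C \<in> sets (canon n)" for C
    using that by (simp add: canon.emeasure_eq_measure)
  have "AE \<tau> in canon n. \<bar>f (passage n \<tau>) - S1 \<tau>\<bar>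
      \<le> \<eta> + B * (S2 \<tau> + indicator C1 \<tau> + indicator C2 \<tau> + indicator C3 \<tau>)"
    using AE_canon[of n] AE_canon_inj[of n] AE_space
  proof eventually_elim
    case (elim \<tau>)
    have ex1: "\<exists>!x. x \<in> tuples n k \<and> smallest n k x \<tau>"
      using elim(1) by (intro ex1_smallest elim(2) k) auto
    then obtain x where x: "x \<in> tuples n k" "smallest n k x \<tau>" by blast
    define m where "m = max_weight x (\<lambda>i. normalizer n * h (\<tau> (x i))) {..<k}"
    have S1: "S1 \<tau> = f (ereal m)"
    proof -
      have "max_weight x (\<lambda>i. normalizer n * h ((\<lambda>i\<in>{..<k}. \<tau> (x i)) i)) {..<k} = m"
        unfolding m_def by (rule max_weight_cong) auto
      then show ?thesis unfolding S1_def smallest_value_eq[OF ex1 x] by (simp add: chain_value_def)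
    qed
    have S2: "S2 \<tau> = of_bool (\<not> (separated n (sqrt n) k x \<and> \<tau> (x (k - 1)) < p))"
      unfolding S2_def smallest_value_eq[OF ex1 x] using k(1) by (simp add: bad_tuple_def)
    have triv: "\<bar>f (passage n \<tau>) - S1 \<tau>\<bar> \<le> B"
      using f(2,3)[of "passage n \<tau>"] f(2,3)[of "ereal m"] unfolding S1 by linarith
    show ?case
    proof (cases "separated n (sqrt n) k x \<and> \<tau> (x (k - 1)) < p \<and> \<tau> \<notin> C1 \<and> \<tau> \<notin> C2 \<and> \<tau> \<notin> C3")
      case True
      then have conn: "connected_gaps (\<lambda>y. \<tau> y < p) n (sqrt n)"
        and few: "card {y \<in> edge_set n. \<tau> y \<le> \<theta> / K n} < k" and R_less: "R \<tau> < \<delta>"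
        using elim(3) by (auto simp: C1_def C2_def C3_def)
      have "ereal m \<le> passage n \<tau>" "passage n \<tau> \<le> ereal (m + R \<tau>)"
        unfolding m_def using True elim(1)
        by (intro passage_sandwich[where \<theta> = \<theta> and R = "R \<tau>"] n k(1) x conn few R; blast)+
      then obtain z where z: "passage n \<tau> = ereal z" "m \<le> z" "z \<le> m + R \<tau>"
        by (cases "passage n \<tau>") auto
      then have "\<bar>f (passage n \<tau>) - S1 \<tau>\<bar> \<le> \<eta>"
        unfolding z(1) S1 using R_less by (intro \<delta>(2)) auto
      moreover have "0 \<le> B * (S2 \<tau> + indicator C1 \<tau> + indicator C2 \<tau> + indicator C3 \<tau>)"
        unfolding S2 using B by (intro mult_nonneg_nonneg add_nonneg_nonneg) auto
      ultimately show ?thesis by linarith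
    next
      case False
      then have "1 \<le> S2 \<tau> + indicator C1 \<tau> + indicator C2 \<tau> + indicator C3 \<tau>"
        unfolding S2 by (auto simp: indicator_def)
      then have "B * 1 \<le> B * (S2 \<tau> + indicator C1 \<tau> + indicator C2 \<tau> + indicator C3 \<tau>)"
        using B by (intro mult_left_mono)
      then show ?thesis using triv \<eta> by linarith
    qed
  qed
  then have "(\<integral>\<tau>. \<bar>f (passage n \<tau>) - S1 \<tau>\<bar> \<partial>canon n)
      \<le> (\<integral>\<tau>. \<eta> + B * (S2 \<tau> + indicator C1 \<tau> + indicator C2 \<tau> + indicator C3 \<tau>) \<partial>canon n)"
    using S1_int S2_int f_int ind_int C1 C2 C3
    by (intro integral_mono_AE integrable_abs Bochner_Integration.integrable_diff
        Bochner_Integration.integrable_add integrable_mult_right) auto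
  also have "\<dots> = \<eta> + B * ((\<integral>\<tau>. S2 \<tau> \<partial>canon n) + measure (canon n) C1 + measure (canon n) C2 + measure (canon n) C3)"
    using S2_int ind_int C1 C2 C3 by (simp add: canon.prob_space)
  also have "\<dots> \<le> \<eta> + B * ((\<integral>\<tau>. S2 \<tau> \<partial>canon n) + measure (canon n) C1 + \<theta> / k + Q / \<delta>)"
  proof (intro add_left_mono mult_left_mono add_mono order_refl B)
    show "measure (canon n) C2 \<le> \<theta> / k"
      using prob_many_small[of k "\<theta> / K n" n] k(1) \<theta>(1) Kn by (simp add: C2_def)
    have "measure (canon n) C3 \<le> (\<integral>\<tau>. R \<tau> \<partial>canon n) / \<delta>"
      unfolding C3_def using R_nonneg \<delta>(1)
      by (intro integral_Markov_inequality_measure[where A = "{}"] R_int) auto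
    also have "\<dots> \<le> Q / \<delta>"
      using R_exp \<delta>(1) by (intro divide_right_mono) auto
    finally show "measure (canon n) C3 \<le> Q / \<delta>" .
  qed
  finally have "(\<integral>\<tau>. \<bar>f (passage n \<tau>) - S1 \<tau>\<bar> \<partial>canon n)
    \<le> \<eta> + B * ((\<integral>\<tau>. S2 \<tau> \<partial>canon n) + measure (canon n) C1 + \<theta> / k + Q / \<delta>)" .
  moreover have "\<bar>(\<integral>\<tau>. f (passage n \<tau>) \<partial>canon n) - (\<integral>\<tau>. S1 \<tau> \<partial>canon n)\<bar>
      \<le> (\<integral>\<tau>. \<bar>f (passage n \<tau>) - S1 \<tau>\<bar> \<partial>canon n)"
    using f_int S1_int by (simp add: integral_abs_bound flip: Bochner_Integration.integral_diff)
  ultimately show ?thesis unfolding S1_def S2_def C1_def by linarith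
qed

lemma passage_limit:
  fixes f :: "ereal \<Rightarrow> real"
  assumes s2: "s < 2" and model: "continuous_model N W U V"
    and f: "continuous_on UNIV f" "\<And>x. 0 \<le> f x" "\<And>x. f x \<le> B"
  shows "(\<lambda>n. \<integral>\<tau>. f (passage n \<tau>) \<partial>canon n) \<longlonglongrightarrow> (\<integral>\<omega>. f (continuous_last_passage s W U V \<omega>) \<partial>N)"
proof -
  interpret C: continuous_model N W U V by (rule model)
  have f_meas [measurable]: "f \<in> borel_measurable borel"
    using f(1) by (rule borel_measurable_continuous_onI)
  have f_lim: "((\<lambda>n. f (g n)) \<longlongrightarrow> f l) F'" if "(g \<longlongrightarrow> l) F'" for g l and F' :: "'z filter"
    using continuous_on_tendsto_compose[OF f(1) that] by simp
  have B: "0 \<le> B" using f(2,3) order_trans by blast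
  define A1 where "A1 = (\<lambda>k n. \<integral>\<tau>. smallest_value n k (chain_value f n k) \<tau> \<partial>canon n)"
  define A2 where "A2 = (\<lambda>k n. \<integral>\<tau>. smallest_value n k (bad_tuple n k) \<tau> \<partial>canon n)"
  define I where "I = (\<integral>\<omega>. f (continuous_last_passage s W U V \<omega>) \<partial>N)"
  define I' where "I' = (\<lambda>k. \<integral>\<omega>. f (ereal (C.top_weight s k \<omega>)) \<partial>N)"
  have tuples: "AE \<omega> in N. eventually (\<lambda>n. C.grid n k \<omega> \<in> tuples n k) sequentially" for k
    using C.AE_good by eventually_elim (use C.grid_eventually in \<open>force elim: eventually_mono\<close>)
  have sums: "C.good \<omega> \<Longrightarrow> i < k \<Longrightarrow> rescaled_sums n k (C.W_vec k \<omega>) i = (\<Sum>j\<le>i. W j \<omega>) / K n" for \<omega> i k n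
    by (simp add: rescaled_sums_def C.W_vec_def)
  have sums_pos: "0 < (\<Sum>j\<le>i. W j \<omega>)" if "C.good \<omega>" for \<omega> i
    using that by (intro sum_pos) (auto simp: C.good_def)
  have lim_A1: "A1 k \<longlonglongrightarrow> I' k" if k: "0 < k" for k
    unfolding A1_def I'_def
  proof (rule C.smallest_limit[OF k chain_value_measurable[OF f_meas] _ _ tuples, where B = B])
    show "AE \<omega> in N. (\<lambda>n. chain_value f n k (C.grid n k \<omega>) (rescaled_sums n k (C.W_vec k \<omega>)))
        \<longlonglongrightarrow> f (ereal (C.top_weight s k \<omega>))"
      using C.AE_good
    proof eventually_elim
      case (elim \<omega>)
      have "(\<lambda>n. max_weight (\<lambda>i. position U V i \<omega>) (\<lambda>i. normalizer n * h (rescaled_sums n k (C.W_vec k \<omega>) i)) {..<k})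
          \<longlonglongrightarrow> C.top_weight s k \<omega>"
        unfolding C.top_weight_def
      proof (rule max_weight_tendsto)
        fix i assume i: "i \<in> {..<k}"
        show "(\<lambda>n. normalizer n * h (rescaled_sums n k (C.W_vec k \<omega>) i)) \<longlonglongrightarrow> weight s W i \<omega>"
          using scaled_tendsto[OF sums_pos[OF elim, of i]] i by (simp add: sums[OF elim] scaled_eq weight_def)
      qed simp
      moreover have "eventually (\<lambda>n. max_weight (\<lambda>i. position U V i \<omega>) (\<lambda>i. normalizer n * h (rescaled_sums n k (C.W_vec k \<omega>) i)) {..<k}
          = max_weight (C.grid n k \<omega>) (\<lambda>i. normalizer n * h (rescaled_sums n k (C.W_vec k \<omega>) i)) {..<k}) sequentially"
        using C.grid_eventually[OF elim, of k] by eventually_elim (simp add: max_weight_def)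
      ultimately have "(\<lambda>n. max_weight (C.grid n k \<omega>) (\<lambda>i. normalizer n * h (rescaled_sums n k (C.W_vec k \<omega>) i)) {..<k})
          \<longlonglongrightarrow> C.top_weight s k \<omega>"
        by (rule Lim_transform_eventually)
      then show ?case unfolding chain_value_def by (intro f_lim tendsto_ereal)
    qed
  qed (use f in \<open>auto simp: chain_value_def\<close>)
  have lim_A2: "A2 k \<longlonglongrightarrow> 0" if k: "0 < k" for k
  proof -
    have "A2 k \<longlonglongrightarrow> (\<integral>\<omega>. 0 \<partial>N)"
      unfolding A2_def
    proof (rule C.smallest_limit[OF k bad_tuple_measurable[OF k] _ _ tuples, where B = 1])
      show "AE \<omega> in N. (\<lambda>n. bad_tuple n k (C.grid n k \<omega>) (rescaled_sums n k (C.W_vec k \<omega>))) \<longlonglongrightarrow> 0"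
        using C.AE_good
      proof eventually_elim
        case (elim \<omega>)
        have "(\<lambda>n. (\<Sum>j\<le>k - 1. W j \<omega>) / K n) \<longlonglongrightarrow> 0"
          by (rule real_tendsto_divide_at_top[OF tendsto_const K_at_top])
        then have "eventually (\<lambda>n. (\<Sum>j\<le>k - 1. W j \<omega>) / K n < p) sequentially"
          using p_pos by (rule order_tendstoD)
        with C.grid_eventually[OF elim, of k]
        have "eventually (\<lambda>n. bad_tuple n k (C.grid n k \<omega>) (rescaled_sums n k (C.W_vec k \<omega>)) = 0) sequentially"
          by eventually_elim (use k in \<open>simp add: bad_tuple_def sums[OF elim]\<close>)
        then show ?case by (rule tendsto_eventually)
      qed
    qed (auto simp: bad_tuple_def)
    then show ?thesis by simp
  qed
  have lim_I: "I' \<longlonglongrightarrow> I"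
    unfolding I'_def I_def
  proof (rule integral_dominated_convergence[where w = "\<lambda>_. B"])
    show "AE \<omega> in N. (\<lambda>k. f (ereal (C.top_weight s k \<omega>))) \<longlonglongrightarrow> f (continuous_last_passage s W U V \<omega>)"
      using f_lim[OF C.top_weight_tendsto] by simp
    show "(\<lambda>\<omega>. f (continuous_last_passage s W U V \<omega>)) \<in> borel_measurable N"
      by (rule measurable_compose[OF C.continuous_last_passage_measurable f_meas])
    show "(\<lambda>\<omega>. f (ereal (C.top_weight s k \<omega>))) \<in> borel_measurable N" for k by measurable
  qed (use f in auto)
  obtain \<psi> where \<psi>: "\<psi> \<longlonglongrightarrow> 0"
    and tail: "eventually (\<lambda>n. \<forall>i. (\<Sum>j | 2 ^ i * 2 ^ j < K n. scaled n (2 ^ i * 2 ^ j) * (4 * sqrt (2 ^ i * 2 ^ j) / ln 2)) \<le> \<psi> i) sequentially"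
    using scaled_tail_sum[OF s2] by blast
  show ?thesis
    unfolding I_def[symmetric]
  proof (rule tendstoI)
    fix e :: real assume e: "0 < e"
    define \<eta> where "\<eta> = e / 8"
    have \<eta>: "0 < \<eta>" using e by (simp add: \<eta>_def)
    obtain \<delta> where \<delta>: "0 < \<delta>" "\<And>x y. \<bar>x - y\<bar> \<le> \<delta> \<Longrightarrow> \<bar>f (ereal x) - f (ereal y)\<bar> < \<eta>"
      using ereal_uniformly_continuous[OF f(1) \<eta>] by blast
    have "(\<lambda>i. B * (\<psi> i / \<delta>)) \<longlonglongrightarrow> B * (0 / \<delta>)"
      using \<delta>(1) by (intro tendsto_intros \<psi>) auto
    then have "eventually (\<lambda>i. B * (\<psi> i / \<delta>) < \<eta>) sequentially"
      using \<eta> by (intro order_tendstoD) auto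
    then obtain i where i: "B * (\<psi> i / \<delta>) < \<eta>" by (auto simp: eventually_sequentially)
    define \<theta> where "\<theta> = (2::real) ^ i"
    have "(\<lambda>k. B * (\<theta> / real k)) \<longlonglongrightarrow> B * 0"
      by (intro tendsto_mult tendsto_const lim_const_over_n)
    then have "eventually (\<lambda>k. B * (\<theta> / real k) < \<eta>) sequentially"
      using \<eta> by (intro order_tendstoD) auto
    moreover have "eventually (\<lambda>k. dist (I' k) I < \<eta>) sequentially" by (rule tendstoD[OF lim_I \<eta>])
    moreover have "eventually (\<lambda>k::nat. 0 < k) sequentially" by (rule eventually_gt_at_top)
    ultimately have "eventually (\<lambda>k. B * (\<theta> / real k) < \<eta> \<and> dist (I' k) I < \<eta> \<and> 0 < k) sequentially"
      by eventually_elim simp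
    then obtain k where k: "B * (\<theta> / real k) < \<eta>" "\<bar>I' k - I\<bar> < \<eta>" "0 < k"
      by (auto simp: eventually_sequentially dist_real_def)
    have "(\<lambda>n. B * A2 k n) \<longlonglongrightarrow> B * 0" by (intro tendsto_mult tendsto_const lim_A2 k)
    then have ev2: "eventually (\<lambda>n. B * A2 k n < \<eta>) sequentially"
      using \<eta> by (intro order_tendstoD) auto
    define P where "P = (\<lambda>n. measure (canon n) {\<tau> \<in> space (canon n). \<not> connected_gaps (\<lambda>x. \<tau> x < p) n (sqrt n)})"
    have "(\<lambda>n. B * P n) \<longlonglongrightarrow> B * 0"
      unfolding P_def by (intro tendsto_mult tendsto_const prob_not_connected_tendsto_0 p_pos p_le)
    then have evP: "eventually (\<lambda>n. B * P n < \<eta>) sequentially"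
      using \<eta> by (intro order_tendstoD) auto
    have evK: "eventually (\<lambda>n. max \<theta> (real k) < K n) sequentially"
      by (rule filterlim_at_top_dense[THEN iffD1, OF K_at_top, rule_format])
    have evA: "eventually (\<lambda>n. dist (A1 k n) (I' k) < \<eta>) sequentially"
      by (rule tendstoD[OF lim_A1[OF k(3)] \<eta>])
    from ev2 evP evK evA tail eventually_ge_at_top[of 2]
    show "eventually (\<lambda>n. dist (\<integral>\<tau>. f (passage n \<tau>) \<partial>canon n) I < e) sequentially"
    proof eventually_elim
      case (elim n)
      have kn: "k \<le> card (edge_set n)" "\<theta> < K n" using elim(3) by auto
      define Q where "Q = (\<Sum>j | \<theta> * 2 ^ j < K n. scaled n (\<theta> * 2 ^ j) * (4 * sqrt (\<theta> * 2 ^ j) / ln 2))"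
      have Q: "B * (Q / \<delta>) \<le> B * (\<psi> i / \<delta>)"
        using elim(5) \<delta>(1) B unfolding Q_def \<theta>_def by (intro mult_left_mono divide_right_mono) auto
      have "\<bar>(\<integral>\<tau>. f (passage n \<tau>) \<partial>canon n) - A1 k n\<bar> \<le> \<eta> + B * (A2 k n + P n + \<theta> / k + Q / \<delta>)"
        unfolding A1_def A2_def P_def Q_def
        by (rule passage_approximation[OF elim(6) k(3) kn(1) _ kn(2) f_meas f(2,3) \<delta>(1)])
          (use \<delta>(2) in \<open>auto simp: \<theta>_def less_imp_le\<close>)
      also have "B * (A2 k n + P n + \<theta> / k + Q / \<delta>) = B * A2 k n + B * P n + B * (\<theta> / real k) + B * (Q / \<delta>)"
        by (simp add: distrib_left)
      finally have "\<bar>(\<integral>\<tau>. f (passage n \<tau>) \<partial>canon n) - A1 k n\<bar> < 5 * \<eta>"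
        using elim(1,2) k(1) Q i by linarith
      moreover have "\<bar>A1 k n - I' k\<bar> < \<eta>" using elim(4) by (simp add: dist_real_def)
      ultimately have "\<bar>(\<integral>\<tau>. f (passage n \<tau>) \<partial>canon n) - I\<bar> < 7 * \<eta>" using k(2) by linarith
      also have "\<dots> < e" using e by (simp add: \<eta>_def)
      finally show ?case by (simp add: dist_real_def)
    qed
  qed
qed

end

section \<open>The discrete model\<close>

context discrete_model
begin

definition thinned :: "int \<times> int \<Rightarrow> 'a \<Rightarrow> real" where
  "thinned x \<omega> = v x \<omega> * of_bool (e x \<omega>)"

abbreviation "Y \<equiv> case_sum v (\<lambda>x \<omega>. of_bool (e x \<omega>))"

lemma Y_measurable: "j \<in> edges <+> edges \<Longrightarrow> Y j \<in> borel_measurable M"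
  using indep by (auto simp: indep_vars_def)

lemma v_measurable: "x \<in> edges \<Longrightarrow> v x \<in> borel_measurable M"
  using Y_measurable[of "Inl x"] by (simp add: Plus_def)

lemma e_measurable: "x \<in> edges \<Longrightarrow> Measurable.pred M (e x)"
proof -
  assume x: "x \<in> edges"
  then have "(\<lambda>\<omega>. of_bool (e x \<omega>) :: real) \<in> borel_measurable M"
    using Y_measurable[of "Inr x"] by (simp add: Plus_def)
  then have "Measurable.pred M (\<lambda>\<omega>. 0 < (of_bool (e x \<omega>) :: real))"
    by (intro borel_measurable_pred_less) auto
  then show ?thesis by simp
qed

lemma edge_set_subset: "edge_set n \<subseteq> edges"
  by (auto simp: edge_set_def edges_def)

lemma indep_thinned: "indep_vars (\<lambda>_. borel) thinned (edge_set n)"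
proof -
  define K where "K = (\<lambda>x. {Inl x, Inr x} :: ((int \<times> int) + (int \<times> int)) set)"
  have K: "K x \<subseteq> edges <+> edges" if "x \<in> edge_set n" for x
    using that edge_set_subset by (auto simp: K_def)
  have "disjoint_family_on K (edge_set n)" by (auto simp: disjoint_family_on_def K_def)
  then have "indep_vars (\<lambda>x. PiM (K x) (\<lambda>_. borel)) (\<lambda>x \<omega>. restrict (\<lambda>j. Y j \<omega>) (K x)) (edge_set n)"
    by (intro indep_vars_restrict[OF indep K])
  then have "indep_vars (\<lambda>_. borel) (\<lambda>x \<omega>. (\<lambda>r. r (Inl x) * r (Inr x)) (restrict (\<lambda>j. Y j \<omega>) (K x))) (edge_set n)"
  proof (rule indep_vars_compose2)
    fix x
    have "(\<lambda>r. r (Inl x)) \<in> borel_measurable (PiM (K x) (\<lambda>_. borel :: real measure))"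
      "(\<lambda>r. r (Inr x)) \<in> borel_measurable (PiM (K x) (\<lambda>_. borel :: real measure))"
      by (rule measurable_component_singleton, simp add: K_def)+
    then show "(\<lambda>r. r (Inl x) * r (Inr x)) \<in> borel_measurable (PiM (K x) (\<lambda>_. borel :: real measure))"
      by (rule borel_measurable_times)
  qed
  then show ?thesis by (simp add: K_def thinned_def[abs_def])
qed

lemma thinned_measurable: "x \<in> edges \<Longrightarrow> thinned x \<in> borel_measurable M"
  unfolding thinned_def[abs_def] using Y_measurable[of "Inl x"] Y_measurable[of "Inr x"]
  by (intro borel_measurable_times) (auto simp: Plus_def)

lemma prob_thinned_le:
  assumes x: "x \<in> edges" and y: "0 \<le> y"
  shows "prob {\<omega> \<in> space M. thinned x \<omega> \<le> y} = 1 - p * (1 - F y)"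
proof -
  note [measurable] = v_measurable[OF x] e_measurable[OF x] thinned_measurable[OF x]
  let ?J = "{Inl x, Inr x} :: ((int \<times> int) + (int \<times> int)) set"
  define A where "A = (\<lambda>j :: (int \<times> int) + (int \<times> int). if j = Inl x then {y<..} else {1::real})"
  have "indep_vars (\<lambda>_. borel) Y ?J" using indep by (rule indep_vars_subset) (use x in auto)
  then have "prob (\<Inter>j\<in>?J. Y j -` A j \<inter> space M) = (\<Prod>j\<in>?J. prob (Y j -` A j \<inter> space M))"
    by (rule indep_varsD_finite) (auto simp: A_def)
  also have "\<dots> = prob (v x -` {y<..} \<inter> space M) * prob ((\<lambda>\<omega>. of_bool (e x \<omega>) :: real) -` {1} \<inter> space M)"
    by (simp add: A_def)
  also have "prob ((\<lambda>\<omega>. of_bool (e x \<omega>) :: real) -` {1} \<inter> space M) = p"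
  proof -
    have "(\<lambda>\<omega>. of_bool (e x \<omega>) :: real) -` {1} \<inter> space M = {\<omega> \<in> space M. e x \<omega>}" by auto
    then show ?thesis using e_prob[OF x] by simp
  qed
  also have "prob (v x -` {y<..} \<inter> space M) = 1 - F y"
  proof -
    have "F y = prob {\<omega> \<in> space M. v x \<omega> \<le> y}"
    proof -
      have "F y = measure (distr M borel (v x)) {..y}" by (simp add: v_cdf[OF x, symmetric] cdf_def)
      also have "\<dots> = prob {\<omega> \<in> space M. v x \<omega> \<le> y}"
        by (subst measure_distr) (auto intro!: arg_cong[where f = prob])
      finally show ?thesis .
    qed
    moreover have "v x -` {y<..} \<inter> space M = space M - {\<omega> \<in> space M. v x \<omega> \<le> y}" by auto
    ultimately show ?thesis by (simp add: prob_compl)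
  qed
  also have "(\<Inter>j\<in>?J. Y j -` A j \<inter> space M) = space M - {\<omega> \<in> space M. thinned x \<omega> \<le> y}"
    using y by (auto simp: A_def thinned_def)
  finally have "1 - prob {\<omega> \<in> space M. thinned x \<omega> \<le> y} = (1 - F y) * p"
    by (subst (asm) prob_compl) measurable
  then show ?thesis by (simp add: algebra_simps)
qed

lemma AE_thinned_nonneg: "x \<in> edges \<Longrightarrow> AE \<omega> in M. 0 \<le> thinned x \<omega>"
  using v_pos[of x] by (auto simp: thinned_def elim!: eventually_mono)

lemma AE_v_pos: "AE \<omega> in M. \<forall>x\<in>edge_set n. 0 < v x \<omega>"
  using edge_set_subset by (intro AE_finite_allI finite_edge_set v_pos) auto

lemma last_passage_eq:
  assumes "\<forall>x\<in>edge_set n. 0 < v x \<omega>"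
  shows "last_passage v e n \<omega> = lpp n (\<lambda>x. thinned x \<omega>)"
proof -
  have "paths (\<lambda>x. e x \<omega>) 0 (int n) = paths (\<lambda>x. 0 < thinned x \<omega>) 0 (int n)"
    using assms by (intro paths_cong) (auto simp: thinned_def)
  moreover have "path_weight (\<lambda>x. v x \<omega>) is = path_weight (\<lambda>x. thinned x \<omega>) is"
    if "is \<in> paths (\<lambda>x. e x \<omega>) 0 (int n)" for "is"
    using that by (auto simp: path_weight_def paths_def thinned_def intro!: sum.cong)
  ultimately show ?thesis unfolding last_passage_def lpp_def by (intro SUP_cong) auto
qed

lemma last_passage_measurable: "last_passage v e n \<in> borel_measurable M"
  unfolding last_passage_def[abs_def]
  using edge_set_subset by (intro measurable_SUP_paths v_measurable e_measurable) auto

lemma heavy_tail_model: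
  assumes "0 < s" "0 < p" "p \<le> 1"
    and "\<And>t. 0 < t \<Longrightarrow> ((\<lambda>x. (1 - F (t * x)) / (1 - F x)) \<longlongrightarrow> t powr (- s)) at_top"
  shows "heavy_tail F s p"
proof -
  have x: "(0, 1) \<in> edges" by (simp add: edges_def)
  interpret v: real_distribution "distr M borel (v (0, 1))"
    by (rule real_distribution_distr[OF v_measurable[OF x]])
  have F: "F = cdf (distr M borel (v (0, 1)))" using v_cdf[OF x] by simp
  show ?thesis
  proof
    show "mono F" unfolding F by (intro monoI v.cdf_nondecreasing)
    show "continuous (at_right y) F" for y unfolding F by (rule v.cdf_is_right_cont)
    show "(F \<longlongrightarrow> 1) at_top" unfolding F by (rule v.cdf_lim_at_top_prob)
    have "prob (v (0, 1) -` {..0} \<inter> space M) = 0"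
    proof -
      have "AE \<omega> in M. \<omega> \<notin> v (0, 1) -` {..0} \<inter> space M"
        using v_pos[OF x] by eventually_elim auto
      then show ?thesis using measurable_sets[OF v_measurable[OF x], of "{..0}"] by (subst prob_eq_0) auto
    qed
    then show "F 0 = 0" unfolding F cdf_def using v_measurable[OF x] by (simp add: measure_distr)
  qed (use assms in auto)
qed

lemma distr_thinned:
  assumes "heavy_tail F s p" and x: "x \<in> edges"
  shows "distr M borel (thinned x) = distr unif borel (tail_inverse F p)"
proof -
  interpret heavy_tail F s p by fact
  interpret A: real_distribution "distr M borel (thinned x)"
    by (rule real_distribution_distr[OF thinned_measurable[OF x]])
  have h_meas: "tail_inverse F p \<in> measurable unif borel"
    by (simp add: measurable_cong_sets[OF sets_unif refl] tail_inverse_measurable)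
  interpret B: real_distribution "distr unif borel (tail_inverse F p)"
    by (rule unif.real_distribution_distr[OF h_meas])
  show ?thesis
  proof (rule cdf_unique)
    show "real_distribution (distr M borel (thinned x))" by (rule A.real_distribution_axioms)
    show "real_distribution (distr unif borel (tail_inverse F p))" by (rule B.real_distribution_axioms)
    show "cdf (distr M borel (thinned x)) = cdf (distr unif borel (tail_inverse F p))"
    proof
      fix y
      have l: "cdf (distr M borel (thinned x)) y = prob {\<omega> \<in> space M. thinned x \<omega> \<le> y}"
        unfolding cdf_def using thinned_measurable[OF x]
        by (subst measure_distr) (auto intro!: arg_cong[where f = prob])
      have r: "cdf (distr unif borel (tail_inverse F p)) y = measure unif {u. h u \<le> y}"
        unfolding cdf_def using h_meas
        by (subst measure_distr) (auto intro!: arg_cong[where f = "measure unif"])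
      have h_sets: "{u. h u \<le> z} \<in> sets unif" for z
        using measurable_sets[OF h_meas, of "{..z}"] by (simp add: vimage_def)
      show "cdf (distr M borel (thinned x)) y = cdf (distr unif borel (tail_inverse F p)) y"
      proof (cases "0 \<le> y")
        case True
        have "0 \<le> T y" "T y \<le> 1"
          using T_pos[of y] T_antimono[OF True] F_zero p_le by auto
        have "measure unif {u. h u \<le> y} = measure unif (space unif - {..<T y})"
        proof (rule unif.finite_measure_eq_AE)
          show "AE u in unif. (u \<in> {u. h u \<le> y}) = (u \<in> space unif - {..<T y})"
            using AE_unif by eventually_elim (use tail_inverse_le_iff True in auto)
        qed (use h_sets in auto)
        also have "\<dots> = 1 - T y"
          using \<open>0 \<le> T y\<close> \<open>T y \<le> 1\<close> by (subst unif.prob_compl) (simp_all add: measure_unif_lessThan)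
        finally show ?thesis unfolding l r using prob_thinned_le[OF x True] by simp
      next
        case False
        have "prob {\<omega> \<in> space M. thinned x \<omega> \<le> y} = 0"
          by (rule prob_eq_0_AE) (use AE_thinned_nonneg[OF x] False in \<open>auto elim!: eventually_mono\<close>)
        moreover have "measure unif {u. h u \<le> y} = 0"
        proof (subst unif.prob_eq_0)
          show "{u. h u \<le> y} \<in> sets unif" by (rule h_sets)
          show "AE u in unif. u \<notin> {u. h u \<le> y}"
            using AE_unif
          proof eventually_elim
            case (elim u)
            then show ?case using tail_inverse_in(1)[of u] False by auto
          qed
        qed
        ultimately show ?thesis unfolding l r by simp
      qed
    qed
  qed
qed

lemma expectation_last_passage:
  fixes f :: "ereal \<Rightarrow> real"
  assumes ht: "heavy_tail F s p" and n: "0 < n" and a: "0 < a" and f: "f \<in> borel_measurable borel"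
  shows "(\<integral>\<omega>. f (ereal a * last_passage v e n \<omega>) \<partial>M) = (\<integral>\<tau>. f (lpp n (\<lambda>x. a * tail_inverse F p (\<tau> x))) \<partial>canon n)"
proof -
  interpret heavy_tail F s p by (rule ht)
  let ?E = "edge_set n" and ?P = "PiM (edge_set n) (\<lambda>_. borel :: real measure)"
  have "(0, 1) \<in> ?E" using n by (auto simp: edge_set_def)
  then have ne: "?E \<noteq> {}" by blast
  define g where "g = (\<lambda>c. f (lpp n (\<lambda>x. a * c x)))"
  have g: "g \<in> borel_measurable ?P"
    unfolding g_def lpp_def
  proof (rule measurable_compose[OF measurable_SUP_paths f])
    fix x assume x: "x \<in> ?E"
    show m: "(\<lambda>c. a * c x) \<in> borel_measurable ?P"
      using x by (intro borel_measurable_times borel_measurable_const measurable_component_singleton)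
    show "Measurable.pred ?P (\<lambda>c. 0 < a * c x)"
      using m by (intro borel_measurable_pred_less) auto
  qed
  have g_restrict: "g (restrict c ?E) = g c" for c
    unfolding g_def by (intro arg_cong[where f = f] lpp_cong) simp
  have rv: "thinned x \<in> borel_measurable M" if "x \<in> ?E" for x
    using that edge_set_subset by (intro thinned_measurable) auto
  have rvE: "(\<lambda>\<omega>. \<lambda>x\<in>?E. thinned x \<omega>) \<in> measurable M ?P"
    using rv by (intro measurable_restrict)
  have h_meas: "h \<in> measurable unif borel"
    by (simp add: measurable_cong_sets[OF sets_unif refl] tail_inverse_measurable)
  have hE: "compose ?E h \<in> measurable (canon n) ?P"
    unfolding compose_def
    by (intro measurable_restrict measurable_compose[OF measurable_canon_component tail_inverse_measurable])
  have "distr M ?P (\<lambda>\<omega>. \<lambda>x\<in>?E. thinned x \<omega>) = PiM ?E (\<lambda>x. distr M borel (thinned x))"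
    using indep_vars_iff_distr_eq_PiM'[where X = thinned and M' = "\<lambda>_. borel", OF ne rv] indep_thinned
    by simp
  also have "\<dots> = PiM ?E (\<lambda>x. distr unif borel h)"
    using edge_set_subset by (intro PiM_cong refl distr_thinned[OF ht]) auto
  also have "\<dots> = distr (canon n) ?P (compose ?E h)"
  proof -
    define Q where "Q = distr unif borel h"
    have Q: "prob_space Q" "sets Q = sets borel"
      unfolding Q_def using unif.prob_space_distr[OF h_meas] by auto
    have "distr (canon n) ?P (compose ?E h) = distr (canon n) (PiM ?E (\<lambda>_. Q)) (compose ?E h)"
      by (intro distr_cong refl sets_PiM_cong) (simp add: Q)
    also have "\<dots> = PiM ?E (\<lambda>_. distr unif Q h)"
      unfolding canon_def using h_meas Q unif.prob_space_axioms finite_edge_set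
      by (intro distr_PiM_finite_prob_space') (auto cong: measurable_cong_sets)
    also have "distr unif Q h = distr unif borel h"
      by (intro distr_cong) (simp_all add: Q)
    finally show ?thesis ..
  qed
  finally have law: "distr M ?P (\<lambda>\<omega>. \<lambda>x\<in>?E. thinned x \<omega>) = distr (canon n) ?P (compose ?E h)" .
  have "(\<integral>\<omega>. f (ereal a * last_passage v e n \<omega>) \<partial>M) = (\<integral>\<omega>. g (\<lambda>x\<in>?E. thinned x \<omega>) \<partial>M)"
  proof (rule integral_cong_AE)
    show "(\<lambda>\<omega>. f (ereal a * last_passage v e n \<omega>)) \<in> borel_measurable M"
      by (intro measurable_compose[OF _ f] borel_measurable_ereal_times borel_measurable_const last_passage_measurable)
    show "(\<lambda>\<omega>. g (\<lambda>x\<in>?E. thinned x \<omega>)) \<in> borel_measurable M"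
      by (rule measurable_compose[OF rvE g])
    show "AE \<omega> in M. f (ereal a * last_passage v e n \<omega>) = g (\<lambda>x\<in>?E. thinned x \<omega>)"
      using AE_v_pos[of n]
    proof eventually_elim
      case (elim \<omega>)
      then show ?case
        unfolding g_restrict by (simp add: g_def last_passage_eq lpp_cmult[OF a])
    qed
  qed
  also have "\<dots> = (\<integral>c. g c \<partial>distr M ?P (\<lambda>\<omega>. \<lambda>x\<in>?E. thinned x \<omega>))"
    by (rule integral_distr[symmetric, OF rvE g])
  also have "\<dots> = (\<integral>\<tau>. g (compose ?E h \<tau>) \<partial>canon n)"
    unfolding law by (rule integral_distr[OF hE g])
  also have "\<dots> = (\<integral>\<tau>. f (lpp n (\<lambda>x. a * h (\<tau> x))) \<partial>canon n)"
    unfolding compose_def g_restrict by (simp add: g_def)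
  finally show ?thesis .
qed

end

theorem theorem2p7:
  fixes M :: "'a measure" and N :: "'b measure"
    and s p :: real and F :: "real \<Rightarrow> real"
    and v :: "int \<times> int \<Rightarrow> 'a \<Rightarrow> real" and e :: "int \<times> int \<Rightarrow> 'a \<Rightarrow> bool"
    and W U V :: "nat \<Rightarrow> 'b \<Rightarrow> real"
  assumes "0 < s" and "s < 2"
    and "0 < p" and "p \<le> 1"
    and "discrete_model M p F v e"
    and "continuous_model N W U V"
    and "\<And>t. 0 < t \<Longrightarrow> ((\<lambda>x. (1 - F (t * x)) / (1 - F x)) \<longlongrightarrow> t powr (- s)) at_top"
  shows "converges_in_distribution
           M (\<lambda>n \<omega>. ereal (p powr (- 1 / s)) * last_passage v e n \<omega> / ereal (scaling F n))
           N (continuous_last_passage s W U V)"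
proof -
  interpret D: discrete_model M p F v e by fact
  interpret C: continuous_model N W U V by fact
  have ht: "heavy_tail F s p" by (rule D.heavy_tail_model) fact+
  interpret heavy_tail F s p by (rule ht)
  let ?X = "\<lambda>n \<omega>. ereal (p powr (- 1 / s)) * last_passage v e n \<omega> / ereal (scaling F n)"
  have X_meas: "?X n \<in> borel_measurable M" for n
    using D.last_passage_measurable by (intro borel_measurable_ereal_divide borel_measurable_ereal_times) auto
  have X_eq: "?X n \<omega> = ereal (normalizer n) * last_passage v e n \<omega>" if n: "2 \<le> n" for n \<omega>
  proof -
    have b: "scaling F n = h (p / K n)" using scaling_eq[OF n] by (simp add: card_edge_set)
    have "0 < h (p / K n)" using normalizer_pos[OF n] p_pos tail_inverse_in(1)[of "p / K n"] K_pos[of n] n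
      by (auto simp: normalizer_def zero_less_divide_iff)
    then have "inverse (ereal (h (p / K n))) = ereal (inverse (h (p / K n)))" by simp
    then show ?thesis
      unfolding b divide_ereal_def by (simp add: normalizer_def divide_inverse mult.assoc mult.commute mult.left_commute flip: times_ereal.simps(1))
  qed
  have limit_nonneg: "(\<lambda>n. \<integral>\<omega>. f (?X n \<omega>) \<partial>M) \<longlonglongrightarrow> (\<integral>\<omega>. f (continuous_last_passage s W U V \<omega>) \<partial>N)"
    if f: "continuous_on UNIV f" "\<And>x. 0 \<le> f x" "\<And>x. f x \<le> B" for f :: "ereal \<Rightarrow> real" and B
  proof -
    have "(\<lambda>n. \<integral>\<tau>. f (passage n \<tau>) \<partial>canon n) \<longlonglongrightarrow> (\<integral>\<omega>. f (continuous_last_passage s W U V \<omega>) \<partial>N)"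
      by (rule passage_limit[OF assms(2,6) f])
    moreover have "eventually (\<lambda>n. (\<integral>\<tau>. f (passage n \<tau>) \<partial>canon n) = (\<integral>\<omega>. f (?X n \<omega>) \<partial>M)) sequentially"
      using eventually_ge_at_top[of 2]
    proof eventually_elim
      case (elim n)
      have "(\<integral>\<omega>. f (?X n \<omega>) \<partial>M) = (\<integral>\<omega>. f (ereal (normalizer n) * last_passage v e n \<omega>) \<partial>M)"
        by (simp only: X_eq[OF elim])
      also have "\<dots> = (\<integral>\<tau>. f (passage n \<tau>) \<partial>canon n)"
        unfolding passage_def using elim normalizer_pos[OF elim] f(1)
        by (intro D.expectation_last_passage[OF ht] borel_measurable_continuous_onI) auto
      finally show ?case by simp
    qed
    ultimately show ?thesis by (rule Lim_transform_eventually)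
  qed
  show ?thesis
    unfolding converges_in_distribution_def
  proof (intro conjI allI impI X_meas C.continuous_last_passage_measurable)
    fix f :: "ereal \<Rightarrow> real" assume f: "continuous_on UNIV f" "bounded (range f)"
    obtain B where B: "\<And>x. \<bar>f x\<bar> \<le> B" using f(2) by (auto simp: bounded_iff)
    have f_meas: "f \<in> borel_measurable borel" using f(1) by (rule borel_measurable_continuous_onI)
    have int_X: "integrable M (\<lambda>\<omega>. f (?X n \<omega>))" for n
      by (rule D.integrable_const_bound[where B = B]) (use B measurable_compose[OF X_meas f_meas] in auto)
    have int_Y: "integrable N (\<lambda>\<omega>. f (continuous_last_passage s W U V \<omega>))"
      by (rule C.integrable_const_bound[where B = B])
        (use B measurable_compose[OF C.continuous_last_passage_measurable f_meas] in auto)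
    have "(\<lambda>n. \<integral>\<omega>. f (?X n \<omega>) + B \<partial>M) \<longlonglongrightarrow> (\<integral>\<omega>. f (continuous_last_passage s W U V \<omega>) + B \<partial>N)"
    proof (rule limit_nonneg[of "\<lambda>x. f x + B" "2 * B"])
      show "continuous_on UNIV (\<lambda>x. f x + B)" using f(1) by (intro continuous_intros)
      show "0 \<le> f x + B" "f x + B \<le> 2 * B" for x using B[of x] by linarith+
    qed
    then have "(\<lambda>n. (\<integral>\<omega>. f (?X n \<omega>) \<partial>M) + B) \<longlonglongrightarrow> (\<integral>\<omega>. f (continuous_last_passage s W U V \<omega>) \<partial>N) + B"
      using int_X int_Y by (simp add: D.prob_space C.prob_space)
    from tendsto_diff[OF this tendsto_const[of B]]
    show "(\<lambda>n. \<integral>\<omega>. f (?X n \<omega>) \<partial>M) \<longlonglongrightarrow> (\<integral>\<omega>. f (continuous_last_passage s W U V \<omega>) \<partial>N)" by simp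
  qed
qed

end
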